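(* Let $(X,\omega)$ be a compact Kähler manifold with $\dim_{\mathbb C}X=n$ and let $m\in\{1,\dots,n-1\}$. Fix a volume form $dV\in C^\infty_{n,n}(X,\mathbb R)$ with $dV>0$ and a form $\alpha\in C^\infty_{m,m}(X,\mathbb R)$ such that $d\alpha=0$ and $\alpha>0$ strongly on $X$. Suppose there exist $u_1,u_2\in C^\infty_{m-1,m-1}(X,\mathbb R)$ such that $$\Big[\star_\omega\big((\alpha+i\partial\bar\partial u_1)\wedge\omega_{n-m-1}\big)\Big]^n=\Big[\star_\omega\big((\alpha+i\partial\bar\partial u_2)\wedge\omega_{n-m-1}\big)\Big]^n,$$ satisfying $$\alpha+i\partial\bar\partial u_j>0\ \text{(strongly)}\quad\text{and}\quad u_j\in\ker\partial^\star_\omega\cap\ker\bar\partial^\star_\omega,\qquad j=1,2,$$ and, furthermore, $(u_1)_{prim}^{(l)}=(u_2)_{prim}^{(l)}$ for $l=0,\dots,m-2$. Then there exists a constant $C\in\mathbb R$ such that $$u_1=u_2+C\,\omega^{m-1}.$$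
   Context: Manifolds are assumed connected. $C^\infty_{p,p}(X,\mathbb R)$ is the space of real smooth $(p,p)$-forms; $\omega_p:=\omega^p/p!$. $\star_\omega$ is the Hodge star: $u\wedge\star_\omega\bar v=\langle u,v\rangle_\omega\,\omega^n/n!$. $\partial^\star_\omega,\bar\partial^\star_\omega$ are the formal adjoints of $\partial,\bar\partial$. A form of bidegree $(m,m)$ is strongly positive, $>0$ (strongly), if at each point it lies in the interior of the convex cone of finite sums of $i\eta_1\wedge\bar\eta_1\wedge\dots\wedge i\eta_m\wedge\bar\eta_m$ with $\eta_j$ of type $(1,0)$. Lefschetz decomposition: a $(p,q)$-form $v$ is $\omega$-primitive if $p+q\le n$ and $v\wedge\omega^{n-p-q+1}=0$. Every $(r,r)$-form $\zeta$ is uniquely written $\zeta=\sum_{l=0}^r\zeta^{(l)}_{prim}\wedge\omega^l$ with $\zeta^{(l)}_{prim}$ an $\omega$-primitive $(r-l,r-l)$-form (with $\zeta_{prim}^{(l)}:=0$ for $l<2r-n$). *)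

theory Defs
  imports "HOL-Analysis.Analysis" "HOL-Library.Function_Algebras"
begin

text \<open>
  The model tangent space is \<^typ>\<open>complex ^ 'n\<close>, regarded as a real vector space of dimension
  \<open>2 * CARD('n)\<close>; multiplication by the imaginary unit is the complex structure \<open>J\<close>.
  The complex dimension of the manifold is \<open>CARD('n)\<close>.
\<close>

section \<open>Exterior algebra at a point\<close>

text \<open>
  A complex-valued exterior form is a function on lists of tangent vectors; a \<open>k\<close>-form is
  supported on the lists of length \<open>k\<close>. Sums and \<open>0\<close> are the pointwise ones of
  \<^theory>\<open>HOL-Library.Function_Algebras\<close>.
\<close>

type_synonym 'n ext = "(complex ^ 'n) list \<Rightarrow> complex"

definition alt_form :: "nat \<Rightarrow> 'n::finite ext \<Rightarrow> bool" where
  "alt_form k a \<longleftrightarrow>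
     (\<forall>vs. length vs \<noteq> k \<longrightarrow> a vs = 0) \<and>
     (\<forall>vs. length vs = k \<longrightarrow> (\<forall>i<k. linear (\<lambda>v. a (vs[i := v])))) \<and>
     (\<forall>vs. \<not> distinct vs \<longrightarrow> a vs = 0)"

text \<open>
  On the wedge of \<open>p\<close> forms \<open>dz\<^sub>i\<close> and \<open>q\<close> conjugates of forms \<open>dz\<^sub>j\<close>, scaling all arguments by a
  complex number \<open>c\<close> multiplies by \<open>c^p * cnj c^q\<close>. As these characters are distinct for the different
  \<open>(p, q)\<close> with \<open>p + q = k\<close>, this weight singles out the summand of type \<open>(p, q)\<close> among the
  \<open>k\<close>-forms.
\<close>

definition bidegree :: "nat \<Rightarrow> nat \<Rightarrow> 'n::finite ext \<Rightarrow> bool" where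
  "bidegree p q a \<longleftrightarrow> alt_form (p + q) a \<and>
     (\<forall>c vs. length vs = p + q \<longrightarrow> a (map (\<lambda>v. c *s v) vs) = c ^ p * cnj c ^ q * a vs)"

definition ext_scale :: "complex \<Rightarrow> 'n::finite ext \<Rightarrow> 'n ext" where
  "ext_scale c a = (\<lambda>vs. c * a vs)"

definition ext_cnj :: "'n::finite ext \<Rightarrow> 'n ext" where
  "ext_cnj a = (\<lambda>vs. cnj (a vs))"

text \<open>
  The wedge product as a signed sum over shuffles, i.e. normalised so that
  \<open>(a \<and> b) [v, w] = a [v] * b [w] - a [w] * b [v]\<close> for one-forms.
\<close>

definition wedge :: "'n::finite ext \<Rightarrow> 'n ext \<Rightarrow> 'n ext" where
  "wedge a b = (\<lambda>vs. \<Sum>S\<in>Pow {..<length vs}.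
     (-1) ^ card {(i, j). i < j \<and> j < length vs \<and> i \<notin> S \<and> j \<in> S} *
     a (nths vs S) * b (nths vs (- S)))"

definition ext_one :: "'n::finite ext" where
  "ext_one = (\<lambda>vs. if vs = [] then 1 else 0)"

primrec wedge_pow :: "'n::finite ext \<Rightarrow> nat \<Rightarrow> 'n ext" where
  "wedge_pow a 0 = ext_one"
| "wedge_pow a (Suc k) = wedge a (wedge_pow a k)"

primrec wedge_list :: "'n::finite ext list \<Rightarrow> 'n ext" where
  "wedge_list [] = ext_one"
| "wedge_list (a # as) = wedge a (wedge_list as)"

subsection \<open>Strong positivity\<close>

definition real_forms_at :: "nat \<Rightarrow> 'n::finite ext set" where
  "real_forms_at m = {a. bidegree m m a \<and> ext_cnj a = a}"

definition strong_cone :: "nat \<Rightarrow> 'n::finite ext set" where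
  "strong_cone m = {a. \<exists>N (\<eta> :: nat \<Rightarrow> nat \<Rightarrow> 'n ext).
     (\<forall>k<N. \<forall>j<m. bidegree 1 0 (\<eta> k j)) \<and>
     a = (\<Sum>k<N. wedge_list
            (map (\<lambda>j. ext_scale \<i> (wedge (\<eta> k j) (ext_cnj (\<eta> k j)))) [0..<m]))}"

text \<open>
  The interior is taken in the finite-dimensional real vector space of real \<open>(m, m)\<close>-forms. The
  topology that it inherits from the function space (pointwise convergence) is its usual one.
\<close>

definition strongly_pos_at :: "nat \<Rightarrow> 'n::finite ext \<Rightarrow> bool" where
  "strongly_pos_at m a \<longleftrightarrow> a \<in> (top_of_set (real_forms_at m)) interior_of (strong_cone m)"

subsection \<open>Hermitian metric, inner product and Hodge star\<close>

text \<open>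
  Throughout, \<open>w\<close> is a real \<open>(1, 1)\<close>-form with \<open>w [v, J v] > 0\<close> for \<open>v \<noteq> 0\<close>, and
  \<open>g v v' = w [v, J v']\<close> is the associated Riemannian metric.
\<close>

definition metric :: "'n::finite ext \<Rightarrow> complex ^ 'n \<Rightarrow> complex ^ 'n \<Rightarrow> real" where
  "metric w v v' = Re (w [v, \<i> *s v'])"

definition orthonormal_frame :: "'n::finite ext \<Rightarrow> (complex ^ 'n) list \<Rightarrow> bool" where
  "orthonormal_frame w B \<longleftrightarrow> length B = 2 * CARD('n) \<and>
     (\<forall>i<length B. \<forall>j<length B. metric w (B ! i) (B ! j) = (if i = j then 1 else 0))"

text \<open>
  The inner product for which the products of increasing subfamilies of the coframe dual to an
  orthonormal frame are orthonormal; it does not depend on the frame. It is linear in the first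
  and antilinear in the second argument.
\<close>

definition ext_inner :: "'n::finite ext \<Rightarrow> 'n ext \<Rightarrow> 'n ext \<Rightarrow> complex" where
  "ext_inner w a b = (let B = (SOME B. orthonormal_frame w B) in
     \<Sum>S\<in>Pow {..<length B}. a (nths B S) * cnj (b (nths B S)))"

definition divided_pow :: "'n::finite ext \<Rightarrow> nat \<Rightarrow> 'n ext" where
  "divided_pow a p = ext_scale (1 / fact p) (wedge_pow a p)"

definition vol_at :: "'n::finite ext \<Rightarrow> 'n ext" where
  "vol_at w = divided_pow w CARD('n)"

text \<open>
  The Hodge star of a \<open>k\<close>-form \<open>b\<close>, determined by
  \<open>u \<and> \<star>b = \<langle>u, cnj b\<rangle> \<omega>^n / n!\<close> for all \<open>k\<close>-forms \<open>u\<close>.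
\<close>

definition hodge_star_at :: "'n::finite ext \<Rightarrow> nat \<Rightarrow> 'n ext \<Rightarrow> 'n ext" where
  "hodge_star_at w k b = (THE s. alt_form (2 * CARD('n) - k) s \<and>
     (\<forall>u. alt_form k u \<longrightarrow> wedge u s = ext_scale (ext_inner w u (ext_cnj b)) (vol_at w)))"

definition primitive_at :: "'n::finite ext \<Rightarrow> nat \<Rightarrow> nat \<Rightarrow> 'n ext \<Rightarrow> bool" where
  "primitive_at w p q a \<longleftrightarrow> bidegree p q a \<and> p + q \<le> CARD('n) \<and>
     wedge a (wedge_pow w (CARD('n) - p - q + 1)) = 0"

section \<open>Complex manifolds\<close>

primrec Ck_on ::
  "nat \<Rightarrow> 'v::real_normed_vector set \<Rightarrow> ('v \<Rightarrow> 'w::real_normed_vector) \<Rightarrow> bool" where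
  "Ck_on 0 S f \<longleftrightarrow> continuous_on S f"
| "Ck_on (Suc k) S f \<longleftrightarrow> (\<forall>x\<in>S. f differentiable (at x)) \<and>
     (\<forall>v. Ck_on k S (\<lambda>x. frechet_derivative f (at x) v))"

text \<open>Meant for open sets \<open>S\<close> in finite-dimensional spaces.\<close>

definition smooth_on ::
  "'v::real_normed_vector set \<Rightarrow> ('v \<Rightarrow> 'w::real_normed_vector) \<Rightarrow> bool" where
  "smooth_on S f \<longleftrightarrow> (\<forall>k. Ck_on k S f)"

definition holomorphic_map_on ::
  "(complex ^ 'n) set \<Rightarrow> (complex ^ 'n \<Rightarrow> complex ^ 'k) \<Rightarrow> bool" where
  "holomorphic_map_on S f \<longleftrightarrow> smooth_on S f \<and>
     (\<forall>x\<in>S. \<forall>c v. frechet_derivative f (at x) (c *s v) = c *s frechet_derivative f (at x) v)"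

text \<open>A chart is a coordinate domain together with the coordinate map.\<close>

type_synonym ('a, 'n) chart = "'a set \<times> ('a \<Rightarrow> complex ^ 'n)"

definition chart_inv :: "('a, 'n::finite) chart \<Rightarrow> complex ^ 'n \<Rightarrow> 'a" where
  "chart_inv c = inv_into (fst c) (snd c)"

definition transition :: "('a, 'n::finite) chart \<Rightarrow> ('a, 'n) chart \<Rightarrow> complex ^ 'n \<Rightarrow> complex ^ 'n" where
  "transition c d = snd d \<circ> chart_inv c"

definition is_chart :: "'a topology \<Rightarrow> ('a, 'n::finite) chart \<Rightarrow> bool" where
  "is_chart X c \<longleftrightarrow> openin X (fst c) \<and> open (snd c ` fst c) \<and>
     homeomorphic_map (subtopology X (fst c)) (top_of_set (snd c ` fst c)) (snd c)"

text \<open>Second countability is not listed: it is automatic in the compact case considered here.\<close>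

definition compact_complex_manifold :: "'a topology \<Rightarrow> ('a, 'n::finite) chart set \<Rightarrow> bool" where
  "compact_complex_manifold X A \<longleftrightarrow>
     Hausdorff_space X \<and> compact_space X \<and> connected_space X \<and>
     (\<forall>c\<in>A. is_chart X c) \<and> (\<Union>c\<in>A. fst c) = topspace X \<and>
     (\<forall>c\<in>A. \<forall>d\<in>A. holomorphic_map_on (snd c ` (fst c \<inter> fst d)) (transition c d))"

section \<open>Differential forms\<close>

text \<open>
  A differential form is given by its expressions in the charts: \<open>u c x\<close> is the exterior form
  at the point \<open>x\<close> read in the coordinates of the chart \<open>c\<close>, so that \<open>u c x vs\<close> is the value
  on the tangent vectors at \<open>x\<close> with coordinate vectors \<open>vs\<close>. Only the values for \<open>c\<close> in the atlas
  and \<open>x\<close> in the domain of \<open>c\<close> are meaningful.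
\<close>

type_synonym ('a, 'n) form = "('a, 'n) chart \<Rightarrow> 'a \<Rightarrow> 'n ext"

definition form_eq ::
  "('a, 'n::finite) chart set \<Rightarrow> ('a, 'n) form \<Rightarrow> ('a, 'n) form \<Rightarrow> bool" where
  "form_eq A u v \<longleftrightarrow> (\<forall>c\<in>A. \<forall>x\<in>fst c. u c x = v c x)"

definition chart_compatible :: "('a, 'n::finite) chart set \<Rightarrow> ('a, 'n) form \<Rightarrow> bool" where
  "chart_compatible A u \<longleftrightarrow> (\<forall>c\<in>A. \<forall>d\<in>A. \<forall>x\<in>fst c \<inter> fst d. \<forall>vs.
     u c x vs = u d x (map (frechet_derivative (transition c d) (at (snd c x))) vs))"

definition in_coords :: "('a, 'n::finite) form \<Rightarrow> ('a, 'n) chart \<Rightarrow> complex ^ 'n \<Rightarrow> 'n ext" where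
  "in_coords u c z = u c (chart_inv c z)"

definition smooth_forms ::
  "('a, 'n::finite) chart set \<Rightarrow> nat \<Rightarrow> nat \<Rightarrow> ('a, 'n) form set" where
  "smooth_forms A p q = {u. chart_compatible A u \<and>
     (\<forall>c\<in>A. (\<forall>x\<in>fst c. bidegree p q (u c x)) \<and>
            (\<forall>vs. smooth_on (snd c ` fst c) (\<lambda>z. in_coords u c z vs)))}"

definition real_smooth_forms ::
  "('a, 'n::finite) chart set \<Rightarrow> nat \<Rightarrow> ('a, 'n) form set" where
  "real_smooth_forms A p =
     {u \<in> smooth_forms A p p. \<forall>c\<in>A. \<forall>x\<in>fst c. ext_cnj (u c x) = u c x}"

definition form_scale :: "complex \<Rightarrow> ('a, 'n::finite) form \<Rightarrow> ('a, 'n) form" where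
  "form_scale k u = (\<lambda>c x. ext_scale k (u c x))"

definition form_wedge :: "('a, 'n::finite) form \<Rightarrow> ('a, 'n) form \<Rightarrow> ('a, 'n) form" where
  "form_wedge u v = (\<lambda>c x. wedge (u c x) (v c x))"

definition form_pow :: "('a, 'n::finite) form \<Rightarrow> nat \<Rightarrow> ('a, 'n) form" where
  "form_pow u k = (\<lambda>c x. wedge_pow (u c x) k)"

definition form_divided_pow :: "('a, 'n::finite) form \<Rightarrow> nat \<Rightarrow> ('a, 'n) form" where
  "form_divided_pow u k = (\<lambda>c x. divided_pow (u c x) k)"

definition hodge_star ::
  "('a, 'n::finite) form \<Rightarrow> nat \<Rightarrow> ('a, 'n) form \<Rightarrow> ('a, 'n) form" where
  "hodge_star \<omega> k u = (\<lambda>c x. hodge_star_at (\<omega> c x) k (u c x))"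

definition strongly_positive ::
  "('a, 'n::finite) chart set \<Rightarrow> nat \<Rightarrow> ('a, 'n) form \<Rightarrow> bool" where
  "strongly_positive A m u \<longleftrightarrow> (\<forall>c\<in>A. \<forall>x\<in>fst c. strongly_pos_at m (u c x))"

subsection \<open>The operators \<open>d\<close>, \<open>\<partial>\<close> and \<open>\<partial>\<close>-bar\<close>

definition dir_d :: "(complex ^ 'n \<Rightarrow> complex) \<Rightarrow> complex ^ 'n \<Rightarrow> complex ^ 'n \<Rightarrow> complex" where
  "dir_d f z v = frechet_derivative f (at z) v"

text \<open>
  The complex-linear and complex-antilinear parts of the differential, i.e.
  the sums over \<open>j\<close> of \<open>v\<^sub>j * \<partial>f/\<partial>z\<^sub>j\<close> and of the conjugate of \<open>v\<^sub>j\<close> times the derivative of \<open>f\<close>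
  in the conjugate of \<open>z\<^sub>j\<close>.
\<close>

definition dir_del :: "(complex ^ 'n \<Rightarrow> complex) \<Rightarrow> complex ^ 'n \<Rightarrow> complex ^ 'n \<Rightarrow> complex" where
  "dir_del f z v = (dir_d f z v - \<i> * dir_d f z (\<i> *s v)) / 2"

definition dir_delbar :: "(complex ^ 'n \<Rightarrow> complex) \<Rightarrow> complex ^ 'n \<Rightarrow> complex ^ 'n \<Rightarrow> complex" where
  "dir_delbar f z v = (dir_d f z v + \<i> * dir_d f z (\<i> *s v)) / 2"

text \<open>
  With \<open>\<delta> = dir_d\<close> this is the coordinate formula for the exterior derivative,
  \<open>(du) [v\<^sub>0, ..., v\<^sub>k] = \<Sum>\<^sub>i (-1)^i D\<^bsub>v\<^sub>i\<^esub> (u [v\<^sub>0, ..., v\<^sub>k without v\<^sub>i])\<close>; the other two choices of \<open>\<delta>\<close>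
  give its parts of bidegree \<open>(1, 0)\<close> and \<open>(0, 1)\<close>.
\<close>

definition form_deriv ::
  "((complex ^ 'n \<Rightarrow> complex) \<Rightarrow> complex ^ 'n \<Rightarrow> complex ^ 'n \<Rightarrow> complex) \<Rightarrow>
   ('a, 'n::finite) form \<Rightarrow> ('a, 'n) form" where
  "form_deriv \<delta> u = (\<lambda>c x vs. \<Sum>i<length vs.
     (-1) ^ i * \<delta> (\<lambda>z. in_coords u c z (take i vs @ drop (Suc i) vs)) (snd c x) (vs ! i))"

definition ext_d :: "('a, 'n::finite) form \<Rightarrow> ('a, 'n) form" where
  "ext_d = form_deriv dir_d"

definition del :: "('a, 'n::finite) form \<Rightarrow> ('a, 'n) form" where
  "del = form_deriv dir_del"

definition delbar :: "('a, 'n::finite) form \<Rightarrow> ('a, 'n) form" where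
  "delbar = form_deriv dir_delbar"

section \<open>Compact Kaehler manifolds\<close>

definition compact_kaehler ::
  "'a topology \<Rightarrow> ('a, 'n::finite) chart set \<Rightarrow> ('a, 'n) form \<Rightarrow> bool" where
  "compact_kaehler X A \<omega> \<longleftrightarrow> compact_complex_manifold X A \<and> \<omega> \<in> real_smooth_forms A 1 \<and>
     (\<forall>c\<in>A. \<forall>x\<in>fst c. \<forall>v. v \<noteq> 0 \<longrightarrow> metric (\<omega> c x) v v > 0) \<and>
     form_eq A (ext_d \<omega>) 0"

subsection \<open>Integration of top-degree forms\<close>

text \<open>
  A positively oriented real frame \<open>e\<^sub>1, J e\<^sub>1, e\<^sub>2, J e\<^sub>2, ...\<close> of unit Lebesgue volume; the value of
  a top-degree form on it does not depend on the enumeration of the index type.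
\<close>

definition std_frame :: "(complex ^ 'n::finite) list" where
  "std_frame = concat (map (\<lambda>j. [axis j 1, axis j \<i>])
     (SOME js. distinct js \<and> set js = (UNIV :: 'n set)))"

text \<open>
  A finite cover by charts is chosen and made disjoint; the form is integrated over each piece in
  the coordinates of the chart. By the change of variables formula the result is independent of
  the cover.
\<close>

definition form_integral :: "('a, 'n::finite) chart set \<Rightarrow> ('a, 'n) form \<Rightarrow> complex" where
  "form_integral A \<eta> =
     (let cs = (SOME cs. set cs \<subseteq> A \<and> (\<Union>c\<in>set cs. fst c) = (\<Union>c\<in>A. fst c)) in
      \<Sum>i<length cs. set_lebesgue_integral lborel
        (snd (cs ! i) ` (fst (cs ! i) - (\<Union>j<i. fst (cs ! j))))
        (\<lambda>z. in_coords \<eta> (cs ! i) z std_frame))"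

definition L2_inner ::
  "('a, 'n::finite) chart set \<Rightarrow> ('a, 'n) form \<Rightarrow> ('a, 'n) form \<Rightarrow> ('a, 'n) form \<Rightarrow> complex" where
  "L2_inner A \<omega> u v =
     form_integral A (\<lambda>c x. ext_scale (ext_inner (\<omega> c x) (u c x) (v c x)) (vol_at (\<omega> c x)))"

subsection \<open>Formal adjoints\<close>

text \<open>
  \<open>is_del_star A \<omega> p q u w\<close> says that the formal adjoint of \<open>\<partial>\<close>, which maps \<open>(p, q)\<close>-forms to
  \<open>(p - 1, q)\<close>-forms, takes \<open>u\<close> to \<open>w\<close>; there are no forms of bidegree \<open>(-1, q)\<close>, so the
  adjoint vanishes for \<open>p = 0\<close>. Likewise for the conjugate operator.
\<close>

definition is_del_star ::
  "('a, 'n::finite) chart set \<Rightarrow> ('a, 'n) form \<Rightarrow> nat \<Rightarrow> nat \<Rightarrow>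
   ('a, 'n) form \<Rightarrow> ('a, 'n) form \<Rightarrow> bool" where
  "is_del_star A \<omega> p q u w \<longleftrightarrow>
     (case p of 0 \<Rightarrow> form_eq A w 0
      | Suc p' \<Rightarrow> w \<in> smooth_forms A p' q \<and>
          (\<forall>v\<in>smooth_forms A p' q. L2_inner A \<omega> (del v) u = L2_inner A \<omega> v w))"

definition is_delbar_star ::
  "('a, 'n::finite) chart set \<Rightarrow> ('a, 'n) form \<Rightarrow> nat \<Rightarrow> nat \<Rightarrow>
   ('a, 'n) form \<Rightarrow> ('a, 'n) form \<Rightarrow> bool" where
  "is_delbar_star A \<omega> p q u w \<longleftrightarrow>
     (case q of 0 \<Rightarrow> form_eq A w 0
      | Suc q' \<Rightarrow> w \<in> smooth_forms A p q' \<and>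
          (\<forall>v\<in>smooth_forms A p q'. L2_inner A \<omega> (delbar v) u = L2_inner A \<omega> v w))"

definition ker_del_star ::
  "('a, 'n::finite) chart set \<Rightarrow> ('a, 'n) form \<Rightarrow> nat \<Rightarrow> nat \<Rightarrow> ('a, 'n) form set" where
  "ker_del_star A \<omega> p q = {u \<in> smooth_forms A p q. is_del_star A \<omega> p q u 0}"

definition ker_delbar_star ::
  "('a, 'n::finite) chart set \<Rightarrow> ('a, 'n) form \<Rightarrow> nat \<Rightarrow> nat \<Rightarrow> ('a, 'n) form set" where
  "ker_delbar_star A \<omega> p q = {u \<in> smooth_forms A p q. is_delbar_star A \<omega> p q u 0}"

subsection \<open>Lefschetz decomposition\<close>

text \<open>
  \<open>P l\<close> is the primitive component of index \<open>l\<close> in the Lefschetz decomposition of the \<open>(r, r)\<close>-form \<open>\<zeta>\<close>.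
  As the decomposition exists and is unique at every point, smoothness of the components
  need not be required.
\<close>

definition lefschetz_decomposition ::
  "('a, 'n::finite) chart set \<Rightarrow> ('a, 'n) form \<Rightarrow> nat \<Rightarrow> ('a, 'n) form \<Rightarrow>
   (nat \<Rightarrow> ('a, 'n) form) \<Rightarrow> bool" where
  "lefschetz_decomposition A \<omega> r \<zeta> P \<longleftrightarrow>
     (\<forall>l\<le>r. \<forall>c\<in>A. \<forall>x\<in>fst c.
        if l + CARD('n) < 2 * r then P l c x = 0
        else primitive_at (\<omega> c x) (r - l) (r - l) (P l c x)) \<and>
     form_eq A \<zeta> (\<Sum>l\<le>r. form_wedge (P l) (form_pow \<omega> l))"

end

theory Submission
  imports Defs
begin

text \<open>
  By the Lefschetz decompositions, \<open>u1 - u2 = f \<omega>^(m-1)\<close> for a smooth real function \<open>f\<close>, and \<open>f\<close> has to be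
  constant. Let \<open>\<rho>1\<close> and \<open>\<rho>2\<close> be the two \<open>(1, 1)\<close>-forms whose \<open>n\<close>-th powers agree. As \<open>\<omega>\<close> is closed,
  \<open>\<partial>\<close> and \<open>\<partial>\<close>-bar act on \<open>f \<omega>^(m-1)\<close> as they act on \<open>f\<close>, and therefore \<open>\<rho>1 - \<rho>2\<close> is a positive multiple of
  the star of \<open>i \<partial>\<partial>\<close>-bar \<open>f \<and> \<omega>^(n-2)\<close>. Factoring \<open>\<rho>1^n - \<rho>2^n\<close> gives

  \<open>\<star>(i \<partial>\<partial>\<close>-bar \<open>f \<and> \<omega>^(n-2)) \<and> R = 0\<close> with \<open>R = \<rho>1^(n-1) + \<rho>1^(n-2) \<rho>2 + \<dots> + \<rho>2^(n-1)\<close>,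

  a homogeneous linear equation of second order for \<open>f\<close> without terms of lower order. The strong
  positivity of the forms \<open>\<alpha> + i \<partial>\<partial>\<close>-bar \<open>u\<^sub>j\<close> makes \<open>\<rho>1\<close> and \<open>\<rho>2\<close> positive definite
  (\<open>star_strongly_positive\<close>), and this makes the equation elliptic (\<open>linearised_operator_pos\<close>). So \<open>f\<close>
  obeys Hopf's strong maximum principle (\<open>strong_maximum_principle\<close>, \<open>local_strong_maximum\<close>): the set where
  it attains its maximum is open. On a compact connected manifold \<open>f\<close> is then constant
  (\<open>constant_by_local_maximum\<close>).

  The algebra at a point rests on two devices. The wedge product satisfies a recursion on the list of
  arguments (\<open>wedge_Cons\<close>), and in an orthonormal frame exterior multiplication by a covector is
  adjoint to contraction (\<open>pairing_covector_wedge\<close>); together they replace bases of the exterior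
  powers, and they give an explicit and continuous formula for the Hodge star. Positivity is handled
  with the cone spanned by the forms \<open>\<i>^(k^2) H \<and> cnj H\<close> for \<open>(k, 0)\<close>-forms \<open>H\<close>. It contains the strong cone,
  is closed under wedge products and under contraction with complex lines, and its elements are
  non-negative on complex frames (\<open>positive_cone_pairs\<close>).
\<close>

section \<open>The wedge product\<close>

definition contract :: "complex ^ 'n::finite \<Rightarrow> 'n ext \<Rightarrow> 'n ext" where
  "contract v a = (\<lambda>vs. a (v # vs))"

text \<open>
  The sign \<open>(-1)^k\<close> on \<open>k\<close>-forms, which a contraction picks up when it passes a factor of a wedge
  product.
\<close>

definition twist :: "'n::finite ext \<Rightarrow> 'n ext" where
  "twist a = (\<lambda>vs. (-1) ^ length vs * a vs)"

definition shuffle_sign :: "nat \<Rightarrow> nat set \<Rightarrow> complex" where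
  "shuffle_sign n S = (-1) ^ card {(i, j). i < j \<and> j < n \<and> i \<notin> S \<and> j \<in> S}"

text \<open>
  A subset of \<open>{0..n}\<close> is sorted by whether it contains \<open>0\<close>. This turns every sum over shuffles into
  a recursion on the list of arguments.
\<close>

lemma sum_Pow_Suc:
  fixes f :: "nat set \<Rightarrow> 'b::comm_monoid_add"
  shows "(\<Sum>S\<in>Pow {..<Suc n}. f S) =
     (\<Sum>S\<in>Pow {..<n}. f (insert 0 (Suc ` S))) + (\<Sum>S\<in>Pow {..<n}. f (Suc ` S))"
proof -
  have *: "Pow {..<Suc n} = (\<lambda>S. insert 0 (Suc ` S)) ` Pow {..<n} \<union> (\<lambda>S. Suc ` S) ` Pow {..<n}"
    unfolding lessThan_Suc_eq_insert_0 Pow_insert image_Pow_surj[OF refl, symmetric] by (auto simp: image_image)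
  have inj: "inj_on (\<lambda>S. insert 0 (Suc ` S)) (Pow {..<n})" "inj_on (\<lambda>S. Suc ` S) (Pow {..<n})"
    by (auto simp: inj_on_def)
  show ?thesis
    unfolding * by (subst sum.union_disjoint) (auto simp: sum.reindex[OF inj(1)] sum.reindex[OF inj(2)])
qed

lemma shuffle_pairs_Suc:
  assumes "S \<subseteq> {..<n}"
  shows "{(i, j). i < j \<and> j < Suc n \<and> i \<notin> Suc ` S \<and> j \<in> Suc ` S} =
      map_prod Suc Suc ` {(i, j). i < j \<and> j < n \<and> i \<notin> S \<and> j \<in> S} \<union> (\<lambda>j. (0, Suc j)) ` S"
    (is "?L = ?R")
    and "{(i, j). i < j \<and> j < Suc n \<and> i \<notin> insert 0 (Suc ` S) \<and> j \<in> insert 0 (Suc ` S)} =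
      map_prod Suc Suc ` {(i, j). i < j \<and> j < n \<and> i \<notin> S \<and> j \<in> S}" (is "?L' = ?R'")
proof -
  have "(i, j) \<in> ?L \<longleftrightarrow> (i, j) \<in> ?R" for i j
    using assms by (cases i; cases j) (auto simp: image_iff)
  then show "?L = ?R" by auto
  have "(i, j) \<in> ?L' \<longleftrightarrow> (i, j) \<in> ?R'" for i j
    using assms by (cases i; cases j) (auto simp: image_iff)
  then show "?L' = ?R'" by auto
qed

lemma shuffle_sign_Suc:
  assumes "S \<subseteq> {..<n}"
  shows "shuffle_sign (Suc n) (insert 0 (Suc ` S)) = shuffle_sign n S"
    and "shuffle_sign (Suc n) (Suc ` S) = (-1) ^ card S * shuffle_sign n S"
proof -
  let ?P = "{(i, j). i < j \<and> j < n \<and> i \<notin> S \<and> j \<in> S}"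
  have fin: "finite ?P"
    by (rule finite_subset[of _ "{..<n} \<times> {..<n}"]) auto
  have inj: "inj_on (map_prod Suc Suc) ?P" by (auto simp: inj_on_def)
  have finS: "finite S" using assms finite_subset by blast
  have inj': "inj_on (\<lambda>j. (0::nat, Suc j)) S" by (auto simp: inj_on_def)
  show "shuffle_sign (Suc n) (insert 0 (Suc ` S)) = shuffle_sign n S"
    unfolding shuffle_sign_def shuffle_pairs_Suc(2)[OF assms] by (simp add: card_image[OF inj])
  have "card (map_prod Suc Suc ` ?P \<union> (\<lambda>j. (0, Suc j)) ` S) = card ?P + card S"
    by (subst card_Un_disjoint) (auto simp: fin finS card_image[OF inj] card_image[OF inj'])
  then show "shuffle_sign (Suc n) (Suc ` S) = (-1) ^ card S * shuffle_sign n S"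
    unfolding shuffle_sign_def shuffle_pairs_Suc(1)[OF assms] by (simp add: power_add)
qed

lemma shuffle_sign_square [simp]: "shuffle_sign n S * shuffle_sign n S = 1"
  by (simp add: shuffle_sign_def flip: power_mult_distrib)

lemma nths_Cons_image:
  "nths (v # vs) (insert 0 (Suc ` S)) = v # nths vs S"
  "nths (v # vs) (Suc ` S) = nths vs S"
  "nths (v # vs) (- insert 0 (Suc ` S)) = nths vs (- S)"
  "nths (v # vs) (- (Suc ` S)) = v # nths vs (- S)"
  by (auto simp: nths_Cons inj_image_mem_iff intro!: arg_cong[of _ _ "nths vs"])

lemma length_nths_subset: "S \<subseteq> {..<length vs} \<Longrightarrow> length (nths vs S) = card S"
  by (simp add: length_nths) (metis (no_types, lifting) Collect_cong Int_def inf.absorb_iff2 lessThan_def mem_Collect_eq inf_commute Collect_mem_eq)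

lemma wedge_eq: "wedge a b vs = (\<Sum>S\<in>Pow {..<length vs}.
    shuffle_sign (length vs) S * a (nths vs S) * b (nths vs (- S)))"
  by (simp add: wedge_def shuffle_sign_def)

lemma wedge_Nil [simp]: "wedge a b [] = a [] * b []"
  by (simp add: wedge_eq shuffle_sign_def)

text \<open>
  The first argument goes to the left factor, or past it to the right factor at the cost of the
  sign \<open>twist\<close>. As the recursion holds for arbitrary functions on lists, the laws of the wedge
  product follow by induction on the list of arguments, for all factors at once.
\<close>

lemma wedge_Cons:
  "wedge a b (v # vs) = wedge (contract v a) b vs + wedge (twist a) (contract v b) vs"
proof -
  have "(\<Sum>S\<in>Pow {..<length vs}. shuffle_sign (Suc (length vs)) (Suc ` S) *
          a (nths (v # vs) (Suc ` S)) * b (nths (v # vs) (- (Suc ` S)))) =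
        (\<Sum>S\<in>Pow {..<length vs}. shuffle_sign (length vs) S *
          twist a (nths vs S) * contract v b (nths vs (- S)))"
    by (intro sum.cong refl)
       (auto simp: shuffle_sign_Suc nths_Cons_image twist_def contract_def length_nths_subset)
  moreover have "(\<Sum>S\<in>Pow {..<length vs}. shuffle_sign (Suc (length vs)) (insert 0 (Suc ` S)) *
          a (nths (v # vs) (insert 0 (Suc ` S))) * b (nths (v # vs) (- insert 0 (Suc ` S)))) =
        (\<Sum>S\<in>Pow {..<length vs}. shuffle_sign (length vs) S *
          contract v a (nths vs S) * b (nths vs (- S)))"
    by (intro sum.cong refl)
       (auto simp: shuffle_sign_Suc nths_Cons_image contract_def simp del: Compl_insert)
  ultimately show ?thesis
    unfolding wedge_eq by (simp add: sum_Pow_Suc)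
qed

lemma wedge_add_left: "wedge (a + a') b = wedge a b + wedge a' b"
  and wedge_add_right: "wedge a (b + b') = wedge a b + wedge a b'"
  and wedge_diff_left: "wedge (a - a') b = wedge a b - wedge a' b"
  and wedge_diff_right: "wedge a (b - b') = wedge a b - wedge a b'"
  and wedge_scale_left: "wedge (ext_scale c a) b = ext_scale c (wedge a b)"
  and wedge_scale_right: "wedge a (ext_scale c b) = ext_scale c (wedge a b)"
  and wedge_zero_left [simp]: "wedge 0 b = 0"
  and wedge_zero_right [simp]: "wedge a 0 = 0"
  by (auto simp: fun_eq_iff wedge_def algebra_simps sum.distrib sum_subtractf ext_scale_def sum_distrib_left)

lemma wedge_minus_left: "wedge (- a) b = - wedge a b"
  and wedge_minus_right: "wedge a (- b) = - wedge a b"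
  by (auto simp: fun_eq_iff wedge_def sum_negf)

lemma wedge_sum_left: "wedge (\<Sum>i\<in>I. f i) b = (\<Sum>i\<in>I. wedge (f i) b)"
  by (induction I rule: infinite_finite_induct) (simp_all only: sum.infinite sum.empty sum.insert wedge_zero_left wedge_add_left not_False_eq_True)

lemma wedge_sum_right: "wedge a (\<Sum>i\<in>I. f i) = (\<Sum>i\<in>I. wedge a (f i))"
  by (induction I rule: infinite_finite_induct) (simp_all only: sum.infinite sum.empty sum.insert wedge_zero_right wedge_add_right not_False_eq_True)

lemma contract_simps:
  "contract v (a + b) = contract v a + contract v b"
  "contract v (a - b) = contract v a - contract v b"
  "contract v (- a) = - contract v a"
  "contract v 0 = 0"
  "contract v (ext_scale c a) = ext_scale c (contract v a)"
  "contract v (ext_cnj a) = ext_cnj (contract v a)"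
  "contract v (twist a) = - twist (contract v a)"
  "contract v ext_one = 0"
  by (auto simp: fun_eq_iff contract_def ext_scale_def ext_cnj_def twist_def ext_one_def)

lemma twist_simps:
  "twist (a + b) = twist a + twist b"
  "twist (a - b) = twist a - twist b"
  "twist (- a) = - twist a"
  "twist 0 = 0"
  "twist (ext_scale c a) = ext_scale c (twist a)"
  "twist (ext_cnj a) = ext_cnj (twist a)"
  "twist (twist a) = a"
  "twist ext_one = ext_one"
  by (auto simp: fun_eq_iff ext_scale_def ext_cnj_def twist_def ext_one_def algebra_simps
      simp flip: power_mult_distrib)

lemma contract_wedge:
  "contract v (wedge a b) = wedge (contract v a) b + wedge (twist a) (contract v b)"
  by (auto simp: fun_eq_iff contract_def wedge_Cons)

lemma twist_wedge: "twist (wedge a b) = wedge (twist a) (twist b)"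
proof -
  have "twist (wedge a b) vs = wedge (twist a) (twist b) vs" for vs
  proof (induction vs arbitrary: a b)
    case (Cons v vs)
    have "twist (wedge a b) (v # vs) = - twist (contract v (wedge a b)) vs"
      by (simp add: twist_def contract_def)
    also have "\<dots> = - twist (wedge (contract v a) b) vs - twist (wedge (twist a) (contract v b)) vs"
      by (simp add: contract_wedge twist_simps)
    finally show ?case
      by (simp add: Cons.IH wedge_Cons contract_simps twist_simps wedge_minus_left wedge_minus_right)
  qed (simp add: twist_def)
  then show ?thesis by auto
qed

lemma wedge_assoc: "wedge (wedge a b) c = wedge a (wedge b c)"
proof -
  have "wedge (wedge a b) c vs = wedge a (wedge b c) vs" for vs
    by (induction vs arbitrary: a b c)
       (simp_all add: wedge_Cons contract_wedge twist_wedge wedge_add_left wedge_add_right)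
  then show ?thesis by auto
qed

text \<open>
  Contraction changes the parity of a form, so both parities have to be treated in one induction.
\<close>

lemma wedge_comm_twist:
  "twist a = a \<Longrightarrow> wedge a b = wedge b a"
  "twist a = - a \<Longrightarrow> wedge a b = wedge (twist b) a"
proof -
  have "(twist a = a \<longrightarrow> wedge a b vs = wedge b a vs) \<and>
        (twist a = - a \<longrightarrow> wedge a b vs = wedge (twist b) a vs)" for vs
  proof (induction vs arbitrary: a b)
    case Nil
    have "a [] = 0" if "twist a = - a"
      using fun_cong[OF that, of "[]"] by (simp add: twist_def)
    then show ?case by (auto simp: twist_def)
  next
    case (Cons v vs)
    have ev: "twist (contract v a) = - contract v a" if "twist a = a"
      using contract_simps(7)[of v a] that by (metis minus_minus)
    have od: "twist (contract v a) = contract v a" if "twist a = - a"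
      using contract_simps(3,7)[of v a] that by (metis minus_minus)
    show ?case
    proof (intro conjI impI)
      assume t: "twist a = a"
      have "wedge (contract v a) b vs = wedge (twist b) (contract v a) vs"
        using Cons.IH ev[OF t] by blast
      moreover have "wedge a (contract v b) vs = wedge (contract v b) a vs"
        using Cons.IH t by blast
      ultimately show "wedge a b (v # vs) = wedge b a (v # vs)" by (simp add: wedge_Cons t)
    next
      assume t: "twist a = - a"
      have "wedge (contract v a) b vs = wedge b (contract v a) vs"
        using Cons.IH od[OF t] by blast
      moreover have "wedge a (contract v b) vs = wedge (twist (contract v b)) a vs"
        using Cons.IH t by blast
      ultimately show "wedge a b (v # vs) = wedge (twist b) a (v # vs)"
        by (simp add: wedge_Cons t contract_simps twist_simps wedge_minus_left)
    qed
  qed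
  then show "twist a = a \<Longrightarrow> wedge a b = wedge b a" "twist a = - a \<Longrightarrow> wedge a b = wedge (twist b) a"
    by auto
qed

lemma wedge_one_left [simp]: "wedge ext_one a = a"
proof -
  have "wedge ext_one a vs = a vs" for vs
    by (induction vs arbitrary: a)
       (simp_all add: wedge_Cons contract_simps twist_simps, simp_all add: ext_one_def contract_def)
  then show ?thesis by auto
qed

lemma wedge_one_right [simp]: "wedge a ext_one = a"
  using wedge_comm_twist(1)[of ext_one a] by (simp add: twist_simps)

lemma wedge_pow_add: "wedge_pow a (j + k) = wedge (wedge_pow a j) (wedge_pow a k)"
  by (induction j) (auto simp: wedge_assoc)

lemma cnj_wedge: "ext_cnj (wedge a b) = wedge (ext_cnj a) (ext_cnj b)"
  by (simp add: fun_eq_iff ext_cnj_def wedge_def)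

lemma cnj_one [simp]: "ext_cnj ext_one = ext_one"
  by (auto simp: ext_cnj_def ext_one_def fun_eq_iff)

lemma wedge_map: "wedge a b (map f vs) = wedge (\<lambda>ws. a (map f ws)) (\<lambda>ws. b (map f ws)) vs"
  by (simp add: wedge_def nths_map)

lemma wedge_pow_map: "wedge_pow a k (map f vs) = wedge_pow (\<lambda>ws. a (map f ws)) k vs"
proof (induction k arbitrary: vs)
  case (Suc k)
  then show ?case by (simp add: wedge_map)
qed (simp add: ext_one_def)

text \<open>
  The wedge product evaluates its factors on sublists only. Together with its mirror image this
  removes the terms of a contraction that vanish on the orthogonal complement of a vector.
\<close>

lemma wedge_local_zero:
  assumes "\<And>us. set us \<subseteq> set ws \<Longrightarrow> b us = 0"
  shows "wedge a b ws = 0"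
  unfolding wedge_def by (rule sum.neutral) (auto simp: assms set_nths_subset)

lemma wedge_local_zero':
  assumes "\<And>us. set us \<subseteq> set ws \<Longrightarrow> a us = 0"
  shows "wedge a b ws = 0"
  unfolding wedge_def by (rule sum.neutral) (auto simp: assms set_nths_subset)

text \<open>
  Even forms commute, so the factorisation of \<open>a^n - b^n\<close> is available. It turns the equality of
  two \<open>n\<close>-th powers into a linear equation for the difference.
\<close>

lemma wedge_pow_diff:
  assumes "twist a = a" "twist b = b"
  shows "wedge_pow a n - wedge_pow b n =
    wedge (a - b) (\<Sum>k<n. wedge (wedge_pow a k) (wedge_pow b (n - 1 - k)))"
proof (induction n)
  case (Suc n)
  have "wedge_pow a (Suc n) - wedge_pow b (Suc n) =
      wedge (a - b) (wedge_pow a n) + wedge b (wedge_pow a n - wedge_pow b n)"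
    by (simp add: wedge_diff_left wedge_diff_right)
  also have "wedge b (wedge_pow a n - wedge_pow b n) =
      wedge (a - b) (\<Sum>k<n. wedge (wedge_pow a k) (wedge b (wedge_pow b (n - 1 - k))))"
  proof -
    have "wedge b (wedge (a - b) x) = wedge (a - b) (wedge b x)" for x
      by (metis wedge_assoc wedge_comm_twist(1) assms(2))
    moreover have "wedge b (wedge (wedge_pow a k) y) = wedge (wedge_pow a k) (wedge b y)" for k y
      by (metis wedge_assoc wedge_comm_twist(1) assms(2))
    ultimately show ?thesis by (simp only: Suc wedge_sum_right)
  qed
  also have "(\<Sum>k<n. wedge (wedge_pow a k) (wedge b (wedge_pow b (n - 1 - k)))) =
      (\<Sum>k<n. wedge (wedge_pow a k) (wedge_pow b (Suc n - 1 - k)))"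
    by (rule sum.cong[OF refl]) (simp flip: wedge_pow.simps(2) add: Suc_diff_Suc)
  also have "wedge (a - b) (wedge_pow a n) + wedge (a - b)
       (\<Sum>k<n. wedge (wedge_pow a k) (wedge_pow b (Suc n - 1 - k))) =
      wedge (a - b) (\<Sum>k<Suc n. wedge (wedge_pow a k) (wedge_pow b (Suc n - 1 - k)))"
    unfolding sum.lessThan_Suc wedge_add_right diff_Suc_1 diff_self_eq_0 wedge_pow.simps(1) wedge_one_right
    by (rule add.commute)
  finally show ?case .
qed (simp only: wedge_pow.simps lessThan_0 sum.empty wedge_zero_right diff_self)

section \<open>Alternating forms\<close>

lemma linear_zero_map: "linear (\<lambda>v. 0)"
  by (rule linearI) auto

text \<open>
  Multilinearity and alternation without a degree. Only adjacent repetitions are forbidden, which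
  is the form of alternation that passes through the recursion for the wedge product.
\<close>

definition multi_alt :: "'n::finite ext \<Rightarrow> bool" where
  "multi_alt a \<longleftrightarrow> (\<forall>ps qs. linear (\<lambda>v. a (ps @ v # qs))) \<and> (\<forall>ps v qs. a (ps @ v # v # qs) = 0)"

definition has_degree :: "nat \<Rightarrow> 'n::finite ext \<Rightarrow> bool" where
  "has_degree k a \<longleftrightarrow> (\<forall>vs. length vs \<noteq> k \<longrightarrow> a vs = 0)"

lemma multi_alt_linear: "multi_alt a \<Longrightarrow> linear (\<lambda>v. a (ps @ v # qs))"
  by (simp add: multi_alt_def)

lemma multi_alt_swap:
  assumes "multi_alt a"
  shows "a (ps @ v # w # qs) = - a (ps @ w # v # qs)"
proof -
  have l1: "linear (\<lambda>v. a (ps @ v # w # qs))" for w using assms by (simp add: multi_alt_def)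
  have l2: "linear (\<lambda>w. a (ps @ v # w # qs))" for v
    using multi_alt_linear[OF assms, of "ps @ [v]" qs] by simp
  have z: "a (ps @ u # u # qs) = 0" for u using assms by (simp add: multi_alt_def)
  have "a (ps @ (v + w) # (v + w) # qs) =
      a (ps @ v # v # qs) + a (ps @ w # v # qs) + (a (ps @ v # w # qs) + a (ps @ w # w # qs))"
    by (simp only: linear_add[OF l1] linear_add[OF l2])
  then show ?thesis by (simp add: z eq_neg_iff_add_eq_0 add.commute)
qed

lemma multi_alt_move:
  assumes "multi_alt a"
  shows "a (ps @ us @ v # qs) = (-1) ^ length us * a (ps @ v # us @ qs)"
proof (induction us arbitrary: ps)
  case (Cons u us)
  have "a (ps @ (u # us) @ v # qs) = (-1) ^ length us * a (ps @ u # v # us @ qs)"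
    using Cons[of "ps @ [u]"] by simp
  then show ?case using multi_alt_swap[OF assms, of ps u v "us @ qs"] by simp
qed simp

lemma multi_alt_repeat:
  assumes "multi_alt a" "\<not> distinct vs"
  shows "a vs = 0"
proof -
  obtain ps v us qs where "vs = ps @ [v] @ us @ [v] @ qs"
    using not_distinct_decomp[OF assms(2)] by blast
  then have "a vs = (-1) ^ length us * a (ps @ v # v # us @ qs)"
    using multi_alt_move[OF assms(1), of "ps @ [v]" us v qs] by simp
  then show ?thesis using assms(1) by (simp add: multi_alt_def)
qed

lemma alt_form_iff: "alt_form k a \<longleftrightarrow> has_degree k a \<and> multi_alt a"
proof
  assume a: "alt_form k a"
  have "linear (\<lambda>v. a (ps @ v # qs))" for ps qs
  proof (cases "length ps + length qs + 1 = k")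
    case True
    have "\<forall>vs. length vs = k \<longrightarrow> (\<forall>i<k. linear (\<lambda>v. a (vs[i := v])))"
      using a unfolding alt_form_def by blast
    from this[rule_format, of "ps @ undefined # qs" "length ps"]
    have "linear (\<lambda>v. a ((ps @ undefined # qs)[length ps := v]))"
      using True by simp
    then show ?thesis by simp
  next
    case False
    then have "(\<lambda>v. a (ps @ v # qs)) = (\<lambda>v. 0)"
      using a unfolding alt_form_def by (intro ext) auto
    then show ?thesis by (simp add: linear_zero_map)
  qed
  then show "has_degree k a \<and> multi_alt a"
    using a by (auto simp: alt_form_def has_degree_def multi_alt_def)
next
  assume "has_degree k a \<and> multi_alt a"
  then have a: "has_degree k a" "multi_alt a" by auto
  have "linear (\<lambda>v. a (vs[i := v]))" if "i < length vs" for vs i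
    using multi_alt_linear[OF a(2), of "take i vs" "drop (Suc i) vs"] that
    by (simp add: upd_conv_take_nth_drop)
  then show "alt_form k a"
    using a multi_alt_repeat[OF a(2)] by (auto simp: alt_form_def has_degree_def)
qed

lemma has_degree_twist: "has_degree k a \<Longrightarrow> twist a = ext_scale ((-1) ^ k) a"
  by (auto simp: has_degree_def twist_def ext_scale_def fun_eq_iff)

lemma linear_complex_cmult: "linear f \<Longrightarrow> linear (\<lambda>x. (c::complex) * f x)"
  by (rule linear_compose[unfolded o_def]) (auto intro: bounded_linear.linear bounded_linear_mult_right)

lemma linear_complex_multc: "linear f \<Longrightarrow> linear (\<lambda>x. f x * (c::complex))"
  using linear_complex_cmult[of f c] by (simp add: mult.commute)

lemma linear_cnj_comp: "linear f \<Longrightarrow> linear (\<lambda>x. cnj (f x))"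
  by (rule linear_compose[unfolded o_def]) (auto intro: bounded_linear.linear bounded_linear_cnj)

lemma multi_altI:
  assumes "\<And>ps qs. linear (\<lambda>v. a (ps @ v # qs))" "\<And>ps v qs. a (ps @ v # v # qs) = 0"
  shows "multi_alt a"
  using assms by (auto simp: multi_alt_def)

lemma multi_alt_zero: "multi_alt 0"
  by (rule multi_altI) (auto simp: linear_zero_map)

lemma multi_alt_add: "multi_alt a \<Longrightarrow> multi_alt b \<Longrightarrow> multi_alt (a + b)"
  unfolding multi_alt_def by (auto intro!: linear_compose_add)

lemma multi_alt_diff: "multi_alt a \<Longrightarrow> multi_alt b \<Longrightarrow> multi_alt (a - b)"
  unfolding multi_alt_def by (auto intro!: linear_compose_sub)

lemma multi_alt_scale: "multi_alt a \<Longrightarrow> multi_alt (ext_scale c a)"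
  unfolding multi_alt_def ext_scale_def by (auto intro!: linear_complex_cmult)

lemma multi_alt_cnj: "multi_alt a \<Longrightarrow> multi_alt (ext_cnj a)"
  unfolding multi_alt_def ext_cnj_def by (auto intro!: linear_cnj_comp)

lemma multi_alt_contract: "multi_alt a \<Longrightarrow> multi_alt (contract v a)"
  unfolding multi_alt_def contract_def by (auto simp flip: append_Cons)

lemma multi_alt_twist: "multi_alt a \<Longrightarrow> multi_alt (twist a)"
  unfolding multi_alt_def twist_def
  by (auto intro!: linear_complex_cmult simp del: mult_minus_left power_Suc mult_minus1)

text \<open>
  For two equal adjacent arguments the recursion gives four terms: two vanish by alternation of a
  factor, the mixed ones cancel because contraction anticommutes with \<open>twist\<close>.
\<close>

lemma multi_alt_wedge:
  assumes "multi_alt a" "multi_alt b"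
  shows "multi_alt (wedge a b)"
proof (rule multi_altI)
  have lin: "linear (\<lambda>v. wedge (F v) b qs)" if "\<And>ws. linear (\<lambda>v. F v ws)"
    for F :: "complex ^ 'a \<Rightarrow> 'a ext" and b qs
    unfolding wedge_def
    by (intro linear_compose_sum ballI linear_complex_multc linear_complex_cmult that)
  have lin': "linear (\<lambda>v. wedge a (F v) qs)" if "\<And>ws. linear (\<lambda>v. F v ws)"
    for F :: "complex ^ 'a \<Rightarrow> 'a ext" and a qs
    unfolding wedge_def
    by (intro linear_compose_sum ballI linear_complex_multc linear_complex_cmult that)
  show "linear (\<lambda>v. wedge a b (ps @ v # qs))" for ps qs
    using assms
  proof (induction ps arbitrary: a b)
    case Nil
    have "linear (\<lambda>v. contract v a ws)" "linear (\<lambda>v. contract v b ws)" for ws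
      using multi_alt_linear[OF Nil(1), of "[]"] multi_alt_linear[OF Nil(2), of "[]"]
      by (simp_all add: contract_def)
    then show ?case
      by (auto simp: wedge_Cons intro!: linear_compose_add lin lin')
  next
    case (Cons p ps)
    then show ?case
      by (simp add: wedge_Cons linear_compose_add multi_alt_contract multi_alt_twist)
  qed
  show "wedge a b (ps @ v # v # qs) = 0" for ps v qs
    using assms
  proof (induction ps arbitrary: a b)
    case Nil
    have "contract v (contract v a) = 0" "contract v (contract v b) = 0"
      using Nil by (auto simp: contract_def multi_alt_def fun_eq_iff dest!: spec[of _ "[]"])
    then show ?case
      by (simp add: wedge_Cons contract_simps wedge_minus_left)
  next
    case (Cons p ps)
    then show ?case
      by (simp add: wedge_Cons multi_alt_contract multi_alt_twist)
  qed
qed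

lemma multi_alt_one: "multi_alt ext_one"
  by (rule multi_altI) (auto simp: ext_one_def linear_zero_map)

lemma has_degree_one: "has_degree 0 ext_one"
  by (auto simp: has_degree_def ext_one_def)

lemma has_degree_wedge:
  assumes "has_degree k a" "has_degree l b"
  shows "has_degree (k + l) (wedge a b)"
  unfolding has_degree_def
proof (intro allI impI)
  fix vs :: "(complex ^ 'a) list" assume n: "length vs \<noteq> k + l"
  show "wedge a b vs = 0"
    unfolding wedge_eq
  proof (intro sum.neutral ballI)
    fix S assume "S \<in> Pow {..<length vs}"
    then have S: "S \<subseteq> {..<length vs}" by auto
    have "{i. i < length vs \<and> i \<in> - S} = {..<length vs} - S" by auto
    then have "length (nths vs (- S)) = length vs - card S" "card S \<le> length vs"
      using S card_mono[OF _ S] by (auto simp: length_nths card_Diff_subset finite_subset)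
    then have "length (nths vs S) \<noteq> k \<or> length (nths vs (- S)) \<noteq> l"
      using n S by (auto simp: length_nths_subset)
    then show "shuffle_sign (length vs) S * a (nths vs S) * b (nths vs (- S)) = 0"
      using assms by (auto simp: has_degree_def)
  qed
qed

lemma has_degree_contract: "has_degree k a \<Longrightarrow> has_degree (k - 1) (contract v a)"
  by (auto simp: has_degree_def contract_def)

lemma has_degree_closed:
  "has_degree k 0"
  "has_degree k a \<Longrightarrow> has_degree k b \<Longrightarrow> has_degree k (a + b)"
  "has_degree k a \<Longrightarrow> has_degree k b \<Longrightarrow> has_degree k (a - b)"
  "has_degree k a \<Longrightarrow> has_degree k (ext_scale c a)"
  "has_degree k a \<Longrightarrow> has_degree k (ext_cnj a)"
  "has_degree k a \<Longrightarrow> has_degree k (twist a)"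
  by (auto simp: has_degree_def ext_scale_def ext_cnj_def twist_def)

lemma alt_form_wedge: "alt_form k a \<Longrightarrow> alt_form l b \<Longrightarrow> alt_form (k + l) (wedge a b)"
  by (simp add: alt_form_iff has_degree_wedge multi_alt_wedge)

lemma alt_form_contract: "alt_form k a \<Longrightarrow> alt_form (k - 1) (contract v a)"
  unfolding alt_form_iff using has_degree_contract multi_alt_contract by blast

lemma alt_form_closed:
  "alt_form k 0"
  "alt_form k a \<Longrightarrow> alt_form k b \<Longrightarrow> alt_form k (a + b)"
  "alt_form k a \<Longrightarrow> alt_form k b \<Longrightarrow> alt_form k (a - b)"
  "alt_form k a \<Longrightarrow> alt_form k (ext_scale c a)"
  "alt_form k a \<Longrightarrow> alt_form k (ext_cnj a)"
  by (simp_all add: alt_form_iff has_degree_closed multi_alt_zero multi_alt_add multi_alt_diff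
      multi_alt_scale multi_alt_cnj)

lemma alt_form_one: "alt_form 0 ext_one"
  by (simp add: alt_form_iff has_degree_one multi_alt_one)

lemma alt_form_sum: "(\<And>i. i \<in> I \<Longrightarrow> alt_form k (f i)) \<Longrightarrow> alt_form k (\<Sum>i\<in>I. f i)"
  by (induction I rule: infinite_finite_induct) (simp_all add: alt_form_closed del: plus_fun_apply zero_fun_apply)

lemma alt_form_even_twist: "alt_form (2 * k) a \<Longrightarrow> twist a = a"
  by (auto simp: alt_form_iff has_degree_twist ext_scale_def dest!: has_degree_twist)

lemma sum_ext_apply: "(\<Sum>i\<in>I. f i) vs = (\<Sum>i\<in>I. (f i vs :: 'b::comm_monoid_add))"
  by (induction I rule: infinite_finite_induct) auto

section \<open>Pairings in a frame\<close>

text \<open>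
  For an orthonormal frame \<open>B\<close> this is the complex bilinear extension of the inner product on
  forms.
\<close>

definition pairing :: "'n::finite ext \<Rightarrow> 'n ext \<Rightarrow> (complex ^ 'n) list \<Rightarrow> complex" where
  "pairing a b B = (\<Sum>S\<in>Pow {..<length B}. a (nths B S) * b (nths B S))"

lemma pairing_Nil [simp]: "pairing a b [] = a [] * b []"
  by (simp add: pairing_def)

lemma pairing_Cons: "pairing a b (e # B) = pairing (contract e a) (contract e b) B + pairing a b B"
  by (simp add: pairing_def sum_Pow_Suc nths_Cons_image contract_def)

lemma pairing_commute: "pairing a b B = pairing b a B"
  by (simp add: pairing_def mult.commute)

lemma pairing_left:
  "pairing 0 b B = 0"
  "pairing (a + a') b B = pairing a b B + pairing a' b B"
  "pairing (- a) b B = - pairing a b B"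
  "pairing (ext_scale c a) b B = c * pairing a b B"
  by (simp_all add: pairing_def algebra_simps sum.distrib ext_scale_def sum_distrib_left sum_negf)

lemma pairing_right:
  "pairing a 0 B = 0"
  "pairing a (b + b') B = pairing a b B + pairing a b' B"
  "pairing a (- b) B = - pairing a b B"
  "pairing a (ext_scale c b) B = c * pairing a b B"
  by (simp_all add: pairing_def algebra_simps sum.distrib ext_scale_def sum_distrib_left sum_negf)

lemma sum_list_cong_add: "(\<Sum>x\<leftarrow>xs. f x + g x) = (\<Sum>x\<leftarrow>xs. f x) + (\<Sum>x\<leftarrow>xs. g x :: complex)"
  by (induction xs) auto

lemma contract_swap:
  assumes "multi_alt b"
  shows "contract e (contract e' b) = - contract e' (contract e b)"
  using multi_alt_swap[OF assms, of "[]" e' e] by (simp add: contract_def fun_eq_iff)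

lemma contract_same: "multi_alt b \<Longrightarrow> contract e (contract e b) = 0"
  by (auto simp: contract_def fun_eq_iff multi_alt_def dest!: spec[of _ "[]"])

lemma contract_covector:
  assumes "has_degree 1 \<theta>"
  shows "contract e \<theta> = ext_scale (\<theta> [e]) ext_one"
  using assms by (auto simp: contract_def ext_scale_def ext_one_def has_degree_def fun_eq_iff)

text \<open>
  Exterior multiplication by a covector is adjoint to contraction with the dual vector. Stated
  for an arbitrary list \<open>B\<close>, of which \<open>\<theta>\<close> only sees the entries, the adjunction is an induction on \<open>B\<close>.
\<close>

lemma pairing_covector_wedge:
  assumes "has_degree 1 \<theta>" "multi_alt b"
  shows "pairing (wedge \<theta> a) b B = (\<Sum>e\<leftarrow>B. \<theta> [e] * pairing a (contract e b) B)"
  using assms(2)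
proof (induction B arbitrary: a b)
  case Nil
  have "\<theta> [] = 0" using assms by (simp add: has_degree_def)
  then show ?case by simp
next
  case (Cons e B)
  have tw: "twist \<theta> = - \<theta>"
    using has_degree_twist[OF assms(1)] by (simp add: ext_scale_def fun_eq_iff)
  have "contract e (wedge \<theta> a) = ext_scale (\<theta> [e]) a + - wedge \<theta> (contract e a)"
    by (simp only: contract_wedge contract_covector[OF assms(1)] tw wedge_minus_left wedge_scale_left wedge_one_left)
  then have "pairing (wedge \<theta> a) b (e # B) =
      \<theta> [e] * pairing a (contract e b) B - pairing (wedge \<theta> (contract e a)) (contract e b) B
      + pairing (wedge \<theta> a) b B"
    by (simp only: pairing_Cons pairing_left diff_conv_add_uminus)
  also have "pairing (wedge \<theta> (contract e a)) (contract e b) B =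
      - (\<Sum>e'\<leftarrow>B. \<theta> [e'] * pairing (contract e a) (contract e (contract e' b)) B)"
  proof -
    have "pairing a' (contract e' (contract e b)) B = - pairing a' (contract e (contract e' b)) B" for e' a'
      by (simp only: contract_swap[OF Cons.prems, of e' e] pairing_right)
    then show ?thesis
      by (simp add: Cons multi_alt_contract uminus_sum_list_map o_def)
  qed
  also have "pairing (wedge \<theta> a) b B = (\<Sum>e'\<leftarrow>B. \<theta> [e'] * pairing a (contract e' b) B)"
    by (rule Cons.IH[OF Cons.prems])
  finally show ?case
    by (simp add: pairing_Cons[of _ _ e] contract_same[OF Cons.prems] pairing_right
        sum_list_cong_add algebra_simps)
qed

lemma linear_sum_list: "linear f \<Longrightarrow> f (\<Sum>x\<leftarrow>xs. t x *\<^sub>R h x) = (\<Sum>x\<leftarrow>xs. t x *\<^sub>R f (h x))"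
  by (induction xs) (simp_all add: linear_0 linear_add linear_scale)

definition covector :: "(complex ^ 'n \<Rightarrow> real) \<Rightarrow> 'n::finite ext" where
  "covector t = (\<lambda>ws. if length ws = 1 then complex_of_real (t (hd ws)) else 0)"

lemma has_degree_covector: "has_degree 1 (covector t)"
  by (simp add: has_degree_def covector_def)

lemma pairing_one: "pairing ext_one b B = b []"
proof (induction B arbitrary: b)
  case (Cons e B)
  have "contract e ext_one = (0 :: 'a ext)" by (rule contract_simps)
  then show ?case by (simp add: pairing_Cons pairing_left Cons)
qed (simp add: ext_one_def)

text \<open>
  Iterating the adjunction expresses the value of an alternating form on arbitrary vectors
  through its values on sublists of a frame. It takes the place of a basis of the exterior power,
  and of determinants.
\<close>

lemma pairing_covectors:
  assumes "\<And>E. E = (\<Sum>e\<leftarrow>B. t E e *\<^sub>R e)" "multi_alt b"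
  shows "pairing (wedge_list (map (\<lambda>E. covector (t E)) Es)) b B = b Es"
  using assms(2)
proof (induction Es arbitrary: b)
  case (Cons E Es)
  let ?a = "wedge_list (map (\<lambda>E. covector (t E)) Es)"
  have lin: "linear (\<lambda>e. pairing ?a (contract e b) B)"
    unfolding pairing_def contract_def
    using multi_alt_linear[OF Cons.prems, of "[]"]
    by (intro linear_compose_sum ballI linear_complex_cmult) simp
  have "pairing (wedge (covector (t E)) ?a) b B = (\<Sum>e\<leftarrow>B. t E e *\<^sub>R pairing ?a (contract e b) B)"
    by (subst pairing_covector_wedge[OF has_degree_covector Cons.prems])
       (simp add: covector_def scaleR_conv_of_real)
  also have "\<dots> = pairing ?a (contract E b) B"
    using linear_sum_list[OF lin, of "t E" "\<lambda>e. e" B] assms(1)[of E] by simp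
  finally show ?case
    using Cons.IH[OF multi_alt_contract[OF Cons.prems], of E] by (simp add: contract_def)
qed (simp add: pairing_one)

lemma frame_coefficients:
  fixes B :: "'v::euclidean_space list"
  assumes "distinct B" "span (set B) = UNIV"
  obtains t where "\<And>E. E = (\<Sum>e\<leftarrow>B. t E e *\<^sub>R e)"
proof -
  have "\<exists>u. E = (\<Sum>e\<leftarrow>B. u e *\<^sub>R e)" for E
  proof -
    have "E \<in> span (set B)" by (simp add: assms)
    then obtain u where "E = (\<Sum>e\<in>set B. u e *\<^sub>R e)"
      by (auto simp: span_finite)
    then show ?thesis using sum_list_distinct_conv_sum_set[OF assms(1)] by metis
  qed
  then show thesis using that by metis
qed

lemma multi_alt_eqI:
  assumes "distinct B" "span (set B) = UNIV" "multi_alt b"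
    and "\<And>S. S \<subseteq> {..<length B} \<Longrightarrow> b (nths B S) = 0"
  shows "b = 0"
proof -
  obtain t where t: "\<And>E. E = (\<Sum>e\<leftarrow>B. t E e *\<^sub>R e)"
    using frame_coefficients assms(1,2) by blast
  have "pairing a b B = 0" for a
    unfolding pairing_def using assms(4) by (intro sum.neutral) auto
  then have "b Es = 0" for Es
    using pairing_covectors[OF t assms(3), of Es] by simp
  then show ?thesis by auto
qed

lemma top_form_eq_zeroI:
  assumes "distinct B" "span (set B) = UNIV" "alt_form (length B) b" "b B = 0"
  shows "b = 0"
proof (rule multi_alt_eqI[OF assms(1,2)])
  show "multi_alt b" using assms by (simp add: alt_form_iff)
  fix S assume S: "S \<subseteq> {..<length B}"
  show "b (nths B S) = 0"
  proof (cases "S = {..<length B}")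
    case True
    then show ?thesis using assms(4) by (simp add: nths_all)
  next
    case False
    then have "card S < card {..<length B}" using S by (intro psubset_card_mono) auto
    then show ?thesis using assms(3) S
      by (auto simp: alt_form_iff has_degree_def length_nths_subset)
  qed
qed

section \<open>Orthonormal frames\<close>

definition inner_form :: "('v::euclidean_space \<Rightarrow> 'v \<Rightarrow> real) \<Rightarrow> bool" where
  "inner_form g \<longleftrightarrow> bilinear g \<and> (\<forall>x y. g x y = g y x) \<and> (\<forall>x. x \<noteq> 0 \<longrightarrow> g x x > 0)"

primrec orthonormal :: "('v::euclidean_space \<Rightarrow> 'v \<Rightarrow> real) \<Rightarrow> 'v list \<Rightarrow> bool" where
  "orthonormal g [] \<longleftrightarrow> True"
| "orthonormal g (e # B) \<longleftrightarrow> g e e = 1 \<and> (\<forall>b\<in>set B. g e b = 0) \<and> orthonormal g B"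

lemma inner_form_linear:
  assumes "inner_form g" shows "linear (g x)" "linear (\<lambda>x. g x y)"
  using assms by (auto simp: inner_form_def bilinear_def)

lemma inner_form_sym: "inner_form g \<Longrightarrow> g x y = g y x"
  by (auto simp: inner_form_def)

lemma orthonormal_append:
  "orthonormal g (xs @ ys) \<longleftrightarrow> orthonormal g xs \<and> orthonormal g ys \<and> (\<forall>x\<in>set xs. \<forall>y\<in>set ys. g x y = 0)"
  by (induction xs) auto

lemma orthonormal_nth:
  assumes "\<And>x y. g x y = g y x"
  shows "orthonormal g B \<longleftrightarrow>
    (\<forall>i<length B. \<forall>j<length B. g (B ! i) (B ! j) = (if i = j then 1 else 0))"
proof (induction B)
  case (Cons e B)
  have "(\<forall>b\<in>set B. g e b = 0) \<longleftrightarrow> (\<forall>i<length B. g e (B ! i) = 0)"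
    by (simp add: all_set_conv_all_nth)
  moreover have "g (B ! i) e = g e (B ! i)" for i by (rule assms)
  ultimately show ?case unfolding orthonormal.simps Cons
    by (auto simp: All_less_Suc2)
qed simp

lemma orthonormal_frame_iff:
  assumes "inner_form (metric w)"
  shows "orthonormal_frame w B \<longleftrightarrow> length B = 2 * CARD('n) \<and> orthonormal (metric w) (B :: (complex ^ 'n::finite) list)"
  unfolding orthonormal_frame_def using orthonormal_nth[of "metric w"] inner_form_sym[OF assms] by blast

lemma orthonormal_combination:
  assumes g: "inner_form g" and "orthonormal g B" "x \<in> span (set B)"
  shows "x = (\<Sum>e\<leftarrow>B. g e x *\<^sub>R e)"
  using assms(2,3)
proof (induction B arbitrary: x)
  case (Cons e B)
  have g_sym: "g b e = 0" if "b \<in> set B" for b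
    using Cons.prems that inner_form_sym[OF g, of b e] by simp
  obtain k where k: "x - k *\<^sub>R e \<in> span (set B)"
    using Cons.prems by (auto simp: span_insert)
  have lin: "g b (x - k *\<^sub>R e) = g b x - k * g b e" for b
    using inner_form_linear(1)[OF g] by (simp add: linear_diff linear_scale)
  have eq: "x - k *\<^sub>R e = (\<Sum>b\<leftarrow>B. g b (x - k *\<^sub>R e) *\<^sub>R b)"
    using Cons k by simp
  have "g e (\<Sum>b\<leftarrow>B. g b (x - k *\<^sub>R e) *\<^sub>R b) = (\<Sum>b\<leftarrow>B. g b (x - k *\<^sub>R e) *\<^sub>R g e b)"
    by (rule linear_sum_list[OF inner_form_linear(1)[OF g]])
  also have "\<dots> = (\<Sum>b\<leftarrow>B. 0)" using Cons.prems by (intro arg_cong[of _ _ sum_list] map_cong) auto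
  finally have "g e (x - k *\<^sub>R e) = 0" using eq by simp
  then have ke: "k = g e x" using lin[of e] Cons.prems by simp
  have "(\<Sum>b\<leftarrow>B. g b (x - k *\<^sub>R e) *\<^sub>R b) = (\<Sum>b\<leftarrow>B. g b x *\<^sub>R b)"
    using Cons.prems by (intro arg_cong[of _ _ sum_list] map_cong) (auto simp: lin g_sym)
  then show ?case using eq ke by (simp add: algebra_simps)
qed (simp)

lemma orthonormal_distinct_independent:
  assumes g: "inner_form g" and "orthonormal g B"
  shows "distinct B \<and> independent (set B)"
  using assms(2)
proof (induction B)
  case (Cons e B)
  have g_sym: "g b e = 0" if "b \<in> set B" for b
    using Cons.prems that inner_form_sym[OF g, of b e] by simp
  have "e \<notin> span (set B)"
  proof
    assume "e \<in> span (set B)"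
    then have "e = (\<Sum>b\<leftarrow>B. g b e *\<^sub>R b)" using orthonormal_combination[OF g] Cons.prems by simp
    also have "\<dots> = (\<Sum>b\<leftarrow>B. 0)"
      using Cons.prems by (intro arg_cong[of _ _ sum_list] map_cong) (auto simp: g_sym)
    finally have "e = 0" by simp
    then show False using Cons.prems linear_0[OF inner_form_linear(1)[OF g]] by simp
  qed
  then show ?case using Cons span_superset[of "set B"] by (auto simp: independent_insert)
qed (simp add: independent_empty)

lemma orthonormal_spanning:
  fixes B :: "'v::euclidean_space list"
  assumes "inner_form g" "orthonormal g B" "length B = DIM('v)"
  shows "span (set B) = UNIV"
proof -
  have d: "distinct B" "independent (set B)"
    using orthonormal_distinct_independent assms by auto
  then have "dim (set B) = DIM('v)"
    using assms(3) by (simp add: dim_eq_card_independent distinct_card)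
  then show ?thesis by (simp add: dim_eq_full)
qed

text \<open>
  The step of the Gram-Schmidt process.
\<close>

lemma orthonormal_residual:
  assumes g: "inner_form g" and B: "orthonormal g B" and e: "e \<notin> span (set B)"
  defines "r \<equiv> e - (\<Sum>b\<leftarrow>B. g e b *\<^sub>R b)"
  shows "g r r > 0" "orthonormal g ((r /\<^sub>R sqrt (g r r)) # B)"
    "span (insert (r /\<^sub>R sqrt (g r r)) (set B)) = span (insert e (set B))"
proof -
  have sp: "(\<Sum>b\<leftarrow>B'. g e b *\<^sub>R b) \<in> span (set B)" if "set B' \<subseteq> set B" for B'
    using that by (induction B') (auto intro: span_zero span_add span_mul span_base)
  have "r \<noteq> 0" using e sp[of B] by (auto simp: r_def)
  then show pos: "g r r > 0" using g by (simp add: inner_form_def)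
  have orth: "g r b = 0" if "b \<in> set B" for b
  proof -
    have "b = (\<Sum>c\<leftarrow>B. g c b *\<^sub>R c)"
      using orthonormal_combination[OF g B] that span_base by blast
    then have "g e b = (\<Sum>c\<leftarrow>B. g c b *\<^sub>R g e c)"
      using linear_sum_list[OF inner_form_linear(1)[OF g, of e], of "\<lambda>c. g c b" "\<lambda>c. c" B] by metis
    moreover have "g (\<Sum>c\<leftarrow>B. g e c *\<^sub>R c) b = (\<Sum>c\<leftarrow>B. g e c *\<^sub>R g c b)"
      by (rule linear_sum_list[OF inner_form_linear(2)[OF g]])
    ultimately show ?thesis
      by (simp add: r_def linear_diff[OF inner_form_linear(2)[OF g]] mult.commute)
  qed
  show "orthonormal g ((r /\<^sub>R sqrt (g r r)) # B)"
    using pos B orth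
    by (auto simp: linear_scale[OF inner_form_linear(2)[OF g]] linear_scale[OF inner_form_linear(1)[OF g]]
        field_simps simp flip: power2_eq_square)
  let ?s = "sqrt (g r r)"
  have nz: "?s \<noteq> 0" using pos by simp
  show "span (insert (r /\<^sub>R ?s) (set B)) = span (insert e (set B))" (is "?L = ?R")
  proof
    have "r \<in> ?R" unfolding r_def
      using sp[of B] span_mono[of "set B" "insert e (set B)"] by (intro span_diff) (auto intro: span_base)
    then show "?L \<subseteq> ?R"
      by (intro span_minimal) (auto intro: span_base span_mul)
    have "r = ?s *\<^sub>R (r /\<^sub>R ?s)" using nz by simp
    then have "r \<in> ?L" by (metis span_mul span_base insertI1)
    then have "r + (\<Sum>b\<leftarrow>B. g e b *\<^sub>R b) \<in> ?L"
      using sp[of B] span_mono[of "set B" "insert (r /\<^sub>R ?s) (set B)"] by (intro span_add) auto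
    then have "e \<in> ?L" by (simp add: r_def)
    then show "?R \<subseteq> ?L"
      by (intro span_minimal) (auto intro: span_base)
  qed
qed

lemma orthonormal_extend:
  fixes B :: "'v::euclidean_space list"
  assumes "inner_form g" "orthonormal g B" "length B < DIM('v)"
  obtains e where "orthonormal g (e # B)"
proof -
  have "dim (span (set B)) \<le> card (set B)" by (simp add: dim_le_card')
  also have "\<dots> < DIM('v)" using card_length[of B] assms(3) by linarith
  finally have "span (set B) \<noteq> UNIV" by (metis dim_UNIV less_irrefl)
  then obtain e where "e \<notin> span (set B)" by auto
  then show thesis using orthonormal_residual[OF assms(1,2)] that by blast
qed

lemma continuous_on_bilinear_family:
  fixes g :: "'z::topological_space \<Rightarrow> 'v::euclidean_space \<Rightarrow> 'v \<Rightarrow> real"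
  assumes "\<And>z. z \<in> U \<Longrightarrow> bilinear (g z)" "\<And>x y. continuous_on U (\<lambda>z. g z x y)"
    and "continuous_on U p" "continuous_on U q"
  shows "continuous_on U (\<lambda>z. g z (p z) (q z))"
proof -
  have "g z (p z) (q z) = (\<Sum>(a, b)\<in>Basis \<times> Basis. (p z \<bullet> a) * (q z \<bullet> b) * g z a b)" if "z \<in> U" for z
  proof -
    have "g z (p z) (q z) = g z (\<Sum>a\<in>Basis. (p z \<bullet> a) *\<^sub>R a) (\<Sum>b\<in>Basis. (q z \<bullet> b) *\<^sub>R b)"
      by (simp add: euclidean_representation)
    also have "\<dots> = (\<Sum>(a, b)\<in>Basis \<times> Basis. g z ((p z \<bullet> a) *\<^sub>R a) ((q z \<bullet> b) *\<^sub>R b))"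
      by (rule bilinear_sum[OF assms(1)[OF that]])
    finally show ?thesis
      by (simp add: bilinear_lmul[OF assms(1)[OF that]] bilinear_rmul[OF assms(1)[OF that]] mult_ac)
  qed
  moreover have "continuous_on U (\<lambda>z. \<Sum>(a, b)\<in>Basis \<times> Basis. (p z \<bullet> a) * (q z \<bullet> b) * g z a b)"
    unfolding case_prod_beta using assms by (intro continuous_intros) auto
  ultimately show ?thesis by (simp cong: continuous_on_cong)
qed

text \<open>
  The Gram-Schmidt process, applied to a fixed basis, depends continuously on the inner product.
  This is the source of the continuity of the Hodge star.
\<close>

lemma continuous_orthonormal_frame:
  fixes g :: "'z::topological_space \<Rightarrow> 'v::euclidean_space \<Rightarrow> 'v \<Rightarrow> real"
  assumes g: "\<And>z. z \<in> U \<Longrightarrow> inner_form (g z)" and gc: "\<And>x y. continuous_on U (\<lambda>z. g z x y)"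
    and "distinct es" "independent (set es)"
  shows "\<exists>fs. length fs = length es \<and> (\<forall>f\<in>set fs. continuous_on U f) \<and>
     (\<forall>z\<in>U. orthonormal (g z) (map (\<lambda>f. f z) fs) \<and> span (set (map (\<lambda>f. f z) fs)) = span (set es))"
  using assms(3,4)
proof (induction es)
  case (Cons e es)
  then have ind: "e \<notin> span (set es)" "independent (set es)"
    by (auto simp: independent_insert)
  then obtain fs where fs: "length fs = length es" "\<And>f. f \<in> set fs \<Longrightarrow> continuous_on U f"
    "\<And>z. z \<in> U \<Longrightarrow> orthonormal (g z) (map (\<lambda>f. f z) fs)"
    "\<And>z. z \<in> U \<Longrightarrow> span (set (map (\<lambda>f. f z) fs)) = span (set es)"
    using Cons by auto
  have bil: "\<And>z. z \<in> U \<Longrightarrow> bilinear (g z)" using g by (simp add: inner_form_def)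
  define r where "r z = e - (\<Sum>b\<leftarrow>map (\<lambda>f. f z) fs. g z e b *\<^sub>R b)" for z
  define h where "h z = r z /\<^sub>R sqrt (g z (r z) (r z))" for z
  have res: "g z (r z) (r z) > 0" "orthonormal (g z) (h z # map (\<lambda>f. f z) fs)"
    "span (insert (h z) (set (map (\<lambda>f. f z) fs))) = span (insert e (set (map (\<lambda>f. f z) fs)))" if "z \<in> U" for z
    using orthonormal_residual[OF g[OF that] fs(3)[OF that], of e] fs(4)[OF that] ind
    by (simp_all add: r_def h_def)
  have "continuous_on U (\<lambda>z. \<Sum>b\<leftarrow>map (\<lambda>f. f z) fs'. g z e b *\<^sub>R b)" if "set fs' \<subseteq> set fs" for fs'
    using that fs(2)
    by (induction fs') (auto intro!: continuous_intros continuous_on_bilinear_family[OF bil gc])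
  then have cr: "continuous_on U r" unfolding r_def by (intro continuous_intros) auto
  have "continuous_on U h" unfolding h_def
    using res(1) by (intro continuous_intros cr continuous_on_bilinear_family[OF bil gc]) force+
  moreover have "span (set (map (\<lambda>f. f z) (h # fs))) = span (set (e # es))" if "z \<in> U" for z
    using res(3)[OF that] fs(4)[OF that] by (simp add: span_insert)
  ultimately show ?case
    using fs res by (intro exI[of _ "h # fs"]) auto
qed auto

lemma multi_alt_covector:
  assumes "linear t" shows "multi_alt (covector t)"
proof (rule multi_altI)
  show "linear (\<lambda>v. covector t (ps @ v # qs))" for ps qs
  proof (cases "ps = [] \<and> qs = []")
    case True
    then show ?thesis using linear_compose[OF assms, of complex_of_real]
      by (simp add: covector_def o_def bounded_linear.linear bounded_linear_of_real)
  next
    case False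
    then show ?thesis by (auto simp: covector_def linear_zero_map)
  qed
qed (simp add: covector_def)

lemma multi_alt_wedge_list: "(\<And>a. a \<in> set as \<Longrightarrow> multi_alt a) \<Longrightarrow> multi_alt (wedge_list as)"
  by (induction as) (auto simp: multi_alt_one multi_alt_wedge)

text \<open>
  The products of the covectors dual to two families of vectors have a symmetric Gram matrix.
  Hence the expansion of one form along \<open>B'\<close> can be moved to the other form, where the sum over \<open>B\<close>
  collapses.
\<close>

lemma pairing_frame_independent:
  fixes B B' :: "(complex ^ 'n::finite) list"
  assumes g: "inner_form g" and B: "orthonormal g B" "span (set B) = UNIV"
    and B': "orthonormal g B'" "span (set B') = UNIV" and ab: "multi_alt a" "multi_alt b"
  shows "pairing a b B = pairing a b B'"
proof -
  define t where "t E e = g e E" for E e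
  define cov where "cov Es = wedge_list (map (\<lambda>E. covector (t E)) Es)" for Es
  have exp: "E = (\<Sum>e\<leftarrow>B. t E e *\<^sub>R e)" "E = (\<Sum>e\<leftarrow>B'. t E e *\<^sub>R e)" for E
    unfolding t_def using orthonormal_combination[OF g] B B' by auto
  have "linear (t E)" for E
    unfolding t_def by (rule inner_form_linear(2)[OF g])
  then have m: "multi_alt (cov Es)" for Es
    unfolding cov_def by (intro multi_alt_wedge_list) (auto intro!: multi_alt_covector)
  have sym: "cov E F = cov F E" for E F
    using pairing_covectors[OF exp(1) m] pairing_commute unfolding cov_def by metis
  have "pairing a b B = (\<Sum>S\<in>Pow {..<length B}. pairing (cov (nths B S)) a B' * b (nths B S))"
    unfolding pairing_def[of a b B] cov_def by (simp add: pairing_covectors[OF exp(2) ab(1)])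
  also have "\<dots> = (\<Sum>S\<in>Pow {..<length B}. \<Sum>T\<in>Pow {..<length B'}.
      a (nths B' T) * (cov (nths B' T) (nths B S) * b (nths B S)))"
    unfolding pairing_def sum_distrib_right by (simp add: sym[of "nths B _"] mult_ac)
  also have "\<dots> = (\<Sum>T\<in>Pow {..<length B'}. a (nths B' T) * pairing (cov (nths B' T)) b B)"
    unfolding pairing_def sum_distrib_left by (rule sum.swap)
  also have "\<dots> = pairing a b B'"
    unfolding cov_def pairing_covectors[OF exp(1) ab(2)] by (simp add: pairing_def)
  finally show ?thesis .
qed

section \<open>The Hodge star in a frame\<close>

lemma multi_alt_shuffle:
  assumes "multi_alt a" "S \<subseteq> {..<length vs}"
  shows "a (ps @ nths vs S @ nths vs (- S)) = shuffle_sign (length vs) S * a (ps @ vs)"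
  using assms(2)
proof (induction vs arbitrary: S ps)
  case Nil
  then show ?case by (simp add: shuffle_sign_def)
next
  case (Cons v vs)
  obtain S' where S': "S' \<subseteq> {..<length vs}" "S = insert 0 (Suc ` S') \<or> S = Suc ` S'"
  proof -
    have "S \<in> Pow {..<Suc (length vs)}" using Cons.prems by simp
    then have "S \<in> (\<lambda>S. insert 0 (Suc ` S)) ` Pow {..<length vs} \<union> (\<lambda>S. Suc ` S) ` Pow {..<length vs}"
      unfolding lessThan_Suc_eq_insert_0 Pow_insert image_Pow_surj[OF refl, symmetric]
      by (auto simp: image_image)
    then show thesis using that by auto
  qed
  note simps = shuffle_sign_Suc[OF S'(1)] nths_Cons_image
  from S'(2) show ?case
  proof
    assume S: "S = insert 0 (Suc ` S')"
    show ?thesis unfolding S simps length_Cons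
      using Cons.IH[OF S'(1), of "ps @ [v]"] by simp
  next
    assume S: "S = Suc ` S'"
    have "a (ps @ nths vs S' @ v # nths vs (- S')) = (-1) ^ card S' * a ((ps @ [v]) @ nths vs S' @ nths vs (- S'))"
      using multi_alt_move[OF assms(1), of ps "nths vs S'" v "nths vs (- S')"]
      by (simp add: length_nths_subset[OF S'(1)])
    then show ?thesis unfolding S simps length_Cons
      using Cons.IH[OF S'(1), of "ps @ [v]"] by simp
  qed
qed

text \<open>
  The Hodge star in coordinates. If \<open>S\<close> is a set of indices, then only the complementary sublist of
  \<open>B\<close> contributes to the value on the sublist with indices in \<open>S\<close>.
\<close>

definition frame_star :: "'n::finite ext \<Rightarrow> (complex ^ 'n) list \<Rightarrow> 'n ext \<Rightarrow> 'n ext" where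
  "frame_star vol B b = (\<lambda>ws. pairing b (\<lambda>us. vol (us @ ws)) B)"

lemma alt_form_pairing:
  assumes "alt_form (k + l) vol" "has_degree k b"
  shows "alt_form l (\<lambda>ws. pairing b (\<lambda>us. vol (us @ ws)) B)"
    and "alt_form l (\<lambda>us. pairing b (\<lambda>ws. vol (us @ ws)) B)"
proof -
  have m: "multi_alt vol" and h: "has_degree (k + l) vol" using assms by (auto simp: alt_form_iff)
  have z: "b us * vol (us @ ws) = 0" "b us * vol (ws @ us) = 0" if "length ws \<noteq> l" for us ws
    using that assms(2) h by (cases "length us = k"; auto simp: has_degree_def)+
  have "multi_alt (\<lambda>ws. pairing b (\<lambda>us. vol (us @ ws)) B)"
  proof (rule multi_altI)
    show "linear (\<lambda>v. pairing b (\<lambda>us. vol (us @ ps @ v # qs)) B)" for ps qs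
      unfolding pairing_def
      by (intro linear_compose_sum ballI linear_complex_cmult)
         (use multi_alt_linear[OF m, of "_ @ ps"] in simp)
    show "pairing b (\<lambda>us. vol (us @ ps @ v # v # qs)) B = 0" for ps v qs
      using multi_alt_repeat[OF m] by (simp add: pairing_def)
  qed
  then show "alt_form l (\<lambda>ws. pairing b (\<lambda>us. vol (us @ ws)) B)"
    unfolding alt_form_iff has_degree_def by (simp add: pairing_def z)
  have "multi_alt (\<lambda>us. pairing b (\<lambda>ws. vol (us @ ws)) B)"
  proof (rule multi_altI)
    show "linear (\<lambda>v. pairing b (\<lambda>us. vol ((ps @ v # qs) @ us)) B)" for ps qs
      unfolding pairing_def
      by (intro linear_compose_sum ballI linear_complex_cmult)
         (use multi_alt_linear[OF m, of ps] in simp)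
    show "pairing b (\<lambda>us. vol ((ps @ v # v # qs) @ us)) B = 0" for ps v qs
      using multi_alt_repeat[OF m] by (simp add: pairing_def)
  qed
  then show "alt_form l (\<lambda>us. pairing b (\<lambda>ws. vol (us @ ws)) B)"
    unfolding alt_form_iff has_degree_def by (simp add: pairing_def z)
qed

lemma complementary_sublists:
  assumes "alt_form (length B) vol" "S \<subseteq> {..<length B}" "T \<subseteq> {..<length B}" "S \<noteq> T" "distinct B"
  shows "vol (nths B S @ nths B (- T)) = 0"
proof (rule ccontr)
  assume nz: "vol (nths B S @ nths B (- T)) \<noteq> 0"
  then have d: "distinct (nths B S @ nths B (- T))"
    using multi_alt_repeat[of vol "nths B S @ nths B (- T)"] assms(1) by (auto simp: alt_form_iff)
  have len: "length (nths B S @ nths B (- T)) = length B"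
    using nz assms(1) unfolding alt_form_iff has_degree_def by blast
  have "S \<subseteq> T"
  proof
    fix i assume i: "i \<in> S"
    then have "B ! i \<in> set (nths B S)" using assms(2) by (auto simp: set_nths)
    then have "B ! i \<notin> set (nths B (- T))" using d by auto
    then show "i \<in> T" using i assms(2) by (auto simp: set_nths)
  qed
  moreover have "card T \<le> card S"
  proof -
    have "{i. i < length B \<and> i \<in> - T} = {..<length B} - T" by auto
    then have "length (nths B (- T)) = length B - card T"
      using assms(3) by (auto simp: length_nths card_Diff_subset finite_subset)
    moreover have "card T \<le> length B" using card_mono[OF _ assms(3)] by simp
    ultimately show ?thesis using len by (simp add: length_nths_subset[OF assms(2)])
  qed
  ultimately have "S = T" using assms(3) by (meson card_seteq finite_lessThan finite_subset)
  then show False using assms(4) by simp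
qed

lemma Pow_lessThan_Compl:
  "(\<Sum>S\<in>Pow {..<n}. f S) = (\<Sum>S\<in>Pow {..<(n::nat)}. f ({..<n} - S))"
  by (rule sum.reindex_bij_witness[of _ "\<lambda>S. {..<n} - S" "\<lambda>S. {..<n} - S"]) (auto simp: Diff_Diff_Int Int_absorb1)

lemma nths_cong_index:
  assumes "\<And>i. i < length B \<Longrightarrow> i \<in> S \<longleftrightarrow> i \<in> T"
  shows "nths B S = nths B T"
  unfolding nths_def by (intro arg_cong[of _ _ "map fst"] filter_cong) (use assms in \<open>auto simp: set_zip\<close>)

lemma nths_Compl_eq: "nths B (- S) = nths B ({..<length B} - S)"
  by (rule nths_cong_index) auto

lemma pairing_complementary:
  assumes "alt_form (length B) vol" "distinct B" "T \<subseteq> {..<length B}"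
  shows "pairing b (\<lambda>us. vol (us @ nths B (- T))) B = b (nths B T) * (shuffle_sign (length B) T * vol B)"
    and "pairing b (\<lambda>ws. vol (nths B T @ ws)) B = b (nths B (- T)) * (shuffle_sign (length B) T * vol B)"
proof -
  have v: "vol (nths B T @ nths B (- T)) = shuffle_sign (length B) T * vol B"
    using multi_alt_shuffle[of vol T B "[]"] assms by (simp add: alt_form_iff)
  have "pairing b (\<lambda>us. vol (us @ nths B (- T))) B =
      (\<Sum>S\<in>Pow {..<length B}. if S = T then b (nths B T) * vol (nths B T @ nths B (- T)) else 0)"
    unfolding pairing_def
    by (intro sum.cong refl) (use complementary_sublists[OF assms(1) _ assms(3) _ assms(2)] in auto)
  then show "pairing b (\<lambda>us. vol (us @ nths B (- T))) B = b (nths B T) * (shuffle_sign (length B) T * vol B)"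
    using assms(3) v by simp
  have "pairing b (\<lambda>ws. vol (nths B T @ ws)) B =
      (\<Sum>S\<in>Pow {..<length B}. b (nths B (- S)) * vol (nths B T @ nths B (- S)))"
    unfolding pairing_def by (subst Pow_lessThan_Compl) (simp add: nths_Compl_eq)
  also have "\<dots> = (\<Sum>S\<in>Pow {..<length B}. if S = T then b (nths B (- T)) * vol (nths B T @ nths B (- T)) else 0)"
  proof (intro sum.cong refl)
    fix S assume "S \<in> Pow {..<length B}"
    then show "b (nths B (- S)) * vol (nths B T @ nths B (- S)) =
      (if S = T then b (nths B (- T)) * vol (nths B T @ nths B (- T)) else 0)"
      using complementary_sublists[OF assms(1,3) _ _ assms(2), of S] by auto
  qed
  finally show "pairing b (\<lambda>ws. vol (nths B T @ ws)) B = b (nths B (- T)) * (shuffle_sign (length B) T * vol B)"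
    using assms(3) v by simp
qed

text \<open>
  Both sides are of top degree, so a comparison on the frame suffices. There every shuffle meets
  exactly its complement, and its sign appears squared.
\<close>

lemma wedge_frame_star:
  assumes "length B = k + l" "distinct B" "span (set B) = UNIV"
    and vol: "alt_form (k + l) vol" and "alt_form k u" "alt_form k b"
  shows "wedge u (frame_star vol B b) = ext_scale (pairing u b B) vol"
proof -
  have vol': "alt_form (length B) vol" using vol assms(1) by simp
  have al: "alt_form l (frame_star vol B b)"
    unfolding frame_star_def using alt_form_pairing(1)[OF vol] assms by (simp add: alt_form_iff)
  have "wedge u (frame_star vol B b) - ext_scale (pairing u b B) vol = 0"
  proof (rule top_form_eq_zeroI[OF assms(2,3)])
    show "alt_form (length B) (wedge u (frame_star vol B b) - ext_scale (pairing u b B) vol)"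
      using alt_form_wedge[OF assms(5) al] vol assms(1) by (auto intro!: alt_form_closed)
    have "wedge u (frame_star vol B b) B = (\<Sum>S\<in>Pow {..<length B}.
        shuffle_sign (length B) S * u (nths B S) * (b (nths B S) * (shuffle_sign (length B) S * vol B)))"
      unfolding wedge_eq frame_star_def
      by (intro sum.cong refl) (simp add: pairing_complementary(1)[OF vol' assms(2)])
    also have "\<dots> = (\<Sum>S\<in>Pow {..<length B}. u (nths B S) * b (nths B S) * vol B)"
    proof (intro sum.cong refl)
      fix S
      have "shuffle_sign (length B) S * u (nths B S) * (b (nths B S) * (shuffle_sign (length B) S * vol B)) =
         (shuffle_sign (length B) S * shuffle_sign (length B) S) * (u (nths B S) * b (nths B S) * vol B)"
        by (simp only: mult_ac)
      then show "shuffle_sign (length B) S * u (nths B S) * (b (nths B S) * (shuffle_sign (length B) S * vol B)) =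
         u (nths B S) * b (nths B S) * vol B" by simp
    qed
    also have "\<dots> = pairing u b B * vol B"
      by (simp add: pairing_def sum_distrib_right)
    finally show "(wedge u (frame_star vol B b) - ext_scale (pairing u b B) vol) B = 0"
      by (simp add: ext_scale_def)
  qed
  then show ?thesis by (metis eq_iff_diff_eq_0)
qed

text \<open>
  The form \<open>u\<close> dual to the conjugate of \<open>d\<close> satisfies \<open>(u \<and> d) B = vol B * \<Sum>\<^sub>S |d B\<^sub>S|^2\<close>, and this can
  only vanish if \<open>d\<close> does.
\<close>

lemma wedge_nondegenerate:
  fixes d vol :: "'n::finite ext" and B :: "(complex ^ 'n) list"
  assumes "length B = k + l" "distinct B" "span (set B) = UNIV"
    and vol: "alt_form (k + l) vol" "vol \<noteq> 0"
    and d: "alt_form l d" "\<And>u. alt_form k u \<Longrightarrow> wedge u d = 0"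
  shows "d = 0"
proof (rule multi_alt_eqI[OF assms(2,3)])
  have vol': "alt_form (length B) vol" using vol assms(1) by simp
  show "multi_alt d" using d(1) by (simp add: alt_form_iff)
  define u where "u us = pairing (ext_cnj d) (\<lambda>ws. vol (us @ ws)) B" for us
  have "alt_form k u"
    unfolding u_def using alt_form_pairing(2)[of l k vol "ext_cnj d"] vol d(1)
    by (simp add: alt_form_iff has_degree_closed add.commute)
  then have "wedge u d B = 0" using d(2) by simp
  moreover have "wedge u d B = (\<Sum>S\<in>Pow {..<length B}.
      shuffle_sign (length B) S * (cnj (d (nths B (- S))) * (shuffle_sign (length B) S * vol B)) * d (nths B (- S)))"
    unfolding wedge_eq u_def
    by (intro sum.cong refl) (simp add: pairing_complementary(2)[OF vol' assms(2)] ext_cnj_def)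
  moreover have "\<dots> = (\<Sum>S\<in>Pow {..<length B}. vol B * of_real ((cmod (d (nths B (- S))))\<^sup>2))"
  proof (intro sum.cong refl)
    fix S
    have "shuffle_sign (length B) S * (cnj (d (nths B (- S))) * (shuffle_sign (length B) S * vol B)) * d (nths B (- S)) =
      (shuffle_sign (length B) S * shuffle_sign (length B) S) * (vol B * (d (nths B (- S)) * cnj (d (nths B (- S)))))"
      by (simp only: mult_ac)
    then show "shuffle_sign (length B) S * (cnj (d (nths B (- S))) * (shuffle_sign (length B) S * vol B)) * d (nths B (- S))
       = vol B * of_real ((cmod (d (nths B (- S))))\<^sup>2)"
      by (simp add: complex_norm_square del: of_real_power)
  qed
  moreover have "vol B \<noteq> 0" using top_form_eq_zeroI[OF assms(2,3) vol'] vol(2) by blast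
  ultimately have "vol B * complex_of_real (\<Sum>S\<in>Pow {..<length B}. (cmod (d (nths B (- S))))\<^sup>2) = 0"
    by (simp only: sum_distrib_left of_real_sum)
  then have "(\<Sum>S\<in>Pow {..<length B}. (cmod (d (nths B (- S))))\<^sup>2) = 0"
    using \<open>vol B \<noteq> 0\<close> by (simp only: mult_eq_0_iff of_real_eq_0_iff) simp
  then have z: "d (nths B (- S)) = 0" if "S \<in> Pow {..<length B}" for S
    using that by (subst (asm) sum_nonneg_eq_0_iff) auto
  fix S assume S: "S \<subseteq> {..<length B}"
  have "nths B S = nths B (- ({..<length B} - S))"
    using S by (intro nths_cong_index) auto
  then show "d (nths B S) = 0" using z[of "{..<length B} - S"] by simp
qed

lemma ext_inner_eq_pairing:
  fixes B :: "(complex ^ 'n::finite) list"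
  assumes "inner_form (metric w)" "orthonormal_frame w B" "multi_alt a" "multi_alt b"
  shows "ext_inner w a b = pairing a (ext_cnj b) B"
proof -
  define B0 :: "(complex ^ 'n) list" where "B0 = (SOME B. orthonormal_frame w B)"
  have B0: "orthonormal_frame w B0" unfolding B0_def using assms(2) by (rule someI)
  have dim: "DIM(complex ^ 'n) = 2 * CARD('n)" by simp
  have sp: "orthonormal (metric w) B'" "span (set B') = UNIV" if "orthonormal_frame w B'" for B' :: "(complex ^ 'n) list"
    using that orthonormal_spanning[OF assms(1)] unfolding orthonormal_frame_iff[OF assms(1)] dim by auto
  have "ext_inner w a b = pairing a (ext_cnj b) B0"
    by (simp add: ext_inner_def B0_def pairing_def ext_cnj_def Let_def)
  also have "\<dots> = pairing a (ext_cnj b) B"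
    using sp[OF B0] sp[OF assms(2)] assms by (intro pairing_frame_independent[OF assms(1)]) (auto intro: multi_alt_cnj)
  finally show ?thesis .
qed

lemma hodge_star_at_frame:
  fixes B :: "(complex ^ 'n::finite) list"
  assumes g: "inner_form (metric w)" and B: "orthonormal_frame w B"
    and vol: "alt_form (2 * CARD('n)) (vol_at w)" "vol_at w \<noteq> 0"
    and b: "alt_form k b" "k \<le> 2 * CARD('n)"
  shows "hodge_star_at w k b = frame_star (vol_at w) B b"
proof -
  let ?N = "2 * CARD('n)"
  have dim: "DIM(complex ^ 'n) = ?N" by simp
  have on: "orthonormal (metric w) B" "length B = ?N"
    using B unfolding orthonormal_frame_iff[OF g] by auto
  have B': "length B = k + (?N - k)" "distinct B" "span (set B) = UNIV"
    using on orthonormal_spanning[OF g, of B] orthonormal_distinct_independent[OF g, of B] b(2) dim by auto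
  have vol': "alt_form (k + (?N - k)) (vol_at w)" using vol b(2) by simp
  have inner: "ext_inner w u (ext_cnj b) = pairing u b B" if "alt_form k u" for u
  proof -
    have "ext_cnj (ext_cnj b) = b" by (simp add: ext_cnj_def)
    then show ?thesis
      using ext_inner_eq_pairing[OF g B, of u "ext_cnj b"] that b by (simp add: alt_form_iff multi_alt_cnj)
  qed
  show ?thesis
    unfolding hodge_star_at_def
  proof (rule the_equality)
    show st: "alt_form (?N - k) (frame_star (vol_at w) B b) \<and> (\<forall>u. alt_form k u \<longrightarrow>
        wedge u (frame_star (vol_at w) B b) = ext_scale (ext_inner w u (ext_cnj b)) (vol_at w))"
      using wedge_frame_star[OF B' vol' _ b(1)] inner alt_form_pairing(1)[OF vol', of b] b(1)
      by (auto simp: frame_star_def alt_form_iff)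
    fix s assume s: "alt_form (?N - k) s \<and> (\<forall>u. alt_form k u \<longrightarrow>
        wedge u s = ext_scale (ext_inner w u (ext_cnj b)) (vol_at w))"
    have "s - frame_star (vol_at w) B b = 0"
    proof (rule wedge_nondegenerate[OF B' vol' vol(2)])
      show "alt_form (?N - k) (s - frame_star (vol_at w) B b)"
        using s st by (auto intro: alt_form_closed)
      show "wedge u (s - frame_star (vol_at w) B b) = 0" if "alt_form k u" for u
        using s st that unfolding wedge_diff_right by (metis diff_self)
    qed
    then show "s = frame_star (vol_at w) B b" by (metis eq_iff_diff_eq_0)
  qed
qed

section \<open>Positive forms at a point\<close>

text \<open>
  Forms of type \<open>(k, 0)\<close>. Complex linearity in the first argument is enough, because alternation
  transports it to the others.
\<close>

definition hol_form :: "nat \<Rightarrow> 'n::finite ext \<Rightarrow> bool" where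
  "hol_form k H \<longleftrightarrow> alt_form k H \<and> (\<forall>v ws. H (\<i> *s v # ws) = \<i> * H (v # ws))"

lemma vec_ii_ii [simp]: "\<i> *s (\<i> *s v) = - (v :: complex ^ 'n)"
  by (simp add: vec_eq_iff mult.assoc[symmetric])

lemma vec_ii_simps:
  "\<i> *s (v + u) = \<i> *s v + \<i> *s (u :: complex ^ 'n)"
  "\<i> *s (v - u) = \<i> *s v - \<i> *s u"
  "\<i> *s (- v) = - (\<i> *s v)"
  "\<i> *s (t *\<^sub>R v) = t *\<^sub>R (\<i> *s v)"
  by (simp_all add: vec_eq_iff algebra_simps scaleR_conv_of_real)

lemma linear_vec_ii: "linear (\<lambda>v :: complex ^ 'n. \<i> *s v)"
  by (rule linearI) (simp_all add: vec_ii_simps)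

lemma hol_contract_ii: "hol_form k H \<Longrightarrow> contract (\<i> *s v) H = ext_scale \<i> (contract v H)"
  by (simp add: hol_form_def contract_def ext_scale_def)

lemma hol_contract:
  assumes "hol_form k H" shows "hol_form (k - 1) (contract v H)"
proof -
  have m: "multi_alt H" using assms by (simp add: hol_form_def alt_form_iff)
  have "contract v H (\<i> *s u # ws) = \<i> * contract v H (u # ws)" for u ws
    using multi_alt_swap[OF m, of "[]" v "\<i> *s u" ws] multi_alt_swap[OF m, of "[]" v u ws] assms
    by (simp add: contract_def hol_form_def)
  then show ?thesis using assms alt_form_contract by (auto simp: hol_form_def)
qed

lemma hol_wedge:
  assumes "hol_form k H" "hol_form l G" shows "hol_form (k + l) (wedge H G)"
proof -
  have "wedge H G (\<i> *s v # ws) = \<i> * wedge H G (v # ws)" for v ws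
    by (simp add: wedge_Cons hol_contract_ii[OF assms(1)] hol_contract_ii[OF assms(2)]
        wedge_scale_left wedge_scale_right ext_scale_def[of \<i> "wedge _ _"] algebra_simps)
  then show ?thesis using assms alt_form_wedge by (auto simp: hol_form_def)
qed

lemma hol_scale: "hol_form k H \<Longrightarrow> hol_form k (ext_scale c H)"
  by (auto simp: hol_form_def alt_form_closed) (simp add: ext_scale_def)

lemma hol_one: "hol_form 0 ext_one"
  unfolding hol_form_def by (intro conjI alt_form_one) (simp add: ext_one_def)

lemma ext_scale_simps:
  "ext_scale c (ext_scale d a) = ext_scale (c * d) a"
  "ext_scale 1 a = a"
  "ext_scale c 0 = 0"
  "ext_scale 0 a = 0"
  "ext_scale c (a + b) = ext_scale c a + ext_scale c b"
  "ext_scale c (a - b) = ext_scale c a - ext_scale c b"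
  "ext_scale (c + d) a = ext_scale c a + ext_scale d a"
  by (auto simp: ext_scale_def fun_eq_iff algebra_simps)

lemma ext_cnj_simps:
  "ext_cnj (ext_scale c a) = ext_scale (cnj c) (ext_cnj a)"
  "ext_cnj (ext_cnj a) = a"
  "ext_cnj (a + b) = ext_cnj a + ext_cnj b"
  "ext_cnj (a - b) = ext_cnj a - ext_cnj b"
  "ext_cnj 0 = 0"
  by (auto simp: ext_scale_def ext_cnj_def fun_eq_iff)

text \<open>
  The unit \<open>\<i> ^ (k * k)\<close> is the one that makes these products positive on complex lines and closed
  under wedge products.
\<close>

definition elementary :: "nat \<Rightarrow> 'n::finite ext \<Rightarrow> 'n ext" where
  "elementary k H = ext_scale (\<i> ^ (k * k)) (wedge H (ext_cnj H))"

text \<open>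
  The cone spanned by all \<open>\<i>^(k^2) H \<and> cnj H\<close>, where \<open>H\<close> need not be decomposable. It contains the
  strong cone, and in contrast to that cone it is seen to be stable under contraction with a
  complex line without any change of basis.
\<close>

inductive positive_cone :: "nat \<Rightarrow> 'n::finite ext \<Rightarrow> bool" for k where
  zero: "positive_cone k 0"
| add_elementary: "positive_cone k a \<Longrightarrow> hol_form k H \<Longrightarrow> positive_cone k (elementary k H + a)"

lemma elementary_positive: "hol_form k H \<Longrightarrow> positive_cone k (elementary k H)"
  using positive_cone.add_elementary[OF positive_cone.zero] by fastforce

lemma positive_cone_add: "positive_cone k a \<Longrightarrow> positive_cone k b \<Longrightarrow> positive_cone k (a + b)"
proof (induction rule: positive_cone.induct)
  case (add_elementary a H)
  then show ?case using positive_cone.add_elementary by (metis add.assoc)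
qed (simp only: add_0_left)

lemma positive_cone_sum: "(\<And>i. i \<in> I \<Longrightarrow> positive_cone k (f i)) \<Longrightarrow> positive_cone k (\<Sum>i\<in>I. f i)"
proof (induction I rule: infinite_finite_induct)
  case (insert x F)
  then show ?case unfolding sum.insert[OF insert.hyps] by (intro positive_cone_add) auto
qed (simp_all only: sum.infinite sum.empty positive_cone.zero not_False_eq_True)

lemma positive_cone_scale:
  assumes "positive_cone k a" "t \<ge> 0"
  shows "positive_cone k (ext_scale (of_real t) a)"
  using assms(1)
proof induction
  case (add_elementary a H)
  have "ext_scale (of_real t) (elementary k H) = elementary k (ext_scale (of_real (sqrt t)) H)"
    using assms(2)
    by (auto simp: elementary_def ext_scale_simps ext_cnj_simps wedge_scale_left wedge_scale_right
        mult_ac simp flip: of_real_mult)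
  then show ?case
    unfolding ext_scale_simps using add_elementary hol_scale positive_cone.add_elementary by metis
qed (simp only: ext_scale_simps positive_cone.zero)

text \<open>
  The two middle factors have to be exchanged; this sign is exactly what the units \<open>\<i> ^ (k * k)\<close>
  compensate.
\<close>

lemma elementary_wedge:
  assumes "hol_form k H" "hol_form l G"
  shows "wedge (elementary k H) (elementary l G) = elementary (k + l) (wedge H G)"
proof -
  have tH: "twist (ext_cnj H) = ext_scale ((-1) ^ k) (ext_cnj H)"
    using assms(1) by (auto simp: hol_form_def alt_form_iff has_degree_closed intro!: has_degree_twist)
  have tG: "twist G = ext_scale ((-1) ^ l) G"
    using assms(2) by (auto simp: hol_form_def alt_form_iff intro!: has_degree_twist)
  have "wedge (ext_cnj H) G = ext_scale ((-1) ^ (k * l)) (wedge G (ext_cnj H))"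
  proof (cases "even k")
    case True
    then have "twist (ext_cnj H) = ext_cnj H" using tH by (simp add: ext_scale_simps)
    then show ?thesis using wedge_comm_twist(1)[of "ext_cnj H" G] True by (simp add: ext_scale_simps)
  next
    case False
    then have "twist (ext_cnj H) = - ext_cnj H" using tH by (simp add: ext_scale_def fun_eq_iff)
    then show ?thesis using wedge_comm_twist(2)[of "ext_cnj H" G] False
      by (simp add: tG wedge_scale_left power_mult)
  qed
  then have "wedge (wedge H (ext_cnj H)) (wedge G (ext_cnj G)) =
      ext_scale ((-1) ^ (k * l)) (wedge (wedge H G) (ext_cnj (wedge H G)))"
    unfolding cnj_wedge wedge_assoc
    by (simp only: wedge_assoc[of "ext_cnj H" G, symmetric])
       (simp only: wedge_scale_left wedge_scale_right wedge_assoc)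
  moreover have "\<i> ^ (l * l) * (\<i> ^ (k * k) * (-1) ^ (k * l)) = \<i> ^ ((k + l) * (k + l))"
  proof -
    have "(k + l) * (k + l) = l * l + (k * k + 2 * (k * l))" by (simp add: algebra_simps)
    then show ?thesis by (simp only: power_add power_mult[of \<i> 2]) simp
  qed
  ultimately show ?thesis
    by (simp only: elementary_def wedge_scale_left wedge_scale_right ext_scale_simps mult.assoc)
qed

lemma positive_cone_wedge:
  assumes "positive_cone k a" "positive_cone l b" shows "positive_cone (k + l) (wedge a b)"
  using assms(1)
proof induction
  case (add_elementary a H)
  have "positive_cone (k + l) (wedge (elementary k H) b)"
    using assms(2)
  proof induction
    case (add_elementary b G)
    then show ?case unfolding wedge_add_right elementary_wedge[OF \<open>hol_form k H\<close> \<open>hol_form l G\<close>]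
      by (intro positive_cone.add_elementary hol_wedge \<open>hol_form k H\<close>)
  qed (simp only: wedge_zero_right positive_cone.zero)
  then show ?case unfolding wedge_add_left using add_elementary by (intro positive_cone_add)
qed (simp only: wedge_zero_left positive_cone.zero)

lemma positive_cone_one: "positive_cone 0 ext_one"
proof -
  have "elementary 0 ext_one = (ext_one :: 'a ext)" by (simp add: elementary_def ext_scale_simps)
  then show ?thesis using elementary_positive[OF hol_one] by metis
qed

lemma positive_cone_pow: "positive_cone 1 a \<Longrightarrow> positive_cone k (wedge_pow a k)"
proof (induction k)
  case (Suc k)
  then show ?case using positive_cone_wedge[of 1 a k] by simp
qed (simp add: positive_cone_one)

lemma alt_form_elementary: "hol_form k H \<Longrightarrow> alt_form (2 * k) (elementary k H)"
  unfolding elementary_def mult_2 hol_form_def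
  by (intro alt_form_closed(4) alt_form_wedge) (auto intro: alt_form_closed)

lemma alt_form_positive_cone: "positive_cone k a \<Longrightarrow> alt_form (2 * k) a"
proof (induction rule: positive_cone.induct)
  case (add_elementary a H)
  then show ?case by (intro alt_form_closed(2) alt_form_elementary)
qed (rule alt_form_closed)

text \<open>
  Of the four terms of the double contraction two vanish, because \<open>H\<close> is complex linear and
  alternating; the other two agree.
\<close>

lemma elementary_contract:
  assumes "hol_form k H" "k > 0"
  shows "contract (\<i> *s v) (contract v (elementary k H)) = ext_scale 2 (elementary (k - 1) (contract v H))"
proof -
  let ?H = "contract v H"
  have m: "multi_alt H" using assms by (simp add: hol_form_def alt_form_iff)
  have tH: "twist H = ext_scale ((-1) ^ k) H"
    using assms(1) by (auto simp: hol_form_def alt_form_iff intro!: has_degree_twist)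
  have tH': "twist ?H = ext_scale (- ((-1) ^ k)) ?H"
    using contract_simps(7)[of v H] unfolding tH contract_simps
    by (auto simp: fun_eq_iff ext_scale_def)
  have z: "contract (\<i> *s v) ?H = 0"
    using hol_contract_ii[OF hol_contract[OF assms(1)], of v v] contract_same[OF m, of v]
    by (simp only: ext_scale_simps)
  have J: "contract (\<i> *s v) H = ext_scale \<i> ?H" "contract (\<i> *s v) (ext_cnj H) = ext_scale (- \<i>) (ext_cnj ?H)"
    by (simp_all add: contract_simps hol_contract_ii[OF assms(1)] ext_cnj_simps)
  have "contract (\<i> *s v) (contract v (wedge H (ext_cnj H))) = ext_scale (2 * \<i> * (-1) ^ k) (wedge ?H (ext_cnj ?H))"
    by (simp only: contract_wedge contract_simps tH tH' z J wedge_zero_left wedge_zero_right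
        ext_cnj_simps wedge_scale_left wedge_scale_right ext_scale_simps add_0_left add_0_right)
       (simp add: ext_scale_def fun_eq_iff)
  moreover have "\<i> ^ (k * k) * (2 * \<i> * (-1) ^ k) = 2 * \<i> ^ ((k - 1) * (k - 1))"
  proof -
    obtain j where k: "k = Suc j" using assms(2) by (cases k) auto
    have e: "k * k = (k - 1) * (k - 1) + 2 * j + 1" by (simp add: k)
    have "(-1 :: complex) ^ k = - (\<i> ^ (2 * j))" by (simp add: k power_mult)
    moreover have "\<i> ^ (2 * j) * \<i> ^ (2 * j) = 1" by (simp add: power_mult flip: power_mult_distrib)
    ultimately show ?thesis by (simp only: e power_add power_one_right) (simp add: mult_ac)
  qed
  ultimately show ?thesis
    by (simp only: elementary_def contract_simps ext_scale_simps)
qed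

lemma positive_cone_contract:
  assumes "positive_cone k a"
  shows "positive_cone (k - 1) (contract (\<i> *s v) (contract v a))"
  using assms
proof induction
  case (add_elementary a H)
  have "positive_cone (k - 1) (contract (\<i> *s v) (contract v (elementary k H)))"
  proof (cases "k = 0")
    case True
    have "contract v (elementary k H) = 0"
      using alt_form_elementary[OF \<open>hol_form k H\<close>] True
      by (auto simp: alt_form_iff has_degree_def contract_def fun_eq_iff)
    then show ?thesis by (simp only: contract_simps positive_cone.zero)
  next
    case False
    have "positive_cone (k - 1) (ext_scale (of_real 2) (elementary (k - 1) (contract v H)))"
      by (intro positive_cone_scale elementary_positive hol_contract \<open>hol_form k H\<close>) simp
    then show ?thesis using False by (simp add: elementary_contract[OF \<open>hol_form k H\<close>])
  qed
  then show ?case unfolding contract_simps using add_elementary by (intro positive_cone_add)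
qed (simp only: contract_simps positive_cone.zero)

definition pairs :: "(complex ^ 'n) list \<Rightarrow> (complex ^ 'n) list" where
  "pairs us = concat (map (\<lambda>v. [v, \<i> *s v]) us)"

lemma pairs_simps [simp]:
  "pairs [] = []" "pairs (u # us) = u # (\<i> *s u) # pairs us" "pairs (us @ vs) = pairs us @ pairs vs"
  "length (pairs us) = 2 * length us" "set (pairs us) = set us \<union> (\<lambda>v. \<i> *s v) ` set us"
proof -
  show "length (pairs us) = 2 * length us" by (induction us) (auto simp: pairs_def)
  show "set (pairs us) = set us \<union> (\<lambda>v. \<i> *s v) ` set us" by (induction us) (auto simp: pairs_def)
qed (auto simp: pairs_def)

text \<open>
  Contraction with one complex line after the other stays in the cone and ends in degree zero,
  where the elements of the cone are non-negative numbers.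
\<close>

lemma positive_cone_pairs: "positive_cone k a \<Longrightarrow> a (pairs us) \<in> \<real>\<^sub>\<ge>\<^sub>0"
proof (induction us arbitrary: k a)
  case Nil
  then show ?case
  proof (induction rule: positive_cone.induct)
    case (add_elementary a H)
    have "elementary k H [] \<in> \<real>\<^sub>\<ge>\<^sub>0"
    proof (cases "k = 0")
      case True
      then show ?thesis
        by (simp add: elementary_def ext_scale_def ext_cnj_def complex_mult_cnj nonneg_Reals_of_real_iff del: of_real_add of_real_power)
    next
      case False
      then show ?thesis using alt_form_elementary[OF \<open>hol_form k H\<close>] by (auto simp: alt_form_iff has_degree_def)
    qed
    then show ?case using add_elementary by (auto intro: nonneg_Reals_add_I)
  qed simp
next
  case (Cons u us)
  then show ?case using Cons.IH[OF positive_cone_contract[OF Cons.prems, of u]]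
    by (simp add: contract_def)
qed

lemma nonneg_Re: "z \<in> \<real>\<^sub>\<ge>\<^sub>0 \<Longrightarrow> 0 \<le> Re z"
  by (auto simp: complex_nonneg_Reals_iff)

lemma hol_form_10: "bidegree 1 0 \<eta> \<Longrightarrow> hol_form 1 \<eta>"
  unfolding hol_form_def
proof (intro conjI allI)
  assume a: "bidegree 1 0 \<eta>"
  then show alt: "alt_form 1 \<eta>" by (simp add: bidegree_def)
  fix v ws
  show "\<eta> (\<i> *s v # ws) = \<i> * \<eta> (v # ws)"
  proof (cases ws)
    case Nil
    have "\<forall>c vs. length vs = 1 + 0 \<longrightarrow> \<eta> (map (\<lambda>v. c *s v) vs) = c ^ 1 * cnj c ^ 0 * \<eta> vs"
      by (rule conjunct2[OF a[unfolded bidegree_def]])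
    from this[rule_format, of "[v]" \<i>] show ?thesis using Nil by simp
  qed (use alt in \<open>auto simp: alt_form_iff has_degree_def\<close>)
qed

lemma strong_cone_positive:
  assumes "a \<in> strong_cone m" shows "positive_cone m a"
proof -
  obtain N \<eta> where \<eta>: "\<forall>k<N. \<forall>j<m. bidegree 1 0 (\<eta> k j)"
    and a: "a = (\<Sum>k<(N::nat). wedge_list
            (map (\<lambda>j::nat. ext_scale \<i> (wedge (\<eta> k j) (ext_cnj (\<eta> k j)))) [0..<m]))"
    using assms unfolding strong_cone_def by blast
  have wl: "positive_cone (length as) (wedge_list as)" if "\<forall>a\<in>set as. positive_cone 1 a" for as :: "'a ext list"
    using that
  proof (induction as)
    case (Cons b as)
    then show ?case using positive_cone_wedge[of 1 b "length as"] by simp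
  qed (simp add: positive_cone_one)
  have "positive_cone 1 (ext_scale \<i> (wedge (\<eta> k j) (ext_cnj (\<eta> k j))))" if "k < N" "j < m" for k j
    using elementary_positive[OF hol_form_10, of "\<eta> k j"] \<eta> that by (simp add: elementary_def)
  then have "positive_cone m (wedge_list
            (map (\<lambda>j. ext_scale \<i> (wedge (\<eta> k j) (ext_cnj (\<eta> k j)))) [0..<m]))" if "k < N" for k
    using wl[of "map (\<lambda>j. ext_scale \<i> (wedge (\<eta> k j) (ext_cnj (\<eta> k j)))) [0..<m]"] that by auto
  then show ?thesis unfolding a by (intro positive_cone_sum) auto
qed

section \<open>Real forms of equal bidegree\<close>

definition real_pp :: "nat \<Rightarrow> 'n::finite ext \<Rightarrow> bool" where
  "real_pp k a \<longleftrightarrow> alt_form (2 * k) a \<and> ext_cnj a = a \<and> (\<forall>us. a (map (\<lambda>v. \<i> *s v) us) = a us)"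

lemma real_forms_at_real_pp:
  assumes "a \<in> real_forms_at m" shows "real_pp m a"
proof -
  have b: "bidegree m m a" "ext_cnj a = a" using assms by (auto simp: real_forms_at_def)
  then have alt: "alt_form (2 * m) a" by (simp add: bidegree_def mult_2)
  have "a (map (\<lambda>v. \<i> *s v) us) = a us" for us
  proof (cases "length us = 2 * m")
    case True
    have "\<i> ^ m * cnj \<i> ^ m = 1" by (simp flip: power_mult_distrib)
    then show ?thesis using b(1) True by (simp add: bidegree_def mult_2)
  next
    case False
    then show ?thesis using alt by (auto simp: alt_form_iff has_degree_def)
  qed
  then show ?thesis using alt b by (simp add: real_pp_def)
qed

lemma real_pp_wedge:
  assumes "real_pp k a" "real_pp l b" shows "real_pp (k + l) (wedge a b)"
proof -
  have "wedge a b (map (\<lambda>v. \<i> *s v) us) = wedge a b us" for us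
    unfolding wedge_map using assms by (simp add: real_pp_def)
  then show ?thesis
    using assms alt_form_wedge[of "2 * k" a "2 * l" b] by (simp add: real_pp_def cnj_wedge distrib_left)
qed

lemma real_pp_one: "real_pp 0 ext_one"
  by (simp add: real_pp_def alt_form_one) (simp add: ext_one_def)

lemma real_pp_pow: "real_pp 1 a \<Longrightarrow> real_pp k (wedge_pow a k)"
proof (induction k)
  case (Suc k)
  then show ?case using real_pp_wedge[of 1 a k] by simp
qed (simp add: real_pp_one)

lemma real_pp_closed:
  "real_pp k a \<Longrightarrow> real_pp k b \<Longrightarrow> real_pp k (a + b)"
  "real_pp k a \<Longrightarrow> real_pp k b \<Longrightarrow> real_pp k (a - b)"
  "real_pp k a \<Longrightarrow> real_pp k (ext_scale (of_real t) a)"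
  unfolding real_pp_def by (auto intro: alt_form_closed simp: ext_cnj_simps) (auto simp: ext_scale_def)

lemma real_pp_twist: "real_pp k a \<Longrightarrow> twist a = a"
  using alt_form_even_twist by (auto simp: real_pp_def)

lemma real_pp_Im: "real_pp k a \<Longrightarrow> a us = of_real (Re (a us))"
  by (auto simp: real_pp_def ext_cnj_def fun_eq_iff complex_eq_iff)

definition herm :: "'n::finite ext \<Rightarrow> complex ^ 'n \<Rightarrow> complex ^ 'n \<Rightarrow> real" where
  "herm h x y = Re (h [x, y])"

lemma herm_bilinear:
  assumes "alt_form 2 h" shows "bilinear (herm h)"
proof -
  have m: "multi_alt h" using assms by (simp add: alt_form_iff)
  have r: "linear (\<lambda>v. Re (f v))" if "linear f" for f :: "complex ^ 'a \<Rightarrow> complex"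
    by (rule linear_compose[OF that, unfolded o_def]) (simp add: bounded_linear.linear bounded_linear_Re)
  show ?thesis unfolding bilinear_def herm_def
    using multi_alt_linear[OF m, of "[]"] multi_alt_linear[OF m, of "[_]" "[]"] by (auto intro!: r)
qed

lemma herm_simps:
  assumes "real_pp 1 h"
  shows "h [x, y] = of_real (herm h x y)" "herm h x x = 0" "herm h y x = - herm h x y"
    "herm h (\<i> *s x) (\<i> *s y) = herm h x y" "herm h (\<i> *s x) y = - herm h x (\<i> *s y)"
proof -
  have alt: "alt_form 2 h" using assms by (simp add: real_pp_def)
  then have m: "multi_alt h" by (simp add: alt_form_iff)
  show "h [x, y] = of_real (herm h x y)" unfolding herm_def by (rule real_pp_Im[OF assms])
  show "herm h x x = 0" using multi_alt_repeat[OF m, of "[x, x]"] by (simp add: herm_def)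
  show "herm h y x = - herm h x y" using multi_alt_swap[OF m, of "[]" y x "[]"] by (simp add: herm_def)
  have J: "herm h (\<i> *s x) (\<i> *s y) = herm h x y" for x y
  proof -
    have "h (map (\<lambda>v. \<i> *s v) [x, y]) = h [x, y]" using assms by (simp only: real_pp_def)
    then show ?thesis by (simp add: herm_def)
  qed
  show "herm h (\<i> *s x) (\<i> *s y) = herm h x y" by (rule J)
  show "herm h (\<i> *s x) y = - herm h x (\<i> *s y)"
    using J[of "\<i> *s x" y] bilinear_lneg[OF herm_bilinear[OF alt], of x "\<i> *s y"] by simp
qed

lemma alt_form_2_eqI:
  assumes "alt_form 2 a" "alt_form 2 b" "\<And>x y. a [x, y] = b [x, y]" shows "a = b"
proof
  fix ws :: "(complex ^ 'a) list"
  show "a ws = b ws"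
  proof (cases "length ws = 2")
    case True
    then obtain x y where "ws = [x, y]" by (auto simp: numeral_2_eq_2 length_Suc_conv)
    then show ?thesis using assms(3) by simp
  next
    case False
    then show ?thesis using assms(1,2) by (auto simp: alt_form_iff has_degree_def)
  qed
qed

lemma Basis_induct_zero:
  assumes "linear f" "\<And>j. f (axis j 1) = 0" "\<And>j. f (axis j \<i>) = (0::real)"
  shows "f (x :: complex ^ 'n::finite) = 0"
proof -
  have "f b = 0" if "b \<in> Basis" for b
    using that assms by (auto simp: Basis_vec_def Basis_complex_def)
  then have "(\<Sum>b\<in>Basis. (x \<bullet> b) *\<^sub>R f b) = 0" by simp
  then show ?thesis
    using linear_sum[OF assms(1), of "\<lambda>b. (x \<bullet> b) *\<^sub>R b" Basis] 
    by (simp add: euclidean_representation linear_scale[OF assms(1)])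
qed

text \<open>
  A semidefinite Hermitian form is a sum of squares. If \<open>h\<close> is positive on \<open>e\<close>, then subtracting the
  square of the linear form dual to \<open>e\<close> puts \<open>e\<close> into the kernel and keeps \<open>h\<close> semidefinite; if \<open>h\<close>
  vanishes on \<open>e\<close>, then \<open>e\<close> already lies in the kernel. The induction runs over the coordinate vectors
  that may lie outside the kernel.
\<close>

lemma positive_cone_psd:
  assumes "real_pp 1 h" "\<And>v. herm h v (\<i> *s v) \<ge> 0"
  shows "positive_cone 1 h"
proof -
  have "positive_cone 1 h" if "finite F" "real_pp 1 h" "\<And>v. herm h v (\<i> *s v) \<ge> 0"
     "\<And>j y. j \<notin> F \<Longrightarrow> herm h (axis j 1) y = 0" for F :: "'a set" and h :: "'a ext"
    using that
  proof (induction F arbitrary: h)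
    case empty
    note hs = herm_simps[OF empty(1)]
    have alt: "alt_form 2 h" using empty(1) by (simp add: real_pp_def)
    have ax: "axis j \<i> = \<i> *s axis j (1::complex)" for j :: 'a by (simp add: axis_def vec_eq_iff)
    have "herm h x y = 0" for x y
    proof (rule Basis_induct_zero[of "\<lambda>x. herm h x y"])
      show "linear (\<lambda>x. herm h x y)" using herm_bilinear[OF alt] by (simp add: bilinear_def)
    qed (use empty(3) hs(5) in \<open>auto simp: ax\<close>)
    then have "h = 0"
      by (intro alt_form_2_eqI alt alt_form_closed) (simp add: hs(1))
    then show ?case by (simp only: positive_cone.zero)
  next
    case (insert j F)
    note hs = herm_simps[OF insert.prems(1)]
    have alt: "alt_form 2 h" using insert.prems(1) by (simp add: real_pp_def)
    note bil = herm_bilinear[OF alt]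
    note bs = bilinear_ladd[OF bil] bilinear_radd[OF bil] bilinear_lmul[OF bil] bilinear_rmul[OF bil]
      bilinear_lsub[OF bil] bilinear_rsub[OF bil] bilinear_lneg[OF bil] bilinear_rneg[OF bil]
    define e :: "complex ^ 'a" where "e = axis j 1"
    define q where "q = herm h e (\<i> *s e)"
    define r where "r x = herm h x e" for x
    define s where "s x = herm h x (\<i> *s e)" for x
    have Jr: "r (\<i> *s x) = - s x" "s (\<i> *s x) = r x" for x
      using hs(5)[of x e] hs(4)[of x e] by (simp_all add: r_def s_def)
    have rs: "herm h e (\<i> *s x) = s x" "herm h e x = - r x" for x
      using hs(3)[of e x] hs(5)[of e x] hs(3)[of "\<i> *s e" x] by (simp_all add: r_def s_def)
    have lin: "linear r" "linear s" using bil by (simp_all add: r_def[abs_def] s_def[abs_def] bilinear_def)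
    show ?case
    proof (cases "q = 0")
      case True
      have s0: "s y = 0" for y
      proof (rule ccontr)
        assume "s y \<noteq> 0"
        \<comment> \<open>For this \<open>t\<close> the form would take the value \<open>-1\<close> at \<open>y + t e\<close>.\<close>
        define t where "t = - (herm h y (\<i> *s y) + 1) / (2 * s y)"
        have "herm h (y + t *\<^sub>R e) (\<i> *s (y + t *\<^sub>R e)) = herm h y (\<i> *s y) +
            t * herm h y (\<i> *s e) + t * herm h e (\<i> *s y) + t * t * herm h e (\<i> *s e)"
          by (simp add: vec_ii_simps bs algebra_simps)
        also have "\<dots> = herm h y (\<i> *s y) + 2 * t * s y + t * t * q"
          unfolding rs(1) by (simp add: s_def q_def)
        also have "\<dots> = -1" using \<open>s y \<noteq> 0\<close> True by (simp add: t_def field_simps)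
        finally show False using insert.prems(2)[of "y + t *\<^sub>R e"] by simp
      qed
      have "herm h e y = 0" for y using s0[of "\<i> *s y"] Jr(2) rs(2) by simp
      then have "herm h (axis i 1) y = 0" if "i \<notin> F" for i y
        using that insert.prems(3)[of i y] by (cases "i = j") (auto simp: e_def)
      then show ?thesis using insert.IH[of h] insert.prems by blast
    next
      case False
      then have q: "q > 0" using insert.prems(2)[of e] by (simp add: q_def)
      \<comment> \<open>The form \<open>\<eta>\<close> below is \<open>h\<close>-dual to \<open>e\<close>, scaled such that \<open>h\<close> and its square agree on \<open>e\<close>.\<close>
      define c where "c = 1 / sqrt (2 * q)"
      have cq: "c * c = 1 / (2 * q)" using q by (simp add: c_def field_simps flip: power2_eq_square)
      define \<eta> :: "'a ext" where
        "\<eta> ws = (if length ws = 1 then complex_of_real c * (of_real (s (hd ws)) - \<i> * of_real (r (hd ws))) else 0)" for ws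
      have hol: "hol_form 1 \<eta>"
        unfolding hol_form_def
      proof (intro conjI allI)
        have "multi_alt \<eta>"
        proof (rule multi_altI)
          show "linear (\<lambda>v. \<eta> (ps @ v # qs))" for ps qs
          proof (cases "ps = [] \<and> qs = []")
            case True
            then show ?thesis
              by (auto intro!: linearI simp: \<eta>_def linear_add[OF lin(1)] linear_add[OF lin(2)]
                  linear_scale[OF lin(1)] linear_scale[OF lin(2)] algebra_simps complex_eq_iff)
          next
            case False
            then show ?thesis by (auto simp: \<eta>_def linear_zero_map)
          qed
        qed (simp add: \<eta>_def)
        then show "alt_form 1 \<eta>" by (simp add: alt_form_iff has_degree_def \<eta>_def)
        show "\<eta> (\<i> *s v # ws) = \<i> * \<eta> (v # ws)" for v ws
          by (simp add: \<eta>_def Jr algebra_simps)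
      qed
      have el: "elementary 1 \<eta> [x, y] = of_real ((r x * s y - s x * r y) / q)" for x y
      proof -
        have z: "\<eta> [] = 0" "\<eta> [a, b] = 0" for a b by (simp_all add: \<eta>_def)
        have "elementary 1 \<eta> [x, y] = \<i> * (\<eta> [x] * cnj (\<eta> [y]) - \<eta> [y] * cnj (\<eta> [x]))"
          by (simp add: elementary_def ext_scale_def wedge_Cons contract_def twist_def ext_cnj_def z)
        also have "\<dots> = of_real (2 * (c * c) * (r x * s y - s x * r y))"
          by (simp add: \<eta>_def complex_eq_iff algebra_simps)
        finally show ?thesis by (simp add: cq)
      qed
      define h' where "h' = h - elementary 1 \<eta>"
      have alt': "alt_form 2 (elementary 1 \<eta>)" using alt_form_elementary[OF hol] by simp
      have el_real: "real_pp 1 (elementary 1 \<eta>)"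
      proof -
        have "ext_cnj (elementary 1 \<eta>) = elementary 1 \<eta>"
          using alt' by (intro alt_form_2_eqI alt_form_closed) (auto simp: el[unfolded One_nat_def] ext_cnj_def)
        moreover have "elementary 1 \<eta> (map (\<lambda>v. \<i> *s v) us) = elementary 1 \<eta> us" for us
        proof (cases "length us = 2")
          case True
          then obtain x y where "us = [x, y]" by (auto simp: numeral_2_eq_2 length_Suc_conv)
          then show ?thesis by (simp add: el[unfolded One_nat_def] Jr algebra_simps)
        next
          case False
          then show ?thesis using alt' by (auto simp: alt_form_iff has_degree_def)
        qed
        ultimately show ?thesis using alt' by (simp add: real_pp_def)
      qed
      have h': "herm h' x y = herm h x y - (r x * s y - s x * r y) / q" for x y
        unfolding h'_def herm_def minus_apply el by simp
      have "positive_cone 1 h'"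
      proof (rule insert.IH)
        show "real_pp 1 h'" unfolding h'_def by (intro real_pp_closed insert.prems el_real)
        show "herm h' x (\<i> *s x) \<ge> 0" for x
        proof -
          \<comment> \<open>\<open>y\<close> is the component of \<open>x\<close> that is \<open>h\<close>-orthogonal to the complex line of \<open>e\<close>.\<close>
          define \<alpha> \<beta> where "\<alpha> = s x / q" and "\<beta> = - r x / q"
          define y where "y = x - (\<alpha> *\<^sub>R e + \<beta> *\<^sub>R (\<i> *s e))"
          have ry: "r y = 0" "s y = 0"
            using False hs(3)[of e "\<i> *s e"] hs(2)
            by (simp_all add: y_def r_def s_def bs \<alpha>_def \<beta>_def q_def)
          have "herm h (x - (\<alpha> *\<^sub>R e + \<beta> *\<^sub>R (\<i> *s e))) z =
              herm h x z - \<alpha> * herm h e z - \<beta> * herm h (\<i> *s e) z" for z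
            by (simp add: bs)
          from this[of "\<i> *s y"] have "herm h y (\<i> *s y) = herm h x (\<i> *s y) - \<alpha> * s y + \<beta> * r y"
            unfolding y_def[symmetric] hs(4) rs by (simp add: Jr)
          also have "\<dots> = herm h x (\<i> *s y)" by (simp add: ry)
          also have "\<dots> = herm h x (\<i> *s x) - \<alpha> * s x + \<beta> * r x"
            by (simp add: y_def vec_ii_simps bs s_def r_def)
          also have "\<dots> = herm h' x (\<i> *s x)"
            using q by (simp add: h' Jr \<alpha>_def \<beta>_def field_simps)
          finally show ?thesis using insert.prems(2)[of y] by simp
        qed
        show "herm h' (axis i 1) y = 0" if "i \<notin> F" for i y
        proof (cases "i = j")
          case True
          then have "herm h' (axis i 1) y = herm h' e y" by (simp add: e_def)
          also have "\<dots> = 0" using q hs(2)[of e] by (simp add: h' rs(2)) (simp add: r_def s_def q_def)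
          finally show ?thesis .
        next
          case False
          then have "herm h (axis i 1) y = 0" "r (axis i 1) = 0" "s (axis i 1) = 0"
            using insert.prems(3)[of i] that by (auto simp: r_def s_def)
          then show ?thesis by (simp add: h')
        qed
      qed
      then have "positive_cone 1 (elementary 1 \<eta> + h')" using hol by (rule positive_cone.add_elementary)
      then show ?thesis unfolding h'_def by (simp only: add_diff_cancel_left' diff_add_cancel add.commute[of "elementary 1 \<eta>"])
    qed
  qed
  from this[OF finite_class.finite_UNIV assms] show ?thesis by simp
qed

section \<open>Kaehler metrics at a point\<close>

definition hermitian :: "'n::finite ext \<Rightarrow> bool" where
  "hermitian w \<longleftrightarrow> bidegree 1 1 w \<and> ext_cnj w = w \<and> (\<forall>v. v \<noteq> 0 \<longrightarrow> metric w v v > 0)"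

lemma metric_eq: "metric w x y = herm w x (\<i> *s y)"
  by (simp add: metric_def herm_def)

lemma hermitian_real_pp: "hermitian w \<Longrightarrow> real_pp 1 w"
  by (rule real_forms_at_real_pp) (simp add: hermitian_def real_forms_at_def)

lemma hermitian_inner_form:
  assumes "hermitian w" shows "inner_form (metric w)"
proof -
  note hs = herm_simps[OF hermitian_real_pp[OF assms]]
  have alt: "alt_form 2 w" using hermitian_real_pp[OF assms] by (simp add: real_pp_def)
  note bil = herm_bilinear[OF alt]
  have "bilinear (metric w)"
    unfolding bilinear_def metric_eq
    using bil linear_compose[OF linear_vec_ii] by (auto simp: bilinear_def o_def)
  moreover have "metric w x y = metric w y x" for x y
    using hs(3)[of x "\<i> *s y"] hs(5)[of y x] by (simp add: metric_eq)
  ultimately show ?thesis using assms by (auto simp: inner_form_def hermitian_def)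
qed

lemma metric_simps:
  assumes "hermitian w"
  shows "metric w (\<i> *s x) (\<i> *s y) = metric w x y" "metric w x (\<i> *s x) = 0"
    "metric w (\<i> *s x) y = - metric w x (\<i> *s y)"
proof -
  note hs = herm_simps[OF hermitian_real_pp[OF assms]]
  have alt: "alt_form 2 w" using hermitian_real_pp[OF assms] by (simp add: real_pp_def)
  note bil = herm_bilinear[OF alt]
  show "metric w (\<i> *s x) (\<i> *s y) = metric w x y" unfolding metric_eq by (rule hs(4))
  show "metric w x (\<i> *s x) = 0" using hs(2) by (simp add: metric_eq bilinear_rneg[OF bil])
  show "metric w (\<i> *s x) y = - metric w x (\<i> *s y)"
    unfolding metric_eq hs(4) by (simp add: bilinear_rneg[OF bil])
qed

lemma hermitian_positive_cone:
  assumes "hermitian w" shows "positive_cone 1 w"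
proof (rule positive_cone_psd[OF hermitian_real_pp[OF assms]])
  fix v
  show "herm w v (\<i> *s v) \<ge> 0"
    unfolding metric_eq[symmetric]
    using assms linear_0[OF inner_form_linear(1)[OF hermitian_inner_form[OF assms], of v]]
    by (cases "v = 0") (auto simp: hermitian_def less_imp_le)
qed

text \<open>
  A unit vector orthogonal to a complex subspace brings its multiple by \<open>\<i>\<close> with it, so the real
  construction of orthonormal frames produces unitary ones.
\<close>

lemma unitary_extend:
  fixes us :: "(complex ^ 'n::finite) list"
  assumes w: "hermitian w" and "orthonormal (metric w) (pairs us)" "length us \<le> CARD('n)"
  obtains vs where "length vs + length us = CARD('n)" "orthonormal (metric w) (pairs (vs @ us))"
proof -
  have "\<exists>vs. length vs + length us = CARD('n) \<and> orthonormal (metric w) (pairs (vs @ us))"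
    using assms(2,3)
  proof (induction "CARD('n) - length us" arbitrary: us)
    case 0
    then show ?case by (intro exI[of _ "[]"]) auto
  next
    case (Suc k)
    note g = hermitian_inner_form[OF w]
    have "length (pairs us) < DIM(complex ^ 'n)" using Suc.hyps(2) by simp
    then obtain r where r: "orthonormal (metric w) (r # pairs us)"
      using orthonormal_extend[OF g Suc.prems(1)] by blast
    have z: "metric w r b = 0" "metric w r (\<i> *s b) = 0" if "b \<in> set us" for b
      using r that by auto
    have "metric w (\<i> *s r) b = 0" if b: "b \<in> set (pairs us)" for b
    proof -
      from b consider "b \<in> set us" | u where "u \<in> set us" "b = \<i> *s u" by auto
      then show ?thesis using z by cases (simp_all add: metric_simps(1)[OF w], simp add: metric_simps(3)[OF w])
    qed
    then have "orthonormal (metric w) (pairs (r # us))"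
      using r by (simp add: metric_simps(1,2)[OF w])
    moreover have "k = CARD('n) - length (r # us)" "length (r # us) \<le> CARD('n)"
      using Suc.hyps(2) by auto
    ultimately obtain vs where "length vs + length (r # us) = CARD('n)" "orthonormal (metric w) (pairs (vs @ r # us))"
      using Suc.hyps(1) by blast
    then show ?case by (intro exI[of _ "vs @ [r]"]) auto
  qed
  then show thesis using that by blast
qed

lemma pow_vanish:
  assumes "alt_form 2 w" "\<And>u. u \<in> set us \<Longrightarrow> w [e, u] = 0"
  shows "wedge_pow w k (e # us) = 0"
  using assms(2)
proof (induction k arbitrary: us)
  case (Suc k)
  have "wedge (contract e w) (wedge_pow w k) us = 0"
  proof (rule wedge_local_zero')
    fix vs assume "set vs \<subseteq> set us"
    then show "contract e w vs = 0"
      using assms(1) Suc.prems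
      by (cases "length vs = 1") (auto simp: length_Suc_conv contract_def alt_form_iff has_degree_def)
  qed
  moreover have "wedge (twist w) (contract e (wedge_pow w k)) us = 0"
    using Suc by (intro wedge_local_zero) (auto simp: contract_def)
  ultimately show ?case by (simp add: wedge_Cons)
qed (simp add: ext_one_def)

lemma orthogonal_vanish:
  assumes w: "hermitian w" and "orthonormal (metric w) (pairs (e # us))" "u \<in> set (pairs us)"
  shows "w [e, u] = 0" "w [\<i> *s e, u] = 0"
proof -
  note rp = hermitian_real_pp[OF w]
  note hs = herm_simps[OF rp]
  have bil: "bilinear (herm w)" using rp by (intro herm_bilinear) (simp add: real_pp_def)
  have z: "metric w e b = 0" if "b \<in> set (pairs us)" for b using assms(2) that by simp
  have Ju: "metric w e (\<i> *s u) = 0"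
  proof -
    have "\<i> *s u \<in> set (pairs us) \<or> - (\<i> *s u) \<in> set (pairs us)" using assms(3) by auto
    then show ?thesis
      using z linear_neg[OF inner_form_linear(1)[OF hermitian_inner_form[OF w], of e], of "\<i> *s u"] by force
  qed
  have "herm w e u = 0" using Ju by (simp add: metric_eq bilinear_rneg[OF bil])
  moreover have "herm w (\<i> *s e) u = 0"
    using z[OF assms(3)] by (simp add: hs(5) metric_eq)
  ultimately show "w [e, u] = 0" "w [\<i> *s e, u] = 0" by (simp_all add: hs(1))
qed

text \<open>
  Contraction of \<open>h \<and> w^k\<close> with the complex line of \<open>e\<close>. The mixed terms vanish because \<open>e\<close> is
  orthogonal to the remaining vectors. What is left is the term on the right-hand side and the
  wedge of \<open>h\<close> with a contraction of \<open>w^k\<close>, which belongs to the positive cone.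
\<close>

lemma wedge_pow_split:
  assumes w: "hermitian w" and on: "orthonormal (metric w) (pairs (e # us))" and h: "positive_cone 1 h" "real_pp 1 h"
  shows "Re (wedge h (wedge_pow w k) (pairs (e # us))) \<ge> herm h e (\<i> *s e) * Re (wedge_pow w k (pairs us))"
proof -
  let ?W = "wedge_pow w k" and ?e = "\<i> *s e"
  have alt: "alt_form 2 w" "alt_form 2 h" using hermitian_real_pp[OF w] h by (auto simp: real_pp_def)
  have v: "?W (e # us') = 0" "?W (?e # us') = 0" if "set us' \<subseteq> set (pairs us)" for us'
    using that orthogonal_vanish[OF w on] by (auto intro!: pow_vanish[OF alt(1)] simp del: pairs_simps)
  have z: "wedge a (contract e ?W) (pairs us) = 0" "wedge a (contract ?e ?W) (pairs us) = 0" for a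
    using v by (auto intro!: wedge_local_zero simp: contract_def simp del: pairs_simps)
  have th: "twist h = h" using real_pp_twist[OF h(2)] .
  have "contract ?e (contract e h) = ext_scale (h [e, ?e]) ext_one"
    using alt(2) by (auto simp: contract_def ext_scale_def ext_one_def alt_form_iff has_degree_def fun_eq_iff)
  then have "wedge h ?W (pairs (e # us)) = h [e, ?e] * ?W (pairs us) +
      wedge h (contract ?e (contract e ?W)) (pairs us)"
    by (simp add: wedge_Cons contract_wedge contract_simps twist_simps th wedge_minus_left z
        wedge_scale_left ext_scale_def[of _ ?W])
  moreover have "positive_cone (1 + (k - 1)) (wedge h (contract ?e (contract e ?W)))"
    by (intro positive_cone_wedge h(1) positive_cone_contract positive_cone_pow hermitian_positive_cone w)
  then have "Re (wedge h (contract ?e (contract e ?W)) (pairs us)) \<ge> 0"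
    by (intro nonneg_Re positive_cone_pairs)
  ultimately show ?thesis by (simp add: herm_simps(1)[OF h(2)])
qed

lemma pow_unitary_ge_1:
  assumes w: "hermitian w" and "orthonormal (metric w) (pairs us)"
  shows "Re (wedge_pow w (length us) (pairs us)) \<ge> 1"
  using assms(2)
proof (induction us)
  case (Cons e us)
  then have "Re (wedge_pow w (length us) (pairs us)) \<ge> 1" "herm w e (\<i> *s e) = 1"
    by (auto simp: metric_eq)
  then show ?case
    using wedge_pow_split[OF w Cons.prems hermitian_positive_cone[OF w] hermitian_real_pp[OF w], of "length us"]
    by simp
qed (simp add: ext_one_def)

lemma real_pp_vol: "hermitian w \<Longrightarrow> real_pp CARD('n) (vol_at (w :: 'n::finite ext))"
  using real_pp_closed(3)[OF real_pp_pow[OF hermitian_real_pp[of w], of "CARD('n)"], of "1 / fact CARD('n)"]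
  by (simp add: vol_at_def divided_pow_def)

lemma vol_unitary_pos:
  fixes w :: "'n::finite ext"
  assumes "hermitian w" "orthonormal (metric w) (pairs us)" "length us = CARD('n)"
  shows "Re (vol_at w (pairs us)) > 0"
proof -
  have "1 / fact CARD('n) = complex_of_real (1 / fact CARD('n))" by simp
  then have "Re (vol_at w (pairs us)) = 1 / fact CARD('n) * Re (wedge_pow w CARD('n) (pairs us))"
    unfolding vol_at_def divided_pow_def ext_scale_def by (simp only: times_complex.simps Re_complex_of_real Im_complex_of_real mult_zero_left diff_zero)
  moreover have "Re (wedge_pow w CARD('n) (pairs us)) \<ge> 1"
    using pow_unitary_ge_1[OF assms(1,2)] assms(3) by simp
  ultimately show ?thesis by simp
qed

lemma unitary_frame_exists:
  fixes w :: "'n::finite ext"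
  assumes "hermitian w"
  obtains us where "length us = CARD('n)" "orthonormal (metric w) (pairs us)"
  using unitary_extend[OF assms, of "[]"] by auto

lemma vol_nonzero: "hermitian w \<Longrightarrow> vol_at w \<noteq> 0"
  using unitary_frame_exists[of w] vol_unitary_pos[of w] by fastforce

lemma hodge_star_at_eq_frame_star:
  fixes w :: "'n::finite ext"
  assumes "hermitian w" "orthonormal (metric w) B" "length B = 2 * CARD('n)"
    "alt_form k b" "k \<le> 2 * CARD('n)"
  shows "hodge_star_at w k b = frame_star (vol_at w) B b"
  using assms real_pp_vol[OF assms(1)] hermitian_inner_form[OF assms(1)] vol_nonzero[OF assms(1)]
  by (intro hodge_star_at_frame) (auto simp: orthonormal_frame_iff real_pp_def)

text \<open>
  Only the sublist complementary to \<open>[x, y]\<close> contributes, and its shuffle is the identity.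
\<close>

lemma frame_star_unitary:
  fixes vol :: "'n::finite ext"
  assumes "alt_form (length (es @ [x, y])) vol" "distinct (es @ [x, y])"
  shows "frame_star vol (es @ [x, y]) b [x, y] = b es * vol (es @ [x, y])"
proof -
  let ?B = "es @ [x, y]" and ?T = "{..<length es}"
  have T: "nths ?B ?T = es" by (simp add: nths_append)
  have T': "nths ?B (- ?T) = [x, y]"
  proof -
    have "nths es (- ?T) = []" by (subst nths_Compl_eq) simp
    then show ?thesis by (simp add: nths_append nths_Cons)
  qed
  have "{(i, j). i < j \<and> j < length ?B \<and> i \<notin> ?T \<and> j \<in> ?T} = {}" by auto
  then have s: "shuffle_sign (length ?B) ?T = 1" unfolding shuffle_sign_def by (simp only: card.empty power_0)
  show ?thesis
    using pairing_complementary(1)[OF assms, of ?T b] unfolding T T' s frame_star_def by simp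
qed

lemma hodge_star_unitary:
  fixes w :: "'n::finite ext"
  assumes w: "hermitian w" and us: "orthonormal (metric w) (pairs (us @ [v]))" "length us + 1 = CARD('n)"
    and b: "alt_form (2 * (CARD('n) - 1)) b"
  shows "hodge_star_at w (2 * (CARD('n) - 1)) b [v, \<i> *s v] = b (pairs us) * vol_at w (pairs us @ [v, \<i> *s v])"
proof -
  have p: "pairs (us @ [v]) = pairs us @ [v, \<i> *s v]" by simp
  have "hodge_star_at w (2 * (CARD('n) - 1)) b = frame_star (vol_at w) (pairs us @ [v, \<i> *s v]) b"
    using us b by (intro hodge_star_at_eq_frame_star[OF w]) (simp_all only: p, auto)
  moreover have "alt_form (length (pairs us @ [v, \<i> *s v])) (vol_at w)"
  proof -
    have "length (pairs us @ [v, \<i> *s v]) = 2 * CARD('n)" using us(2) by simp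
    then show ?thesis using real_pp_vol[OF w] by (simp only: real_pp_def)
  qed
  moreover have "distinct (pairs us @ [v, \<i> *s v])"
    using orthonormal_distinct_independent[OF hermitian_inner_form[OF w] us(1)] unfolding p by blast
  ultimately show ?thesis using frame_star_unitary by metis
qed

text \<open>
  Multiplication by \<open>\<i>\<close> maps orthonormal frames to orthonormal frames, and the star does not depend
  on the frame; so it commutes with the complex structure.
\<close>

lemma real_pp_frame_star:
  fixes w :: "'n::finite ext"
  assumes w: "hermitian w" and b: "real_pp (CARD('n) - 1) b"
    and B: "orthonormal (metric w) B" "length B = 2 * CARD('n)"
  shows "real_pp 1 (frame_star (vol_at w) B b)"
proof -
  note g = hermitian_inner_form[OF w]
  let ?J = "map (\<lambda>v. \<i> *s v)"
  note vol = real_pp_vol[OF w]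
  have b_alt: "alt_form (2 * (CARD('n) - 1)) b" and b_cnj: "cnj (b us) = b us" and b_J: "b (?J us) = b us" for us
    using b by (auto simp: real_pp_def ext_cnj_def fun_eq_iff)
  have v_alt: "alt_form (2 * CARD('n)) (vol_at w)" and v_cnj: "cnj (vol_at w us) = vol_at w us"
    and v_J: "vol_at w (?J us) = vol_at w us" for us
    using vol by (auto simp: real_pp_def ext_cnj_def fun_eq_iff)
  have JB: "orthonormal (metric w) (?J B)"
    using B(1) by (induction B) (auto simp: metric_simps(1)[OF w])
  have k: "2 * (CARD('n) - 1) + 2 = 2 * CARD('n)"
    using zero_less_card_finite[where 'a='n] by linarith
  have "alt_form 2 (frame_star (vol_at w) B b)"
    unfolding frame_star_def using b_alt v_alt k
    by (intro alt_form_pairing(1)[of "2 * (CARD('n) - 1)"]) (auto simp: alt_form_iff)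
  moreover have "ext_cnj (frame_star (vol_at w) B b) = frame_star (vol_at w) B b"
    by (simp add: ext_cnj_def frame_star_def pairing_def b_cnj v_cnj)
  moreover have "frame_star (vol_at w) B b (?J ws) = frame_star (vol_at w) B b ws" for ws
  proof -
    have "frame_star (vol_at w) B b = hodge_star_at w (2 * (CARD('n) - 1)) b"
      by (rule hodge_star_at_eq_frame_star[symmetric, OF w B b_alt]) simp
    also have "\<dots> = frame_star (vol_at w) (?J B) b"
      by (rule hodge_star_at_eq_frame_star[OF w JB _ b_alt]) (simp_all add: B)
    finally have "frame_star (vol_at w) B b (?J ws) = frame_star (vol_at w) (?J B) b (?J ws)" by simp
    also have "\<dots> = frame_star (vol_at w) B b ws"
      by (simp add: frame_star_def pairing_def nths_map b_J v_J flip: map_append)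
    finally show ?thesis .
  qed
  ultimately show ?thesis by (simp add: real_pp_def)
qed

lemma real_pp_hodge_star:
  fixes w :: "'n::finite ext"
  assumes w: "hermitian w" and b: "real_pp (CARD('n) - 1) b"
  shows "real_pp 1 (hodge_star_at w (2 * (CARD('n) - 1)) b)"
proof -
  obtain us where us: "length us = CARD('n)" "orthonormal (metric w) (pairs us)"
    using unitary_frame_exists[OF w] .
  then have "hodge_star_at w (2 * (CARD('n) - 1)) b = frame_star (vol_at w) (pairs us) b"
    using b by (intro hodge_star_at_eq_frame_star[OF w]) (auto simp: real_pp_def)
  then show ?thesis using real_pp_frame_star[OF w b us(2)] us(1) by simp
qed

lemma metric_scaleR: "hermitian w \<Longrightarrow> metric w (s *\<^sub>R x) (t *\<^sub>R y) = s * t * metric w x y"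
  by (simp add: linear_scale[OF inner_form_linear(1)[OF hermitian_inner_form]]
      linear_scale[OF inner_form_linear(2)[OF hermitian_inner_form]])

lemma unit_pair:
  assumes "hermitian w" "v \<noteq> 0"
  defines "u \<equiv> v /\<^sub>R sqrt (metric w v v)"
  shows "orthonormal (metric w) (pairs [u])" "metric w v v > 0" "v = sqrt (metric w v v) *\<^sub>R u"
proof -
  show p: "metric w v v > 0" using assms by (simp add: hermitian_def)
  then show "v = sqrt (metric w v v) *\<^sub>R u" by (simp add: u_def)
  have "metric w u u = 1" using p by (simp add: u_def metric_scaleR[OF assms(1)] field_simps flip: power2_eq_square)
  then show "orthonormal (metric w) (pairs [u])" by (simp add: metric_simps(1,2)[OF assms(1)])
qed

lemma herm_scaleR:
  assumes "real_pp 1 h" shows "herm h (t *\<^sub>R u) (\<i> *s (t *\<^sub>R u)) = t\<^sup>2 * herm h u (\<i> *s u)"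
proof -
  have "bilinear (herm h)" using assms by (intro herm_bilinear) (simp add: real_pp_def)
  then show ?thesis by (simp add: vec_ii_simps bilinear_lmul bilinear_rmul power2_eq_square)
qed

text \<open>
  On a complex line the star evaluates a form on the unitary frame of the orthogonal complement.
  This is how positivity passes from \<open>(n-1, n-1)\<close>-forms to \<open>(1, 1)\<close>-forms.
\<close>

lemma hodge_star_herm:
  fixes w :: "'n::finite ext"
  assumes w: "hermitian w" and us: "orthonormal (metric w) (pairs (us @ [v]))" "length us + 1 = CARD('n)"
    and b: "real_pp (CARD('n) - 1) b"
  shows "herm (hodge_star_at w (2 * (CARD('n) - 1)) b) v (\<i> *s v) =
     Re (b (pairs us)) * Re (vol_at w (pairs (us @ [v])))"
    "Re (vol_at w (pairs (us @ [v]))) > 0"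
proof -
  show "Re (vol_at w (pairs (us @ [v]))) > 0"
    using us by (intro vol_unitary_pos[OF w]) auto
  have "hodge_star_at w (2 * (CARD('n) - 1)) b [v, \<i> *s v] = b (pairs us) * vol_at w (pairs (us @ [v]))"
    using hodge_star_unitary[OF w us, of b] b by (simp add: real_pp_def)
  moreover have "Im (b (pairs us)) = 0"
    using real_pp_Im[OF b, of "pairs us"] by (metis Im_complex_of_real)
  ultimately show "herm (hodge_star_at w (2 * (CARD('n) - 1)) b) v (\<i> *s v) =
     Re (b (pairs us)) * Re (vol_at w (pairs (us @ [v])))"
    by (simp add: herm_def)
qed

lemma hodge_star_nonneg:
  fixes w :: "'n::finite ext"
  assumes w: "hermitian w" and b: "real_pp (CARD('n) - 1) b" "positive_cone (CARD('n) - 1) b"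
  shows "herm (hodge_star_at w (2 * (CARD('n) - 1)) b) v (\<i> *s v) \<ge> 0"
proof (cases "v = 0")
  case True
  then show ?thesis using herm_scaleR[OF real_pp_hodge_star[OF w b(1)], of 0 0] by simp
next
  case False
  define u where "u = v /\<^sub>R sqrt (metric w v v)"
  note u = unit_pair[OF w False, folded u_def]
  obtain us where us: "length us + length [u] = CARD('n)" "orthonormal (metric w) (pairs (us @ [u]))"
    using unitary_extend[OF w u(1)] zero_less_card_finite[where 'a='n] by (auto simp: Suc_leI)
  have "Re (b (pairs us)) \<ge> 0" by (intro nonneg_Re positive_cone_pairs[OF b(2)])
  then have "herm (hodge_star_at w (2 * (CARD('n) - 1)) b) u (\<i> *s u) \<ge> 0"
    using hodge_star_herm[OF w us(2) _ b(1)] us(1) by simp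
  then show ?thesis by (subst u(3), subst (2) u(3)) (simp only: herm_scaleR[OF real_pp_hodge_star[OF w b(1)]], simp)
qed

lemma hodge_star_pos:
  fixes w :: "'n::finite ext"
  assumes w: "hermitian w" and b: "real_pp (CARD('n) - 1) b" "\<epsilon> > 0"
    and c: "positive_cone (CARD('n) - 1) (b - ext_scale (of_real \<epsilon>) (wedge_pow w (CARD('n) - 1)))" and v: "v \<noteq> 0"
  shows "herm (hodge_star_at w (2 * (CARD('n) - 1)) b) v (\<i> *s v) > 0"
proof -
  define u where "u = v /\<^sub>R sqrt (metric w v v)"
  note u = unit_pair[OF w v, folded u_def]
  obtain us where us: "length us + length [u] = CARD('n)" "orthonormal (metric w) (pairs (us @ [u]))"
    using unitary_extend[OF w u(1)] zero_less_card_finite[where 'a='n] by (auto simp: Suc_leI)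
  have "Re ((b - ext_scale (of_real \<epsilon>) (wedge_pow w (CARD('n) - 1))) (pairs us)) \<ge> 0"
    by (intro nonneg_Re positive_cone_pairs[OF c])
  moreover have "Re (wedge_pow w (CARD('n) - 1) (pairs us)) \<ge> 1"
    using pow_unitary_ge_1[OF w, of us] us by (auto simp: orthonormal_append) (metis One_nat_def diff_Suc_1)
  then have "\<epsilon> * Re (wedge_pow w (CARD('n) - 1) (pairs us)) > 0" using b(2) by simp
  ultimately have "Re (b (pairs us)) > 0" by (simp add: ext_scale_def)
  then have "herm (hodge_star_at w (2 * (CARD('n) - 1)) b) u (\<i> *s u) > 0"
    using hodge_star_herm[OF w us(2) _ b(1)] us(1) by simp
  then show ?thesis using u(2)
    by (subst u(3), subst (2) u(3)) (simp only: herm_scaleR[OF real_pp_hodge_star[OF w b(1)]], simp)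
qed

section \<open>Strong positivity\<close>

lemma ext_scale_power_wedge:
  "wedge_pow (ext_scale c a) k = ext_scale (c ^ k) (wedge_pow a k)"
  by (induction k) (simp_all add: wedge_scale_left wedge_scale_right ext_scale_simps mult.commute)

lemma bidegree_scale:
  assumes "bidegree p q a"
  shows "a (map (\<lambda>v. c *s v) us) = c ^ p * cnj c ^ q * a us"
  using assms by (cases "length us = p + q") (auto simp: bidegree_def alt_form_def)

lemma real_forms_at_pow:
  assumes "hermitian w" shows "wedge_pow w m \<in> real_forms_at m"
proof -
  have "(\<lambda>ws. w (map (\<lambda>v. c *s v) ws)) = ext_scale (c * cnj c) w" for c
    using assms bidegree_scale[of 1 1 w] by (simp add: hermitian_def ext_scale_def fun_eq_iff)
  then have "wedge_pow w m (map (\<lambda>v. c *s v) us) = (c * cnj c) ^ m * wedge_pow w m us" for c us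
    by (simp add: wedge_pow_map ext_scale_power_wedge) (simp add: ext_scale_def)
  then show ?thesis
    using real_pp_pow[OF hermitian_real_pp[OF assms], of m]
    by (simp add: real_forms_at_def bidegree_def real_pp_def mult_2 power_mult_distrib)
qed

lemma real_forms_at_diff:
  assumes "a \<in> real_forms_at m" "b \<in> real_forms_at m"
  shows "a - ext_scale (of_real t) b \<in> real_forms_at m"
  using assms unfolding real_forms_at_def
  by (auto simp: bidegree_def ext_cnj_simps intro!: alt_form_closed) (auto simp: ext_scale_def algebra_simps)

lemma strongly_pos_at_real: "strongly_pos_at m a \<Longrightarrow> a \<in> real_forms_at m"
  unfolding strongly_pos_at_def using interior_of_subset_topspace[of "top_of_set (real_forms_at m)"] by auto

text \<open>
  The form \<open>w^m\<close> belongs to the space in which the interior is taken, so a small multiple of it can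
  be subtracted without leaving the cone.
\<close>

lemma strongly_pos_at_interior:
  assumes w: "hermitian w" and a: "strongly_pos_at m a"
  obtains \<epsilon> where "\<epsilon> > 0" "positive_cone m (a - ext_scale (of_real \<epsilon>) (wedge_pow w m))"
proof -
  obtain T where T: "openin (top_of_set (real_forms_at m)) T" "a \<in> T" "T \<subseteq> strong_cone m"
    using a unfolding strongly_pos_at_def interior_of_def by auto
  then obtain U where U: "open U" "T = real_forms_at m \<inter> U" by (auto simp: openin_open)
  define \<phi> where "\<phi> t = a - ext_scale (of_real t) (wedge_pow w m)" for t :: real
  have "continuous_on UNIV \<phi>"
    by (rule continuous_on_coordinatewise_then_product)
       (auto simp: \<phi>_def ext_scale_def intro!: continuous_intros)
  then have "open (\<phi> -` U)" using U(1) by (simp add: open_vimage continuous_on_eq_continuous_within)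
  moreover have "0 \<in> \<phi> -` U" using T U by (simp add: \<phi>_def ext_scale_simps)
  ultimately obtain d where d: "d > 0" "ball 0 d \<subseteq> \<phi> -` U" by (meson open_contains_ball)
  then have "\<phi> (d / 2) \<in> U" by (auto simp: subset_iff dist_norm)
  moreover have "\<phi> (d / 2) \<in> real_forms_at m"
    unfolding \<phi>_def by (intro real_forms_at_diff strongly_pos_at_real[OF a] real_forms_at_pow w)
  ultimately have "positive_cone m (\<phi> (d / 2))" using T U by (intro strong_cone_positive) auto
  then show thesis using that[of "d / 2"] d(1) by (simp add: \<phi>_def)
qed

lemma real_pp_divided_pow: "hermitian w \<Longrightarrow> real_pp p (divided_pow w p)"
  using real_pp_closed(3)[OF real_pp_pow[OF hermitian_real_pp[of w], of p], of "1 / fact p"]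
  by (simp add: divided_pow_def)

text \<open>
  A form in the interior of the cone dominates a multiple of \<open>w^m\<close>; wedging with \<open>w^p\<close> gives a form
  that dominates a multiple of \<open>w^(n-1)\<close>, whose star is a positive multiple of \<open>w\<close>.
\<close>

lemma star_strongly_positive:
  fixes w :: "'n::finite ext"
  assumes w: "hermitian w" and a: "strongly_pos_at m a" and mp: "m + p = CARD('n) - 1"
  defines "\<rho> \<equiv> hodge_star_at w (2 * (CARD('n) - 1)) (wedge a (divided_pow w p))"
  shows "real_pp 1 \<rho>" "v \<noteq> 0 \<Longrightarrow> herm \<rho> v (\<i> *s v) > 0"
proof -
  obtain \<epsilon> where e: "\<epsilon> > 0" "positive_cone m (a - ext_scale (of_real \<epsilon>) (wedge_pow w m))"
    using strongly_pos_at_interior[OF w a] .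
  have b: "real_pp (CARD('n) - 1) (wedge a (divided_pow w p))"
    using real_pp_wedge[OF real_forms_at_real_pp[OF strongly_pos_at_real[OF a]] real_pp_divided_pow[OF w, of p]] mp by simp
  show "real_pp 1 \<rho>" unfolding \<rho>_def by (rule real_pp_hodge_star[OF w b])
  have "positive_cone p (divided_pow w p)"
    using positive_cone_scale[OF positive_cone_pow[OF hermitian_positive_cone[OF w], of p], of "1 / fact p"]
    by (simp add: divided_pow_def)
  then have "positive_cone (m + p) (wedge (a - ext_scale (of_real \<epsilon>) (wedge_pow w m)) (divided_pow w p))"
    using e(2) by (intro positive_cone_wedge)
  moreover have "wedge (a - ext_scale (of_real \<epsilon>) (wedge_pow w m)) (divided_pow w p) =
      wedge a (divided_pow w p) - ext_scale (of_real (\<epsilon> / fact p)) (wedge_pow w (m + p))"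
    by (simp add: wedge_diff_left divided_pow_def wedge_scale_left wedge_scale_right ext_scale_simps
        wedge_pow_add)
  ultimately have "positive_cone (CARD('n) - 1) (wedge a (divided_pow w p) -
      ext_scale (of_real (\<epsilon> / fact p)) (wedge_pow w (CARD('n) - 1)))"
    by (simp add: mp)
  then show "v \<noteq> 0 \<Longrightarrow> herm \<rho> v (\<i> *s v) > 0"
    unfolding \<rho>_def using e(1) by (intro hodge_star_pos[OF w b, of "\<epsilon> / fact p"]) auto
qed

section \<open>Ellipticity of the linearised operator\<close>

text \<open>
  Compactness of the unit sphere.
\<close>

lemma positive_definite_dominates:
  fixes w \<rho> :: "'n::finite ext"
  assumes w: "hermitian w" and r: "real_pp 1 \<rho>" "\<And>v. v \<noteq> 0 \<Longrightarrow> herm \<rho> v (\<i> *s v) > 0"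
  obtains \<epsilon> where "\<epsilon> > 0" "positive_cone 1 (\<rho> - ext_scale (of_real \<epsilon>) w)"
proof -
  have cont: "continuous_on UNIV (\<lambda>v. herm h v (\<i> *s v))" if "real_pp 1 h" for h :: "'n ext"
  proof -
    have "bounded_bilinear (herm h)"
      using that herm_bilinear[of h] by (simp add: real_pp_def bilinear_conv_bounded_bilinear)
    then show ?thesis
      by (rule bounded_bilinear.continuous_on)
         (auto intro: continuous_on_id linear_continuous_on linear_conv_bounded_linear[THEN iffD1] linear_vec_ii)
  qed
  let ?S = "sphere 0 1 :: (complex ^ 'n) set"
  have S: "compact ?S" "?S \<noteq> {}" by auto
  obtain a where a: "a \<in> ?S" "\<And>v. v \<in> ?S \<Longrightarrow> herm \<rho> a (\<i> *s a) \<le> herm \<rho> v (\<i> *s v)"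
    using continuous_attains_inf[OF S continuous_on_subset[OF cont[OF r(1)]]] by auto
  obtain b where b: "b \<in> ?S" "\<And>v. v \<in> ?S \<Longrightarrow> herm w v (\<i> *s v) \<le> herm w b (\<i> *s b)"
    using continuous_attains_sup[OF S continuous_on_subset[OF cont[OF hermitian_real_pp[OF w]]]] by auto
  define m M where "m = herm \<rho> a (\<i> *s a)" and "M = herm w b (\<i> *s b)"
  have "a \<noteq> 0" "b \<noteq> 0" using a(1) b(1) by auto
  then have m: "m > 0" and M: "M > 0"
    using r(2)[of a] w by (auto simp: m_def M_def hermitian_def simp flip: metric_eq)
  have rp: "real_pp 1 (\<rho> - ext_scale (of_real (m / M)) w)"
    by (intro real_pp_closed r hermitian_real_pp w)
  have "positive_cone 1 (\<rho> - ext_scale (of_real (m / M)) w)"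
  proof (rule positive_cone_psd[OF rp])
    fix v :: "complex ^ 'n"
    show "herm (\<rho> - ext_scale (of_real (m / M)) w) v (\<i> *s v) \<ge> 0"
    proof (cases "v = 0")
      case True
      then show ?thesis using herm_scaleR[OF rp, of 0 0] by simp
    next
      case False
      define u where "u = v /\<^sub>R norm v"
      have u: "u \<in> ?S" "v = norm v *\<^sub>R u" using False by (auto simp: u_def)
      have "m / M * herm w u (\<i> *s u) \<le> m / M * M"
        using b(2)[OF u(1)] m M by (intro mult_left_mono) (auto simp: M_def)
      then have "m / M * herm w u (\<i> *s u) \<le> herm \<rho> u (\<i> *s u)"
        using a(2)[OF u(1), folded m_def] M by simp
      then have "herm (\<rho> - ext_scale (of_real (m / M)) w) u (\<i> *s u) \<ge> 0"
        by (simp add: herm_def ext_scale_def)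
      then show ?thesis by (subst u(2), subst (2) u(2)) (simp only: herm_scaleR[OF rp], simp)
    qed
  qed
  then show thesis using that m M by (metis divide_pos_pos)
qed

lemma pow_dominates:
  assumes w: "hermitian w" and r: "real_pp 1 \<rho>" "positive_cone 1 (\<rho> - ext_scale (of_real \<epsilon>) w)" "\<epsilon> \<ge> 0"
  shows "positive_cone k (wedge_pow \<rho> k - ext_scale (of_real (\<epsilon> ^ k)) (wedge_pow w k))"
proof (induction k)
  case 0
  show ?case by (simp only: power_0 of_real_1 wedge_pow.simps ext_scale_simps diff_self positive_cone.zero)
next
  case (Suc k)
  have pr: "positive_cone 1 \<rho>"
    using positive_cone_add[OF r(2) positive_cone_scale[OF hermitian_positive_cone[OF w] r(3)]]
    by (simp only: diff_add_cancel)
  have "wedge_pow \<rho> (Suc k) - ext_scale (of_real (\<epsilon> ^ Suc k)) (wedge_pow w (Suc k)) =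
     wedge \<rho> (wedge_pow \<rho> k - ext_scale (of_real (\<epsilon> ^ k)) (wedge_pow w k)) +
     wedge (\<rho> - ext_scale (of_real \<epsilon>) w) (ext_scale (of_real (\<epsilon> ^ k)) (wedge_pow w k))"
    by (simp add: wedge_diff_left wedge_diff_right wedge_scale_left wedge_scale_right ext_scale_simps mult.commute)
  moreover have "positive_cone (1 + k) (wedge \<rho> (wedge_pow \<rho> k - ext_scale (of_real (\<epsilon> ^ k)) (wedge_pow w k)) +
     wedge (\<rho> - ext_scale (of_real \<epsilon>) w) (ext_scale (of_real (\<epsilon> ^ k)) (wedge_pow w k)))"
    using r(3) by (intro positive_cone_add positive_cone_wedge pr Suc r(2) positive_cone_scale positive_cone_pow
        hermitian_positive_cone w) auto
  ultimately show ?case unfolding plus_1_eq_Suc by (simp only:)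
qed

text \<open>
  The sum \<open>a^(n-1) + a^(n-2) b + \<dots> + b^(n-1)\<close> that arises when \<open>a^n - b^n\<close> is divided by \<open>a - b\<close>.
\<close>

definition telescope :: "nat \<Rightarrow> 'n::finite ext \<Rightarrow> 'n ext \<Rightarrow> 'n ext" where
  "telescope n a b = (\<Sum>k<n. wedge (wedge_pow a k) (wedge_pow b (n - 1 - k)))"

text \<open>
  The summand \<open>b^(n-1)\<close> dominates a multiple of \<open>w^(n-1)\<close>, the others lie in the cone.
\<close>

lemma telescope_dominates:
  assumes w: "hermitian w" and n: "n > 0"
    and a: "real_pp 1 a" "\<And>v. v \<noteq> 0 \<Longrightarrow> herm a v (\<i> *s v) > 0"
    and b: "real_pp 1 b" "\<And>v. v \<noteq> 0 \<Longrightarrow> herm b v (\<i> *s v) > 0"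
  obtains \<epsilon> where "\<epsilon> > 0" "positive_cone (n - 1) (telescope n a b - ext_scale (of_real \<epsilon>) (wedge_pow w (n - 1)))"
proof -
  obtain \<epsilon> where e: "\<epsilon> > 0" "positive_cone 1 (b - ext_scale (of_real \<epsilon>) w)"
    using positive_definite_dominates[OF w b] .
  obtain \<delta> where d: "\<delta> > 0" "positive_cone 1 (a - ext_scale (of_real \<delta>) w)"
    using positive_definite_dominates[OF w a] .
  have pos: "positive_cone 1 a" "positive_cone 1 b"
    using positive_cone_add[OF e(2) positive_cone_scale[OF hermitian_positive_cone[OF w] less_imp_le[OF e(1)]]]
      positive_cone_add[OF d(2) positive_cone_scale[OF hermitian_positive_cone[OF w] less_imp_le[OF d(1)]]]
    by (simp_all only: diff_add_cancel)
  obtain n' where n': "n = Suc n'" using n by (cases n) auto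
  have "telescope n a b = wedge_pow b n' + (\<Sum>k<n'. wedge (wedge_pow a (Suc k)) (wedge_pow b (n' - Suc k)))"
    unfolding telescope_def n' sum.lessThan_Suc_shift by (simp only: wedge_pow.simps(1) wedge_one_left diff_Suc_1 diff_zero)
  then have eq: "telescope n a b - ext_scale (of_real (\<epsilon> ^ n')) (wedge_pow w n') =
     (wedge_pow b n' - ext_scale (of_real (\<epsilon> ^ n')) (wedge_pow w n')) +
     (\<Sum>k<n'. wedge (wedge_pow a (Suc k)) (wedge_pow b (n' - Suc k)))"
    by (simp only: add_diff_eq diff_add_eq)
  have "positive_cone n' (wedge (wedge_pow a (Suc k)) (wedge_pow b (n' - Suc k)))" if "k < n'" for k
    using positive_cone_wedge[OF positive_cone_pow[OF pos(1), of "Suc k"] positive_cone_pow[OF pos(2), of "n' - Suc k"]] that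
    by simp
  then have "positive_cone n' (telescope n a b - ext_scale (of_real (\<epsilon> ^ n')) (wedge_pow w n'))"
    unfolding eq using e by (intro positive_cone_add pow_dominates[OF w b(1)] positive_cone_sum) auto
  then show thesis using that[of "\<epsilon> ^ n'"] e n' by simp
qed

text \<open>
  If \<open>h\<close> is semidefinite, so is the star \<open>T\<close> of \<open>h \<and> w^(n-2)\<close>. Up to a positive factor it is the trace
  of \<open>h\<close> times \<open>w\<close>, minus \<open>h\<close>: if \<open>h\<close> is positive on \<open>e\<close>, then \<open>T\<close> is positive on the vectors orthogonal to \<open>e\<close>,
  which exist in dimension at least two. As the telescoping sum dominates a multiple of \<open>w^(n-1)\<close>,
  its wedge with \<open>T\<close> is positive on a unitary frame adapted to \<open>e\<close>. On the given frame it is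
  non-negative, and not zero since a form of top degree that vanishes on one frame is zero.
\<close>

lemma linearised_operator_pos:
  fixes w :: "'n::finite ext"
  assumes w: "hermitian w" and n: "CARD('n) \<ge> 2"
    and a: "real_pp 1 a" "\<And>v. v \<noteq> 0 \<Longrightarrow> herm a v (\<i> *s v) > 0"
    and b: "real_pp 1 b" "\<And>v. v \<noteq> 0 \<Longrightarrow> herm b v (\<i> *s v) > 0"
    and h: "real_pp 1 h" "\<And>v. herm h v (\<i> *s v) \<ge> 0"
    and F: "distinct (pairs us0)" "span (set (pairs us0)) = UNIV" "length us0 = CARD('n)"
  defines "T \<equiv> hodge_star_at w (2 * (CARD('n) - 1)) (wedge h (wedge_pow w (CARD('n) - 2)))"
  shows "Re (wedge T (telescope CARD('n) a b) (pairs us0)) \<ge> 0"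
    and "herm h e (\<i> *s e) > 0 \<Longrightarrow> Re (wedge T (telescope CARD('n) a b) (pairs us0)) > 0"
proof -
  let ?R = "telescope CARD('n) a b"
  have h1: "positive_cone 1 h" by (rule positive_cone_psd[OF h])
  have n1: "1 + (CARD('n) - 2) = CARD('n) - 1" using n by simp
  have hw: "real_pp (CARD('n) - 1) (wedge h (wedge_pow w (CARD('n) - 2)))"
    using real_pp_wedge[OF h(1) real_pp_pow[OF hermitian_real_pp[OF w], of "CARD('n) - 2"]] n1 by simp
  have hw': "positive_cone (CARD('n) - 1) (wedge h (wedge_pow w (CARD('n) - 2)))"
    using positive_cone_wedge[OF h1 positive_cone_pow[OF hermitian_positive_cone[OF w], of "CARD('n) - 2"]] n1 by simp
  have T: "real_pp 1 T" "\<And>v. herm T v (\<i> *s v) \<ge> 0"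
    unfolding T_def using real_pp_hodge_star[OF w hw] hodge_star_nonneg[OF w hw hw'] by auto
  have T1: "positive_cone 1 T" by (rule positive_cone_psd[OF T])
  obtain \<epsilon> where e: "\<epsilon> > 0" "positive_cone (CARD('n) - 1) (?R - ext_scale (of_real \<epsilon>) (wedge_pow w (CARD('n) - 1)))"
    using telescope_dominates[OF w _ a b, of "CARD('n)"] by auto
  have pw: "positive_cone (CARD('n) - 1) (wedge_pow w (CARD('n) - 1))"
    by (intro positive_cone_pow hermitian_positive_cone w)
  have R: "positive_cone (CARD('n) - 1) ?R"
    using positive_cone_add[OF e(2) positive_cone_scale[OF pw less_imp_le[OF e(1)]]]
    by (simp only: diff_add_cancel)
  have n2: "1 + (CARD('n) - 1) = CARD('n)" using n by simp
  have TR: "positive_cone CARD('n) (wedge T ?R)" using positive_cone_wedge[OF T1 R] n2 by simp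
  have nonneg: "wedge T ?R (pairs us0) \<in> \<real>\<^sub>\<ge>\<^sub>0" by (rule positive_cone_pairs[OF TR])
  then show "Re (wedge T ?R (pairs us0)) \<ge> 0" by (rule nonneg_Re)
  assume he: "herm h e (\<i> *s e) > 0"
  have "e \<noteq> 0" using he herm_scaleR[OF h(1), of 0 0] by auto
  define u where "u = e /\<^sub>R sqrt (metric w e e)"
  note u = unit_pair[OF w \<open>e \<noteq> 0\<close>, folded u_def]
  have hu: "herm h u (\<i> *s u) > 0"
  proof -
    have "0 < herm h (sqrt (metric w e e) *\<^sub>R u) (\<i> *s (sqrt (metric w e e) *\<^sub>R u))" using he u(3) by metis
    then show ?thesis unfolding herm_scaleR[OF h(1)] using u(2) by (simp add: zero_less_mult_iff)
  qed
  obtain us where us: "length us + length [u] = CARD('n)" "orthonormal (metric w) (pairs (us @ [u]))"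
    using unitary_extend[OF w u(1)] n by auto
  obtain v us' where us': "us = us' @ [v]" using us(1) n by (cases us rule: rev_cases) auto
  have on: "orthonormal (metric w) (pairs ((u # us') @ [v]))" "orthonormal (metric w) (pairs (u # us'))"
      "orthonormal (metric w) (pairs us')" "orthonormal (metric w) (pairs (v # u # us'))"
    using us(2) inner_form_sym[OF hermitian_inner_form[OF w]]
    unfolding us' by (auto simp: orthonormal_append)
  have l: "length us' = CARD('n) - 2" "length (u # us') = CARD('n) - 1" using us(1) us' by auto
  have "Re (wedge h (wedge_pow w (CARD('n) - 2)) (pairs (u # us'))) \<ge>
      herm h u (\<i> *s u) * Re (wedge_pow w (CARD('n) - 2) (pairs us'))"
    by (rule wedge_pow_split[OF w on(2) h1 h(1)])
  moreover have "Re (wedge_pow w (CARD('n) - 2) (pairs us')) \<ge> 1"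
    using pow_unitary_ge_1[OF w on(3)] l by simp
  ultimately have "Re (wedge h (wedge_pow w (CARD('n) - 2)) (pairs (u # us'))) > 0"
    using hu by (meson less_le_trans mult_pos_pos zero_less_one)
  then have Tv: "herm T v (\<i> *s v) > 0"
    unfolding T_def using hodge_star_herm[OF w on(1) _ hw] l n by simp
  have "Re (wedge T (wedge_pow w (CARD('n) - 1)) (pairs (v # u # us'))) \<ge>
      herm T v (\<i> *s v) * Re (wedge_pow w (CARD('n) - 1) (pairs (u # us')))"
    by (rule wedge_pow_split[OF w on(4) T1 T(1)])
  moreover have "Re (wedge_pow w (CARD('n) - 1) (pairs (u # us'))) \<ge> 1"
    using pow_unitary_ge_1[OF w on(2)] unfolding l(2) .
  ultimately have "Re (wedge T (wedge_pow w (CARD('n) - 1)) (pairs (v # u # us'))) > 0"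
    using Tv by (meson less_le_trans mult_pos_pos zero_less_one)
  then have "\<epsilon> * Re (wedge T (wedge_pow w (CARD('n) - 1)) (pairs (v # u # us'))) > 0" using e by simp
  moreover have "Re (wedge T (?R - ext_scale (of_real \<epsilon>) (wedge_pow w (CARD('n) - 1))) (pairs (v # u # us'))) \<ge> 0"
    by (rule nonneg_Re[OF positive_cone_pairs[OF positive_cone_wedge[OF T1 e(2)]]])
  ultimately have "Re (wedge T ?R (pairs (v # u # us'))) > 0"
    unfolding wedge_diff_right wedge_scale_right by (simp add: ext_scale_def)
  then have "wedge T ?R \<noteq> 0" by force
  moreover have "alt_form (length (pairs us0)) (wedge T ?R)"
    using alt_form_positive_cone[OF TR] F(3) by simp
  ultimately have "wedge T ?R (pairs us0) \<noteq> 0" using top_form_eq_zeroI[OF F(1,2)] by blast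
  then show "Re (wedge T ?R (pairs us0)) > 0"
    using nonneg by (auto simp: complex_nonneg_Reals_iff complex_eq_iff)
qed

section \<open>The strong maximum principle\<close>

text \<open>
  The first derivative along the line through \<open>y\<close> in direction \<open>x\<close> vanishes at \<open>y\<close>; a positive second
  derivative would make it positive, and the function increasing, right after \<open>y\<close>.
\<close>

lemma second_derivative_nonpos_at_max:
  fixes F :: "'v::euclidean_space \<Rightarrow> real"
  assumes "open U" "y \<in> U"
    and F1: "\<And>z. z \<in> U \<Longrightarrow> (F has_derivative F1 z) (at z)"
    and F2: "((\<lambda>z. F1 z x) has_derivative F2) (at y)"
    and max: "\<And>z. z \<in> U \<Longrightarrow> F z \<le> F y"
  shows "F2 x \<le> 0"
proof (rule ccontr)
  assume neg: "\<not> F2 x \<le> 0"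
  define \<phi> where "\<phi> t = F (y + t *\<^sub>R x)" for t
  define \<psi> where "\<psi> t = F1 (y + t *\<^sub>R x) x" for t
  have "continuous_on UNIV (\<lambda>t::real. y + t *\<^sub>R x)" by (intro continuous_intros)
  then have "open ((\<lambda>t::real. y + t *\<^sub>R x) -` U)"
    using assms(1) by (simp add: open_vimage)
  moreover have "0 \<in> (\<lambda>t::real. y + t *\<^sub>R x) -` U" using assms(2) by simp
  ultimately obtain d where d0: "d > 0" "ball 0 d \<subseteq> (\<lambda>t::real. y + t *\<^sub>R x) -` U"
    using open_contains_ball by blast
  have d: "d > 0" "\<And>t. \<bar>t\<bar> < d \<Longrightarrow> y + t *\<^sub>R x \<in> U"
    using d0 by (simp, metis abs_minus_cancel d0(2) diff_0 dist_norm mem_ball real_norm_def subsetD vimageE)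
  have line: "((\<lambda>t. y + t *\<^sub>R x) has_derivative (\<lambda>h. h *\<^sub>R x)) (at t)" for t
    by (auto intro!: derivative_eq_intros)
  have \<phi>': "DERIV \<phi> t :> \<psi> t" if "\<bar>t\<bar> < d" for t
  proof -
    have "(\<phi> has_derivative (\<lambda>h. F1 (y + t *\<^sub>R x) (h *\<^sub>R x))) (at t)"
      unfolding \<phi>_def using has_derivative_compose[OF line F1[OF d(2)[OF that]]] .
    moreover have "F1 (y + t *\<^sub>R x) (h *\<^sub>R x) = \<psi> t * h" for h
      using has_derivative_linear[OF F1[OF d(2)[OF that]]] by (simp add: linear_scale \<psi>_def)
    ultimately show ?thesis by (simp add: has_field_derivative_def)
  qed
  have "(\<psi> has_derivative (\<lambda>h. F2 (h *\<^sub>R x))) (at 0)"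
    unfolding \<psi>_def using F2 by (intro has_derivative_compose[OF line]) simp
  then have \<psi>': "DERIV \<psi> 0 :> F2 x"
    using has_derivative_linear[OF F2]
    by (auto simp: has_field_derivative_def linear_scale mult.commute elim!: back_subst[of "\<lambda>g. (\<psi> has_derivative g) (at 0)"])
  have "\<psi> 0 = 0"
  proof (rule DERIV_local_max[OF \<phi>' d(1)])
    show "\<forall>s. \<bar>0 - s\<bar> < d \<longrightarrow> \<phi> s \<le> \<phi> 0"
      using max d(2) by (auto simp: \<phi>_def)
  qed (use d in simp)
  moreover obtain e where e: "e > 0" "\<And>h. 0 < h \<Longrightarrow> h < e \<Longrightarrow> \<psi> 0 < \<psi> h"
    using DERIV_pos_inc_right[OF \<psi>'] neg by auto
  define t where "t = min d e / 2"
  have t: "0 < t" "t < d" "t < e" using d(1) e(1) by (auto simp: t_def)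
  have "\<phi> 0 < \<phi> t"
  proof (rule DERIV_pos_imp_increasing_open[OF t(1)])
    show "\<exists>y. DERIV \<phi> s :> y \<and> 0 < y" if "0 < s" "s < t" for s
      using \<phi>'[of s] e(2)[of s] that t \<open>\<psi> 0 = 0\<close> by (intro exI[of _ "\<psi> s"]) auto
    show "continuous_on {0..t} \<phi>"
    proof (intro continuous_at_imp_continuous_on ballI)
      show "isCont \<phi> s" if "s \<in> {0..t}" for s
        using DERIV_isCont[OF \<phi>'[of s]] that t by simp
    qed
  qed
  moreover have "\<phi> t \<le> \<phi> 0" using max[OF d(2), of t] t by (simp add: \<phi>_def)
  ultimately show False by simp
qed

text \<open>
  Linearity in the second argument is inherited from the first derivative, whose values at nearby
  points are linear.
\<close>

lemma bilinear_second_derivative: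
  fixes f1 :: "'v::euclidean_space \<Rightarrow> 'v \<Rightarrow> real"
  assumes "open U" "z \<in> U" "\<And>z. z \<in> U \<Longrightarrow> linear (f1 z)"
    and f2: "\<And>y. ((\<lambda>z. f1 z y) has_derivative (\<lambda>x. f2 x y)) (at z)"
  shows "bilinear f2"
  unfolding bilinear_def
proof (intro conjI allI)
  show "linear (\<lambda>x. f2 x y)" for y using has_derivative_linear[OF f2] .
  have eq: "(\<lambda>x. f2 x y) = g" if "(h has_derivative g) (at z)" "\<And>z. z \<in> U \<Longrightarrow> h z = f1 z y" for y h g
  proof -
    have "((\<lambda>z. f1 z y) has_derivative g) (at z)"
      by (rule has_derivative_transform_within_open[OF that(1) assms(1,2)]) (rule that(2))
    from has_derivative_unique[OF f2 this] show ?thesis .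
  qed
  show "linear (f2 x)" for x
  proof (rule linearI)
    show "f2 x (a + b) = f2 x a + f2 x b" for a b
      using eq[OF has_derivative_add[OF f2[of a] f2[of b]], of "a + b"] assms(3)
      by (auto simp: linear_add fun_eq_iff)
    show "f2 x (c *\<^sub>R a) = c *\<^sub>R f2 x a" for c a
      using eq[OF has_derivative_scaleR_right[OF f2[of a], of c], of "c *\<^sub>R a"] assms(3)
      by (auto simp: linear_scale fun_eq_iff)
  qed
qed

text \<open>
  The second-order operator with coefficient matrix \<open>A\<close>, applied to the Hessian \<open>Q\<close>.
\<close>

definition contraction :: "('v::euclidean_space \<Rightarrow> 'v \<Rightarrow> real) \<Rightarrow> ('v \<Rightarrow> 'v \<Rightarrow> real) \<Rightarrow> real" where
  "contraction A Q = (\<Sum>a\<in>Basis. \<Sum>b\<in>Basis. A a b * Q a b)"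

lemma contraction_linear:
  "contraction A (\<lambda>x y. s * P x y + t * Q x y) = s * contraction A P + t * contraction A Q"
  by (simp add: contraction_def sum_distrib_left algebra_simps sum.distrib)

text \<open>
  Hopf's argument. If \<open>f\<close> is not constant near \<open>z0\<close>, some ball inside the set \<open>f < M\<close> touches the set
  of maxima in a single point \<open>x0\<close>. On a small ball around \<open>x0\<close> the function \<open>v = exp (-c |z - p|^2) -
  exp (-c R^2)\<close>, with centre \<open>p\<close> and radius \<open>R\<close> of the touching ball, is a strict subsolution if \<open>c\<close> is
  large, because the coefficients are continuous and elliptic. Adding a small multiple of \<open>v\<close> pushes
  the maximum on the small ball into its interior, where its Hessian would be negative
  semidefinite, contrary to the strict inequality. Ellipticity is required in the form in which it
  is used: on semidefinite matrices and, strictly, on squares.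
\<close>

theorem strong_maximum_principle:
  fixes f :: "'v::euclidean_space \<Rightarrow> real"
  assumes U: "open U"
    and f1: "\<And>z. z \<in> U \<Longrightarrow> (f has_derivative f1 z) (at z)"
    and f2: "\<And>z y. z \<in> U \<Longrightarrow> ((\<lambda>z. f1 z y) has_derivative (\<lambda>x. f2 z x y)) (at z)"
    and A: "\<And>a b. a \<in> Basis \<Longrightarrow> b \<in> Basis \<Longrightarrow> continuous_on U (\<lambda>z. A z a b)"
    and psd: "\<And>z Q. z \<in> U \<Longrightarrow> bilinear Q \<Longrightarrow> (\<And>x. Q x x \<ge> 0) \<Longrightarrow> contraction (A z) Q \<ge> 0"
    and pos: "\<And>z \<xi>. z \<in> U \<Longrightarrow> \<xi> \<noteq> 0 \<Longrightarrow> contraction (A z) (\<lambda>x y. (\<xi> \<bullet> x) * (\<xi> \<bullet> y)) > 0"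
    and eqn: "\<And>z. z \<in> U \<Longrightarrow> contraction (A z) (f2 z) \<ge> 0"
    and max: "\<And>z. z \<in> U \<Longrightarrow> f z \<le> M" and z0: "z0 \<in> U" "f z0 = M"
  shows "\<exists>r>0. \<forall>z\<in>ball z0 r. f z = M"
proof -
  obtain r0 where r0: "r0 > 0" "cball z0 r0 \<subseteq> U" using U z0(1) open_contains_cball by blast
  define r where "r = r0 / 3"
  have r: "r > 0" using r0 by (simp add: r_def)
  have fc: "continuous_on U f"
    by (intro continuous_at_imp_continuous_on ballI has_derivative_continuous[OF f1])
  show ?thesis
  proof (rule ccontr)
    assume "\<not> ?thesis"
    then obtain z1 where z1: "z1 \<in> ball z0 r" "f z1 \<noteq> M" using r by auto
    define Z where "Z = {z \<in> cball z0 (2 * r). f z = M}"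
    have sub2: "cball z0 (2 * r) \<subseteq> U" using r0 by (auto simp: r_def subset_iff)
    have "compact Z"
    proof -
      have "closed {z \<in> cball z0 (2 * r). f z = M}"
        by (intro continuous_closed_preimage_constant continuous_on_subset[OF fc sub2] closed_cball)
      then show ?thesis unfolding Z_def
        by (simp add: compact_eq_bounded_closed) (auto intro: bounded_subset[OF bounded_cball])
    qed
    moreover have "z0 \<in> Z" using r z0 by (simp add: Z_def)
    ultimately obtain x0 where x0: "x0 \<in> Z" "\<And>z. z \<in> Z \<Longrightarrow> dist z1 x0 \<le> dist z1 z"
      using distance_attains_inf[of Z z1] compact_imp_closed by blast
    define d where "d = dist z1 x0"
    have dr: "d < r" using x0(2)[OF \<open>z0 \<in> Z\<close>] z1(1) by (simp add: d_def dist_commute)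
    have d: "d > 0" using x0(1) z1(2) by (auto simp: d_def Z_def)
    have less: "f z < M" if "dist z1 z < d" for z
    proof -
      have "dist z0 z < 2 * r"
        using dist_triangle[of z0 z z1] z1(1) that dr by simp
      then have "z \<in> U" "z \<in> cball z0 (2 * r)" using sub2 by auto
      moreover have "z \<notin> Z" using x0(2)[of z] that by (auto simp: d_def)
      ultimately show ?thesis using max[of z] by (auto simp: Z_def)
    qed
    have x0U: "x0 \<in> U" "f x0 = M" using x0(1) sub2 by (auto simp: Z_def)
    \<comment> \<open>The ball with diameter from \<open>z1\<close> to \<open>x0\<close> touches the set of maxima only at \<open>x0\<close>.\<close>
    define p where "p = midpoint z1 x0"
    define R where "R = d / 2"
    have R: "R > 0" "dist p x0 = R" "dist z1 p = R"
      using d by (simp_all add: R_def p_def d_def dist_midpoint)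
    have touch: "f z < M" if "dist p z \<le> R" "z \<noteq> x0" for z
    proof -
      have "dist z1 z < d"
      proof (rule ccontr)
        assume "\<not> dist z1 z < d"
        then have e: "dist z1 z = R + R" "dist p z = R"
          using dist_triangle[of z1 z p] R(3) that(1) by (auto simp: R_def)
        have "norm ((p - z1) + (z - p)) = norm (p - z1) + norm (z - p)"
          using e R(3) by (simp add: dist_norm norm_minus_commute)
        then have "norm (p - z1) *\<^sub>R (z - p) = norm (z - p) *\<^sub>R (p - z1)"
          using norm_triangle_eq by blast
        then have "z - p = p - z1" using e R by (simp add: dist_norm norm_minus_commute)
        then have "z = x0" by (simp add: p_def midpoint_def algebra_simps flip: scaleR_2) 
        then show False using that(2) by simp
      qed
      then show ?thesis by (rule less)
    qed
    obtain s0 where s0: "s0 > 0" "cball x0 s0 \<subseteq> U" using U x0U(1) open_contains_cball by blast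
    define s where "s = min s0 (R / 2)"
    have s: "s > 0" "s \<le> R / 2" using s0 R by (auto simp: s_def)
    define K where "K = cball x0 s"
    have K: "compact K" "K \<noteq> {}" "K \<subseteq> U"
      using s s0(2) by (auto simp: K_def s_def subset_iff)
    have pK: "z \<noteq> p" if "z \<in> K" for z
      using that s R by (auto simp: K_def dist_commute)
    define L where "L z Q = contraction (A z) Q" for z Q
    have Lc: "continuous_on K (\<lambda>z. L z (Q z))"
      if "\<And>a b. continuous_on K (\<lambda>z. Q z a b)" for Q
      unfolding L_def contraction_def
      by (intro continuous_on_sum continuous_on_mult that continuous_on_subset[OF A K(3)])
    define \<psi> where "\<psi> z = L z (\<lambda>x y. ((z - p) \<bullet> x) * ((z - p) \<bullet> y))" for z
    define I where "I z = L z (\<lambda>x y. x \<bullet> y)" for z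
    have "continuous_on K \<psi>" unfolding \<psi>_def by (intro Lc continuous_intros)
    then obtain a where a: "a \<in> K" "\<And>z. z \<in> K \<Longrightarrow> \<psi> a \<le> \<psi> z"
      using continuous_attains_inf[OF K(1,2)] by blast
    have "continuous_on K I" unfolding I_def by (intro Lc continuous_intros)
    then obtain b where b: "b \<in> K" "\<And>z. z \<in> K \<Longrightarrow> I z \<le> I b"
      using continuous_attains_sup[OF K(1,2)] by blast
    have \<psi>a: "\<psi> a > 0" using pos[of a "a - p"] a(1) K(3) pK by (auto simp: \<psi>_def L_def)
    \<comment> \<open>This \<open>c\<close> makes \<open>2 * c * \<psi> z > I z\<close> on \<open>K\<close>, which is the condition for a strict subsolution below.\<close>
    define c where "c = (\<bar>I b\<bar> + 1) / \<psi> a"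
    have c: "c > 0" using \<psi>a by (simp add: c_def add_pos_nonneg)
    define E where "E z = exp (- c * ((z - p) \<bullet> (z - p)))" for z
    define v where "v z = E z - exp (- c * R\<^sup>2)" for z
    define v1 where "v1 z y = - 2 * c * ((z - p) \<bullet> y) * E z" for z y
    define v2 where "v2 z x y = (4 * c\<^sup>2 * E z) * (((z - p) \<bullet> x) * ((z - p) \<bullet> y)) + (- 2 * c * E z) * (x \<bullet> y)" for z x y
    have dE: "(E has_derivative (\<lambda>x. - 2 * c * ((z - p) \<bullet> x) * E z)) (at z)" for z
      unfolding E_def by (auto intro!: derivative_eq_intros simp: inner_commute algebra_simps)
    have dv: "(v has_derivative v1 z) (at z)" for z
      unfolding v_def[abs_def] v1_def using dE by (auto intro!: derivative_eq_intros)
    have dv1: "((\<lambda>z. v1 z y) has_derivative (\<lambda>x. v2 z x y)) (at z)" for z y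
      unfolding v1_def v2_def
      by (rule derivative_eq_intros dE refl)+ (auto simp: algebra_simps power2_eq_square)
    have Lv: "L z (v2 z) > 0" if "z \<in> K" for z
    proof -
      have "L z (v2 z) = 2 * c * E z * (2 * c * \<psi> z - I z)"
        unfolding v2_def L_def contraction_linear by (simp add: \<psi>_def I_def L_def algebra_simps power2_eq_square)
      note Leq = this
      have "c * \<psi> a \<le> c * \<psi> z" using c a(2)[OF that] by simp
      moreover have "c * \<psi> a = \<bar>I b\<bar> + 1" using \<psi>a by (simp add: c_def)
      ultimately have "2 * c * \<psi> z - I z > 0" using b(2)[OF that] by linarith
      then show ?thesis unfolding Leq using c by (simp add: E_def)
    qed
    have v_neg: "v z < 0" if "dist p z > R" for z
    proof -
      have "R\<^sup>2 < (dist p z)\<^sup>2" using that R by (intro power_strict_mono) auto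
      also have "(dist p z)\<^sup>2 = (z - p) \<bullet> (z - p)"
        by (simp add: dist_norm norm_minus_commute flip: power2_norm_eq_inner)
      finally show ?thesis using c by (simp add: v_def E_def)
    qed
    have v_le: "v z \<le> 1" for z
    proof -
      have "E z \<le> 1" using c by (simp add: E_def)
      then show ?thesis unfolding v_def by (smt (verit) exp_gt_zero)
    qed
    have v_x0: "v x0 = 0"
      using R(2) by (simp add: v_def E_def dist_norm norm_minus_commute power2_norm_eq_inner flip: power2_norm_eq_inner)
    define S where "S = sphere x0 s \<inter> cball p R"
    obtain \<delta> where \<delta>: "\<delta> > 0" "\<And>z. z \<in> S \<Longrightarrow> f z \<le> M - \<delta>"
    proof (cases "S = {}")
      case True
      then show ?thesis using that[of 1] by auto
    next
      case False
      have "S \<subseteq> K" by (auto simp: S_def K_def)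
      then have "S \<subseteq> U" using K(3) by blast
      have "compact S" unfolding S_def by (intro compact_Int_closed compact_sphere closed_cball)
      then obtain q where q: "q \<in> S" "\<And>z. z \<in> S \<Longrightarrow> f z \<le> f q"
        using continuous_attains_sup[OF _ False continuous_on_subset[OF fc \<open>S \<subseteq> U\<close>]] by blast
      have "f q < M" using q(1) s by (intro touch) (auto simp: S_def)
      then show ?thesis using that[of "M - f q"] q(2) by auto
    qed
    define \<epsilon> where "\<epsilon> = \<delta> / 2"
    have \<epsilon>: "\<epsilon> > 0" "\<epsilon> < \<delta>" using \<delta> by (auto simp: \<epsilon>_def)
    define F where "F z = f z + \<epsilon> * v z" for z
    have "continuous_on K F"
      unfolding F_def using dv has_derivative_continuous
      by (intro continuous_intros continuous_on_subset[OF fc K(3)] continuous_at_imp_continuous_on) blast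
    then obtain y where y: "y \<in> K" "\<And>z. z \<in> K \<Longrightarrow> F z \<le> F y"
      using continuous_attains_sup[OF K(1,2)] by blast
    have Fx0: "F x0 = M" using x0U v_x0 by (simp add: F_def)
    have "y \<notin> sphere x0 s"
    proof
      assume ys: "y \<in> sphere x0 s"
      have "F y < M"
      proof (cases "dist p y \<le> R")
        case True
        then have "f y \<le> M - \<delta>" using ys by (intro \<delta>) (auto simp: S_def)
        moreover have "\<epsilon> * v y \<le> \<epsilon> * 1" using v_le \<epsilon> by (intro mult_left_mono) auto
        ultimately have "f y + \<epsilon> * v y < M" using \<epsilon> by linarith
        then show ?thesis by (simp add: F_def)
      next
        case False
        then have "\<epsilon> * v y < 0" using v_neg[of y] \<epsilon> by (simp add: mult_pos_neg)
        then show ?thesis using max[of y] y(1) K(3) by (auto simp: F_def)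
      qed
      moreover have "F x0 \<le> F y" using y(2)[of x0] s by (simp add: K_def)
      ultimately show False using Fx0 by simp
    qed
    then have yb: "y \<in> ball x0 s" using y(1) by (auto simp: K_def)
    then have yU: "y \<in> U" using y(1) K(3) by auto
    have bU: "ball x0 s \<subseteq> U" using K(3) by (auto simp: K_def)
    define G where "G x w = -1 * f2 y x w + (- \<epsilon>) * v2 y x w" for x w
    have bf: "bilinear (f2 y)"
      by (rule bilinear_second_derivative[OF U yU _ f2[OF yU]]) (use f1 has_derivative_linear in blast)
    have bv: "bilinear (v2 y)"
      by (rule bilinear_second_derivative[OF open_UNIV UNIV_I _ dv1]) (use dv has_derivative_linear in blast)
    have "bilinear G"
      unfolding bilinear_def G_def
      by (auto intro!: linearI simp: bilinear_ladd[OF bf] bilinear_radd[OF bf] bilinear_lmul[OF bf]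
          bilinear_rmul[OF bf] bilinear_ladd[OF bv] bilinear_radd[OF bv] bilinear_lmul[OF bv]
          bilinear_rmul[OF bv] algebra_simps)
    moreover have "G x x \<ge> 0" for x
    proof -
      have "f2 y x x + \<epsilon> * v2 y x x \<le> 0"
      proof (rule second_derivative_nonpos_at_max[where F = F and ?F1.0 = "\<lambda>z x. f1 z x + \<epsilon> * v1 z x"
            and U = "ball x0 s" and y = y and x = x and ?F2.0 = "\<lambda>t. f2 y t x + \<epsilon> * v2 y t x"])
        show "(F has_derivative (\<lambda>x. f1 z x + \<epsilon> * v1 z x)) (at z)" if "z \<in> ball x0 s" for z
          unfolding F_def[abs_def] using that bU
          by (intro has_derivative_add has_derivative_mult_right f1 dv) auto
        show "((\<lambda>z. f1 z x + \<epsilon> * v1 z x) has_derivative (\<lambda>t. f2 y t x + \<epsilon> * v2 y t x)) (at y)"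
          by (intro has_derivative_add has_derivative_mult_right f2 dv1 yU)
      qed (use yb y(2) in \<open>auto simp: K_def\<close>)
      then show ?thesis by (simp add: G_def)
    qed
    ultimately have "L y G \<ge> 0" unfolding L_def by (rule psd[OF yU])
    moreover have "L y G = - L y (f2 y) - \<epsilon> * L y (v2 y)"
      unfolding G_def L_def contraction_linear by simp
    moreover have "L y (f2 y) \<ge> 0" using eqn[OF yU] by (simp add: L_def)
    moreover have "\<epsilon> * L y (v2 y) > 0" using Lv[OF y(1)] \<epsilon> by simp
    ultimately show False by simp
  qed
qed

section \<open>Smooth functions\<close>

lemma has_derivative_cong_open:
  assumes "open S" "x \<in> S" "\<And>y. y \<in> S \<Longrightarrow> f y = g y"
  shows "(f has_derivative D) (at x) \<longleftrightarrow> (g has_derivative D) (at x)"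
proof
  show "(f has_derivative D) (at x) \<Longrightarrow> (g has_derivative D) (at x)"
    by (erule has_derivative_transform_within_open[OF _ assms(1,2)]) (rule assms(3))
  show "(g has_derivative D) (at x) \<Longrightarrow> (f has_derivative D) (at x)"
    by (erule has_derivative_transform_within_open[OF _ assms(1,2)]) (rule assms(3)[symmetric])
qed

lemma frechet_derivative_cong_open:
  assumes "open S" "x \<in> S" "\<And>y. y \<in> S \<Longrightarrow> f y = g y"
  shows "frechet_derivative f (at x) = frechet_derivative g (at x)"
  unfolding frechet_derivative_def using has_derivative_cong_open[OF assms] by simp

lemma differentiable_cong_open:
  assumes "open S" "x \<in> S" "\<And>y. y \<in> S \<Longrightarrow> f y = g y"
  shows "f differentiable (at x) \<longleftrightarrow> g differentiable (at x)"
  unfolding differentiable_def using has_derivative_cong_open[OF assms] by simp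

lemma frechet_derivative_eqI: "(f has_derivative D) (at x) \<Longrightarrow> frechet_derivative f (at x) = D"
  using frechet_derivative_at by metis

lemma differentiable_has_derivative:
  "f differentiable (at x) \<Longrightarrow> (f has_derivative frechet_derivative f (at x)) (at x)"
  using frechet_derivative_works by blast

lemma Ck_on_cong:
  assumes "open S" "\<And>x. x \<in> S \<Longrightarrow> f x = g x"
  shows "Ck_on k S f \<longleftrightarrow> Ck_on k S g"
  using assms(2)
proof (induction k arbitrary: f g)
  case (Suc k)
  have "Ck_on k S (\<lambda>x. frechet_derivative f (at x) v) \<longleftrightarrow> Ck_on k S (\<lambda>x. frechet_derivative g (at x) v)" for v
    by (rule Suc.IH) (simp add: frechet_derivative_cong_open[OF assms(1) _ Suc.prems])
  then show ?case
    using differentiable_cong_open[OF assms(1) _ Suc.prems] by auto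
qed (simp cong: continuous_on_cong)

lemma Ck_on_SucD: "Ck_on (Suc k) S f \<Longrightarrow> Ck_on k S f"
proof (induction k arbitrary: f)
  case 0
  then show ?case
    by (auto intro!: continuous_at_imp_continuous_on differentiable_imp_continuous_within)
qed auto

lemma Ck_on_SucI:
  assumes "open S" "\<And>x. x \<in> S \<Longrightarrow> (f has_derivative D x) (at x)" "\<And>v. Ck_on k S (\<lambda>x. D x v)"
  shows "Ck_on (Suc k) S f"
proof -
  have "Ck_on k S (\<lambda>x. frechet_derivative f (at x) v)" for v
    using assms(3)[of v]
    by (subst Ck_on_cong[OF assms(1), of _ "\<lambda>x. D x v"]) (use frechet_derivative_eqI[OF assms(2)] in auto)
  then show ?thesis using assms(2) by (auto simp: differentiable_def)
qed

lemma Ck_on_SucE: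
  assumes "Ck_on (Suc k) S f"
  shows "\<And>x. x \<in> S \<Longrightarrow> (f has_derivative frechet_derivative f (at x)) (at x)"
    and "\<And>v. Ck_on k S (\<lambda>x. frechet_derivative f (at x) v)"
  using assms differentiable_has_derivative by auto

lemma Ck_on_const: "open S \<Longrightarrow> Ck_on k S (\<lambda>x. c)"
proof (induction k arbitrary: c)
  case (Suc k)
  show ?case by (rule Ck_on_SucI[where D = "\<lambda>x v. 0"]) (use Suc in auto)
qed simp

lemma Ck_on_add: "open S \<Longrightarrow> Ck_on k S f \<Longrightarrow> Ck_on k S g \<Longrightarrow> Ck_on k S (\<lambda>x. f x + g x)"
proof (induction k arbitrary: f g)
  case (Suc k)
  show ?case
    by (rule Ck_on_SucI[OF Suc.prems(1)
        has_derivative_add[OF Ck_on_SucE(1)[OF Suc.prems(2)] Ck_on_SucE(1)[OF Suc.prems(3)]]])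
       (use Suc Ck_on_SucE in auto)
qed (simp add: continuous_on_add)

lemma Ck_on_mult:
  fixes f g :: "'v::real_normed_vector \<Rightarrow> complex"
  shows "open S \<Longrightarrow> Ck_on k S f \<Longrightarrow> Ck_on k S g \<Longrightarrow> Ck_on k S (\<lambda>x. f x * g x)"
proof (induction k arbitrary: f g)
  case (Suc k)
  note D = Ck_on_SucE[OF Suc.prems(2)] Ck_on_SucE[OF Suc.prems(3)]
  show ?case
  proof (rule Ck_on_SucI[OF Suc.prems(1) has_derivative_mult[OF D(1,3)]])
    show "Ck_on k S (\<lambda>x. f x * frechet_derivative g (at x) v + frechet_derivative f (at x) v * g x)" for v
      by (intro Ck_on_add Suc.IH Suc.prems D Ck_on_SucD[OF Suc.prems(2)] Ck_on_SucD[OF Suc.prems(3)])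
  qed
qed (simp add: continuous_on_mult)

lemma Ck_on_inverse:
  fixes f :: "'v::real_normed_vector \<Rightarrow> complex"
  shows "open S \<Longrightarrow> Ck_on k S f \<Longrightarrow> (\<And>x. x \<in> S \<Longrightarrow> f x \<noteq> 0) \<Longrightarrow> Ck_on k S (\<lambda>x. inverse (f x))"
proof (induction k)
  case (Suc k)
  note D = Ck_on_SucE[OF Suc.prems(2)]
  note IH = Suc.IH[OF Suc.prems(1) Ck_on_SucD[OF Suc.prems(2)] Suc.prems(3)]
  show ?case
  proof (rule Ck_on_SucI[OF Suc.prems(1)])
    show "((\<lambda>x. inverse (f x)) has_derivative
        (\<lambda>v. (-1) * (inverse (f x) * frechet_derivative f (at x) v * inverse (f x)))) (at x)" if "x \<in> S" for x
      using Deriv.has_derivative_inverse[OF Suc.prems(3)[OF that] D(1)[OF that]] by simp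
    show "Ck_on k S (\<lambda>x. (-1) * (inverse (f x) * frechet_derivative f (at x) v * inverse (f x)))" for v
      by (intro Ck_on_mult Ck_on_const IH D Suc.prems)
  qed
qed (auto intro: continuous_on_inverse)

lemma smooth_on_add: "open S \<Longrightarrow> smooth_on S f \<Longrightarrow> smooth_on S g \<Longrightarrow> smooth_on S (\<lambda>x. f x + g x)"
  and smooth_on_const: "open S \<Longrightarrow> smooth_on S (\<lambda>x. c)"
  by (simp_all add: smooth_on_def Ck_on_add Ck_on_const)

lemma smooth_on_mult:
  fixes f g :: "'v::real_normed_vector \<Rightarrow> complex"
  shows "open S \<Longrightarrow> smooth_on S f \<Longrightarrow> smooth_on S g \<Longrightarrow> smooth_on S (\<lambda>x. f x * g x)"
  by (simp add: smooth_on_def Ck_on_mult)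

lemma smooth_on_cmult:
  fixes f :: "'v::real_normed_vector \<Rightarrow> complex"
  shows "open S \<Longrightarrow> smooth_on S f \<Longrightarrow> smooth_on S (\<lambda>x. c * f x)"
  by (intro smooth_on_mult smooth_on_const)

lemma smooth_on_diff:
  fixes f g :: "'v::real_normed_vector \<Rightarrow> complex"
  assumes "open S" "smooth_on S f" "smooth_on S g" shows "smooth_on S (\<lambda>x. f x - g x)"
  using smooth_on_add[OF assms(1,2) smooth_on_cmult[OF assms(1,3), of "-1"]] by simp

lemma smooth_on_sum:
  assumes "open S" "\<And>i. i \<in> I \<Longrightarrow> smooth_on S (f i)"
  shows "smooth_on S (\<lambda>x. \<Sum>i\<in>I. f i x)"
  using assms(2) by (induction I rule: infinite_finite_induct)
    (simp_all add: smooth_on_add smooth_on_const assms(1))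

lemma smooth_on_divide:
  fixes f g :: "'v::real_normed_vector \<Rightarrow> complex"
  assumes "open S" "smooth_on S f" "smooth_on S g" "\<And>x. x \<in> S \<Longrightarrow> g x \<noteq> 0"
  shows "smooth_on S (\<lambda>x. f x / g x)"
  using assms unfolding divide_inverse by (auto simp: smooth_on_def intro!: Ck_on_mult Ck_on_inverse)

lemma smooth_on_subset:
  assumes "smooth_on S f" "T \<subseteq> S" shows "smooth_on T f"
proof -
  have "Ck_on k S f \<Longrightarrow> Ck_on k T f" for k
    using assms(2) by (induction k arbitrary: f) (auto intro: continuous_on_subset)
  then show ?thesis using assms by (auto simp: smooth_on_def)
qed

lemma smooth_on_differentiable: "smooth_on S f \<Longrightarrow> x \<in> S \<Longrightarrow> f differentiable (at x)"
  using Ck_on.simps(2)[of 0 S f] unfolding smooth_on_def by blast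

lemma smooth_on_derivative: "smooth_on S f \<Longrightarrow> smooth_on S (\<lambda>x. frechet_derivative f (at x) v)"
  using Ck_on.simps(2)[of _ S f] unfolding smooth_on_def by blast

lemma smooth_on_continuous: "smooth_on S f \<Longrightarrow> continuous_on S f"
  using Ck_on.simps(1)[of S f] unfolding smooth_on_def by blast

section \<open>Derivatives of forms in a chart\<close>

text \<open>
  The common form of \<open>dir_d\<close>, \<open>dir_del\<close> and \<open>dir_delbar\<close>, which differ only in the weights of the
  directions \<open>v\<close> and \<open>\<i> *s v\<close>.
\<close>

definition wdir :: "complex \<Rightarrow> complex \<Rightarrow> (complex ^ 'n \<Rightarrow> complex) \<Rightarrow> complex ^ 'n \<Rightarrow> complex ^ 'n::finite \<Rightarrow> complex" where
  "wdir p q f z v = p * frechet_derivative f (at z) v + q * frechet_derivative f (at z) (\<i> *s v)"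

lemma dir_wdir:
  "dir_d = wdir 1 0" "dir_del = wdir (1/2) (- \<i> / 2)" "dir_delbar = wdir (1/2) (\<i> / 2)"
  by (auto simp: fun_eq_iff wdir_def dir_d_def dir_del_def dir_delbar_def field_simps)

lemma wdir_const [simp]: "wdir p q (\<lambda>z. c) z v = 0"
  by (simp add: wdir_def)

lemma wdir_add:
  assumes "f differentiable (at z)" "g differentiable (at z)"
  shows "wdir p q (\<lambda>z. f z + g z) z v = wdir p q f z v + wdir p q g z v"
  by (simp add: wdir_def algebra_simps
      frechet_derivative_eqI[OF has_derivative_add[OF differentiable_has_derivative[OF assms(1)] differentiable_has_derivative[OF assms(2)]]])

lemma wdir_mult:
  assumes "f differentiable (at z)" "g differentiable (at z)"
  shows "wdir p q (\<lambda>z. f z * g z) z v = wdir p q f z v * g z + f z * wdir p q g z v"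
  by (simp add: wdir_def algebra_simps
      frechet_derivative_eqI[OF has_derivative_mult[OF differentiable_has_derivative[OF assms(1)] differentiable_has_derivative[OF assms(2)]]])

lemma wdir_cmult:
  assumes "f differentiable (at z)"
  shows "wdir p q (\<lambda>z. c * f z) z v = c * wdir p q f z v"
  using wdir_mult[where f = "\<lambda>z. c", OF differentiable_const assms] by simp

lemma wdir_diff:
  assumes "f differentiable (at z)" "g differentiable (at z)"
  shows "wdir p q (\<lambda>z. f z - g z) z v = wdir p q f z v - wdir p q g z v"
  by (simp add: wdir_def algebra_simps
      frechet_derivative_eqI[OF has_derivative_diff[OF differentiable_has_derivative[OF assms(1)] differentiable_has_derivative[OF assms(2)]]])

lemma wdir_sum:
  assumes "\<And>i. i \<in> I \<Longrightarrow> f i differentiable (at z)"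
  shows "wdir p q (\<lambda>z. \<Sum>i\<in>I. f i z) z v = (\<Sum>i\<in>I. wdir p q (f i) z v)"
  using assms by (induction I rule: infinite_finite_induct)
    (simp_all add: wdir_add differentiable_sum)

lemma wdir_cong_open:
  assumes "open S" "z \<in> S" "\<And>y. y \<in> S \<Longrightarrow> f y = g y"
  shows "wdir p q f z v = wdir p q g z v"
proof -
  have "frechet_derivative f (at z) = frechet_derivative g (at z)"
    by (rule frechet_derivative_cong_open[OF assms(1,2)]) (rule assms(3))
  then show ?thesis by (simp only: wdir_def)
qed

lemma smooth_on_wdir: "open S \<Longrightarrow> smooth_on S f \<Longrightarrow> smooth_on S (\<lambda>z. wdir p q f z v)"
  unfolding wdir_def by (intro smooth_on_add smooth_on_cmult smooth_on_derivative)

definition local_deriv ::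
  "((complex ^ 'n \<Rightarrow> complex) \<Rightarrow> complex ^ 'n \<Rightarrow> complex ^ 'n \<Rightarrow> complex) \<Rightarrow>
   (complex ^ 'n \<Rightarrow> 'n::finite ext) \<Rightarrow> complex ^ 'n \<Rightarrow> 'n ext" where
  "local_deriv \<delta> U z vs = (\<Sum>i<length vs. (-1) ^ i * \<delta> (\<lambda>z. U z (take i vs @ drop (Suc i) vs)) z (vs ! i))"

definition components_differentiable :: "(complex ^ 'n \<Rightarrow> 'n::finite ext) \<Rightarrow> complex ^ 'n \<Rightarrow> bool" where
  "components_differentiable U z \<longleftrightarrow> (\<forall>vs. (\<lambda>z. U z vs) differentiable (at z))"

definition components_smooth :: "(complex ^ 'n) set \<Rightarrow> (complex ^ 'n \<Rightarrow> 'n::finite ext) \<Rightarrow> bool" where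
  "components_smooth S U \<longleftrightarrow> (\<forall>vs. smooth_on S (\<lambda>z. U z vs))"

lemma components_smooth_differentiable: "components_smooth S U \<Longrightarrow> z \<in> S \<Longrightarrow> components_differentiable U z"
  unfolding components_smooth_def components_differentiable_def using smooth_on_differentiable by blast

lemma local_deriv_Nil: "local_deriv \<delta> U z [] = 0"
  by (simp add: local_deriv_def)

lemma local_deriv_Cons:
  "local_deriv \<delta> U z (v # vs) = \<delta> (\<lambda>z. U z vs) z v - local_deriv \<delta> (\<lambda>z. contract v (U z)) z vs"
  by (simp add: local_deriv_def sum.lessThan_Suc_shift contract_def sum_negf del: sum.lessThan_Suc)

lemma local_deriv_cong_open:
  assumes "open S" "z \<in> S" "\<And>y. y \<in> S \<Longrightarrow> U y = V y"
  shows "local_deriv (wdir p q) U z = local_deriv (wdir p q) V z"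
proof
  fix vs
  have "wdir p q (\<lambda>z. U z us) z v = wdir p q (\<lambda>z. V z us) z v" for us v
    by (rule wdir_cong_open[OF assms(1,2)]) (simp add: assms(3))
  then show "local_deriv (wdir p q) U z vs = local_deriv (wdir p q) V z vs"
    unfolding local_deriv_def by simp
qed

lemma components_smooth_deriv:
  "open S \<Longrightarrow> components_smooth S U \<Longrightarrow> components_smooth S (local_deriv (wdir p q) U)"
  unfolding components_smooth_def local_deriv_def
  by (intro allI smooth_on_sum smooth_on_cmult smooth_on_wdir) auto

lemma components_smooth_wedge:
  "open S \<Longrightarrow> components_smooth S U \<Longrightarrow> components_smooth S V \<Longrightarrow> components_smooth S (\<lambda>z. wedge (U z) (V z))"
  unfolding components_smooth_def wedge_def
  by (intro allI smooth_on_sum smooth_on_mult smooth_on_const) auto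

lemma components_smooth_const: "open S \<Longrightarrow> components_smooth S (\<lambda>z. a)"
  by (simp add: components_smooth_def smooth_on_const)

lemma components_smooth_pow:
  "open S \<Longrightarrow> components_smooth S U \<Longrightarrow> components_smooth S (\<lambda>z. wedge_pow (U z) k)"
  by (induction k) (simp_all add: components_smooth_wedge components_smooth_const)

lemma components_smooth_add:
  "open S \<Longrightarrow> components_smooth S U \<Longrightarrow> components_smooth S V \<Longrightarrow> components_smooth S (\<lambda>z. U z + V z)"
  by (simp add: components_smooth_def smooth_on_add)

lemma components_smooth_scale:
  "open S \<Longrightarrow> components_smooth S U \<Longrightarrow> components_smooth S (\<lambda>z. ext_scale c (U z))"
  by (simp add: components_smooth_def ext_scale_def smooth_on_cmult)

lemma components_differentiable_contract:
  "components_differentiable U z \<Longrightarrow> components_differentiable (\<lambda>z. contract v (U z)) z"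
  by (simp add: components_differentiable_def contract_def)

lemma components_differentiable_twist:
  "components_differentiable U z \<Longrightarrow> components_differentiable (\<lambda>z. twist (U z)) z"
  by (auto simp: components_differentiable_def twist_def intro!: differentiable_mult differentiable_const)

lemma components_differentiable_wedge:
  "components_differentiable U z \<Longrightarrow> components_differentiable V z \<Longrightarrow>
   components_differentiable (\<lambda>z. wedge (U z) (V z)) z"
  unfolding components_differentiable_def wedge_def
  by (auto intro!: differentiable_sum differentiable_mult differentiable_const)

lemma wdir_wedge:
  assumes "components_differentiable U z" "components_differentiable V z"
  shows "wdir p q (\<lambda>z. wedge (U z) (V z) vs) z v =
    wedge (\<lambda>us. wdir p q (\<lambda>z. U z us) z v) (V z) vs + wedge (U z) (\<lambda>us. wdir p q (\<lambda>z. V z us) z v) vs"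
proof -
  have d: "(\<lambda>z. U z us) differentiable (at z)" "(\<lambda>z. V z us) differentiable (at z)" for us
    using assms by (auto simp: components_differentiable_def)
  show ?thesis
    unfolding wedge_def
    by (subst wdir_sum)
       (auto simp: wdir_mult wdir_cmult d algebra_simps sum.distrib intro!: differentiable_mult differentiable_const)
qed

lemma local_deriv_add:
  assumes "components_differentiable U z" "components_differentiable V z"
  shows "local_deriv (wdir p q) (\<lambda>z. U z + V z) z = local_deriv (wdir p q) U z + local_deriv (wdir p q) V z"
  using assms by (auto simp: local_deriv_def components_differentiable_def wdir_add fun_eq_iff algebra_simps sum.distrib)

lemma local_deriv_diff:
  assumes "components_differentiable U z" "components_differentiable V z"
  shows "local_deriv (wdir p q) (\<lambda>z. U z - V z) z = local_deriv (wdir p q) U z - local_deriv (wdir p q) V z"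
  using assms by (auto simp: local_deriv_def components_differentiable_def wdir_diff fun_eq_iff algebra_simps sum_subtractf)

lemma local_deriv_const: "local_deriv (wdir p q) (\<lambda>z. a) z = 0"
  by (simp add: local_deriv_def fun_eq_iff)

lemma twist_local_deriv:
  assumes "components_differentiable U z"
  shows "twist (local_deriv (wdir p q) U z) = - local_deriv (wdir p q) (\<lambda>z. twist (U z)) z"
proof
  fix vs
  have d: "(\<lambda>z. U z us) differentiable (at z)" for us
    using assms by (auto simp: components_differentiable_def)
  have "wdir p q (\<lambda>z. twist (U z) (take i vs @ drop (Suc i) vs)) z v =
      - ((-1) ^ length vs) * wdir p q (\<lambda>z. U z (take i vs @ drop (Suc i) vs)) z v" if "i < length vs" for i v
  proof -
    have "length (take i vs @ drop (Suc i) vs) = length vs - 1" using that by simp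
    moreover have "(-1 :: complex) ^ (length vs - 1) = - ((-1) ^ length vs)"
      using that by (cases "length vs") auto
    ultimately show ?thesis unfolding twist_def by (simp only: wdir_cmult[OF d])
  qed
  then show "twist (local_deriv (wdir p q) U z) vs = (- local_deriv (wdir p q) (\<lambda>z. twist (U z)) z) vs"
    by (simp add: local_deriv_def twist_def sum_distrib_left mult_ac flip: sum_negf)
qed

text \<open>
  The Leibniz rule, by induction on the list of arguments with the recursions for the wedge
  product and for the derivative.
\<close>

lemma local_deriv_wedge:
  assumes "components_differentiable U z" "components_differentiable V z"
  shows "local_deriv (wdir p q) (\<lambda>z. wedge (U z) (V z)) z =
    wedge (local_deriv (wdir p q) U z) (V z) + wedge (twist (U z)) (local_deriv (wdir p q) V z)"
proof -
  have "local_deriv (wdir p q) (\<lambda>z. wedge (U z) (V z)) z vs =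
    wedge (local_deriv (wdir p q) U z) (V z) vs + wedge (twist (U z)) (local_deriv (wdir p q) V z) vs" for vs
    using assms
  proof (induction vs arbitrary: U V)
    case (Cons v vs)
    note D = Cons.prems components_differentiable_contract[OF Cons.prems(1)] components_differentiable_contract[OF Cons.prems(2)]
       components_differentiable_twist[OF Cons.prems(1)]
    let ?d = "local_deriv (wdir p q)"
    have cd: "contract v (?d U z) = (\<lambda>us. wdir p q (\<lambda>z. U z us) z v) - ?d (\<lambda>z. contract v (U z)) z"
      for U :: "complex ^ 'a \<Rightarrow> 'a ext"
      by (simp add: contract_def[of v "?d U z"] local_deriv_Cons fun_eq_iff)
    have "?d (\<lambda>z. wedge (U z) (V z)) z (v # vs) =
      wedge (\<lambda>us. wdir p q (\<lambda>z. U z us) z v) (V z) vs + wedge (U z) (\<lambda>us. wdir p q (\<lambda>z. V z us) z v) vs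
      - ?d (\<lambda>z. wedge (contract v (U z)) (V z) + wedge (twist (U z)) (contract v (V z))) z vs"
      by (simp only: local_deriv_Cons wdir_wedge[OF D(1,2)] contract_wedge)
    also have "?d (\<lambda>z. wedge (contract v (U z)) (V z) + wedge (twist (U z)) (contract v (V z))) z vs =
      ?d (\<lambda>z. wedge (contract v (U z)) (V z)) z vs + ?d (\<lambda>z. wedge (twist (U z)) (contract v (V z))) z vs"
      by (simp add: local_deriv_add components_differentiable_wedge D)
    also have "?d (\<lambda>z. wedge (contract v (U z)) (V z)) z vs =
      wedge (?d (\<lambda>z. contract v (U z)) z) (V z) vs + wedge (twist (contract v (U z))) (?d V z) vs"
      by (rule Cons.IH[OF D(3,2)])
    also have "?d (\<lambda>z. wedge (twist (U z)) (contract v (V z))) z vs =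
      wedge (?d (\<lambda>z. twist (U z)) z) (contract v (V z)) vs + wedge (U z) (?d (\<lambda>z. contract v (V z)) z) vs"
      using Cons.IH[OF D(5,4)] by (simp add: twist_simps)
    finally show ?case
      by (simp add: wedge_Cons cd twist_local_deriv[OF D(1)] contract_simps twist_simps
          wedge_diff_left wedge_diff_right wedge_minus_left algebra_simps)
  qed (simp add: local_deriv_Nil)
  then show ?thesis by (simp add: fun_eq_iff)
qed

text \<open>
  If all values of \<open>W\<close> are invariant under the complex structure, the weighted derivative at \<open>vs\<close> is
  a combination of \<open>dW\<close> at \<open>vs\<close> and \<open>dW\<close> at the multiples of \<open>vs\<close> by \<open>\<i>\<close>. So \<open>\<partial>\<close> and \<open>\<partial>\<close>-bar kill closed forms
  of this kind separately.
\<close>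

lemma closed_pp_local_deriv:
  assumes "open S" "z \<in> S" "\<And>y us. y \<in> S \<Longrightarrow> W y (map (\<lambda>v. \<i> *s v) us) = W y us"
    and "local_deriv (wdir 1 0) W z = 0"
  shows "local_deriv (wdir p q) W z = 0"
proof
  fix vs
  let ?J = "map (\<lambda>v. \<i> *s v)"
  have fd: "frechet_derivative (\<lambda>z. W z (?J us)) (at z) = frechet_derivative (\<lambda>z. W z us) (at z)" for us
    by (rule frechet_derivative_cong_open[OF assms(1,2)]) (rule assms(3))
  have "local_deriv (wdir 1 0) W z (?J vs) = (\<Sum>i<length vs. (-1) ^ i *
      frechet_derivative (\<lambda>z. W z (take i vs @ drop (Suc i) vs)) (at z) (\<i> *s (vs ! i)))"
    by (simp add: local_deriv_def wdir_def take_map drop_map fd flip: map_append)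
  then have "local_deriv (wdir p q) W z vs = p * local_deriv (wdir 1 0) W z vs + q * local_deriv (wdir 1 0) W z (?J vs)"
    by (simp add: local_deriv_def wdir_def sum_distrib_left sum.distrib algebra_simps)
  then show "local_deriv (wdir p q) W z vs = 0 vs" by (simp add: assms(4))
qed

lemma local_deriv_pow_closed:
  assumes "components_differentiable W z" "local_deriv (wdir p q) W z = 0"
  shows "local_deriv (wdir p q) (\<lambda>z. wedge_pow (W z) k) z = 0 \<and> components_differentiable (\<lambda>z. wedge_pow (W z) k) z"
proof (induction k)
  case 0
  show ?case by (simp only: wedge_pow.simps local_deriv_const components_differentiable_def differentiable_const) simp
next
  case (Suc k)
  then show ?case
    using local_deriv_wedge[OF assms(1), of "\<lambda>z. wedge_pow (W z) k" p q] assms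
    by (simp only: wedge_pow.simps components_differentiable_wedge wedge_zero_left wedge_zero_right add_0_left simp_thms)
qed

definition zero_form :: "complex \<Rightarrow> 'n::finite ext" where
  "zero_form t = (\<lambda>ws. if ws = [] then t else 0)"

lemma components_smooth_zero_form:
  assumes "open S" "smooth_on S f" shows "components_smooth S (\<lambda>z. zero_form (f z))"
  unfolding components_smooth_def
proof
  show "smooth_on S (\<lambda>z. zero_form (f z) vs)" for vs
    using assms by (cases vs) (auto simp: zero_form_def smooth_on_const)
qed

text \<open>
  The powers of \<open>W\<close> are closed for both operators, so they behave like constants.
\<close>

lemma second_deriv_wedge_pow:
  assumes S: "open S" and f: "smooth_on S f" and W: "components_smooth S W"
    and closed: "\<And>z. z \<in> S \<Longrightarrow> local_deriv (wdir p q) W z = 0"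
      "\<And>z. z \<in> S \<Longrightarrow> local_deriv (wdir p' q') W z = 0" and z: "z \<in> S"
  shows "local_deriv (wdir p q) (local_deriv (wdir p' q') (\<lambda>z. wedge (zero_form (f z)) (wedge_pow (W z) k))) z =
    wedge (local_deriv (wdir p q) (local_deriv (wdir p' q') (\<lambda>z. zero_form (f z))) z) (wedge_pow (W z) k)"
proof -
  let ?F = "\<lambda>z. zero_form (f z) :: 'a ext" and ?P = "\<lambda>z. wedge_pow (W z) k"
  let ?d = "local_deriv (wdir p q)" and ?d' = "local_deriv (wdir p' q')"
  note F = components_smooth_zero_form[OF S f]
  note P = components_smooth_pow[OF S W, of k]
  note cd = components_smooth_differentiable
  have "?d' (\<lambda>z. wedge (?F z) (?P z)) y = wedge (?d' ?F y) (?P y)" if "y \<in> S" for y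
    using local_deriv_wedge[OF cd[OF F that] cd[OF P that], of p' q']
      local_deriv_pow_closed[OF cd[OF W that] closed(2)[OF that], of k]
    by (simp only: wedge_zero_right add_0_right)
  then have "?d (?d' (\<lambda>z. wedge (?F z) (?P z))) z = ?d (\<lambda>y. wedge (?d' ?F y) (?P y)) z"
    by (rule local_deriv_cong_open[OF S z])
  also have "\<dots> = wedge (?d (?d' ?F) z) (?P z)"
    using local_deriv_wedge[OF cd[OF components_smooth_deriv[OF S F] z] cd[OF P z], of p q p' q']
      local_deriv_pow_closed[OF cd[OF W z] closed(1)[OF z], of k]
    by (simp only: wedge_zero_right add_0_right)
  finally show ?thesis .
qed

section \<open>The complex Hessian\<close>

text \<open>
  The real \<open>(1, 1)\<close>-form of the Hermitian part of the quadratic form of \<open>Q\<close>. The formula symmetrises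
  \<open>Q\<close>.
\<close>

definition hess_form :: "(complex ^ 'n \<Rightarrow> complex ^ 'n \<Rightarrow> real) \<Rightarrow> 'n::finite ext" where
  "hess_form Q ws = (if length ws = 2 then let x = ws ! 0; y = ws ! 1 in
     of_real ((Q (\<i> *s x) y + Q y (\<i> *s x) - Q x (\<i> *s y) - Q (\<i> *s y) x) / 4) else 0)"

lemma hess_form_pair: "hess_form Q [x, y] =
    of_real ((Q (\<i> *s x) y + Q y (\<i> *s x) - Q x (\<i> *s y) - Q (\<i> *s y) x) / 4)"
  by (simp add: hess_form_def)

lemma hess_form_real_pp:
  assumes "bilinear Q" shows "real_pp 1 (hess_form Q)"
proof -
  note bs = bilinear_ladd[OF assms] bilinear_radd[OF assms] bilinear_lmul[OF assms]
    bilinear_rmul[OF assms] bilinear_lneg[OF assms] bilinear_rneg[OF assms]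
  have z: "hess_form Q ws = 0" if "length ws \<noteq> 2" for ws using that by (simp add: hess_form_def)
  have "multi_alt (hess_form Q)"
  proof (rule multi_altI)
    show "linear (\<lambda>v. hess_form Q (ps @ v # qs))" for ps qs
    proof -
      consider y where "ps = []" "qs = [y]" | x where "ps = [x]" "qs = []" | "length (ps @ undefined # qs) \<noteq> 2"
        by (cases ps; cases qs; cases "tl ps"; cases "tl qs") auto
      then show ?thesis
      proof cases
        case 3
        then have "(\<lambda>v. hess_form Q (ps @ v # qs)) = (\<lambda>v. 0)" by (intro ext z) simp
        then show ?thesis by (simp add: linear_zero_map)
      qed (auto intro!: linearI simp: hess_form_pair vec_ii_simps bs complex_eq_iff field_simps)
    qed
    show "hess_form Q (ps @ v # v # qs) = 0" for ps v qs
      by (cases "ps = [] \<and> qs = []") (auto simp: hess_form_pair intro!: z)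
  qed
  moreover have "hess_form Q (map (\<lambda>v. \<i> *s v) us) = hess_form Q us" for us
  proof (cases "length us = 2")
    case True
    then obtain x y where "us = [x, y]" by (auto simp: numeral_2_eq_2 length_Suc_conv)
    then show ?thesis by (simp add: hess_form_pair bs)
  qed (simp add: z)
  moreover have "ext_cnj (hess_form Q) = hess_form Q"
    by (auto simp: ext_cnj_def hess_form_def fun_eq_iff Let_def)
  ultimately show ?thesis by (auto simp: real_pp_def alt_form_iff has_degree_def z)
qed

lemma herm_hess_form:
  assumes "bilinear Q"
  shows "herm (hess_form Q) x (\<i> *s x) = (Q x x + Q (\<i> *s x) (\<i> *s x)) / 2"
  by (simp add: herm_def hess_form_pair bilinear_lneg[OF assms] bilinear_rneg[OF assms])

text \<open>
  Adding the conjugate removes the part of \<open>i \<partial>\<partial>\<close>-bar \<open>f\<close> that is antisymmetric in the second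
  derivatives of \<open>f\<close>, and what remains is the form of the real Hessian.
\<close>

lemma complex_hessian:
  assumes S: "open S" "z \<in> S" and f: "smooth_on S f" and r: "\<And>y. y \<in> S \<Longrightarrow> Im (f y) = 0"
  defines "H \<equiv> ext_scale \<i> (local_deriv dir_del (local_deriv dir_delbar (\<lambda>z. zero_form (f z))) z)"
    and "Q \<equiv> \<lambda>x y. Re (frechet_derivative (\<lambda>z. frechet_derivative f (at z) y) (at z) x)"
  shows "H + ext_cnj H = ext_scale 2 (hess_form Q)"
proof
  let ?d = "\<lambda>y z. frechet_derivative f (at z) y"
  let ?dd = "\<lambda>x y. frechet_derivative (?d y) (at z) x"
  have sd: "?d y differentiable (at z)" for y
    using smooth_on_differentiable[OF smooth_on_derivative[OF f] S(2)] .
  have real_deriv: "Im (frechet_derivative g (at y) v) = 0"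
    if "smooth_on S g" "\<And>y. y \<in> S \<Longrightarrow> Im (g y) = 0" "y \<in> S" for g y v
  proof -
    have "((\<lambda>y. Im (g y)) has_derivative (\<lambda>v. Im (frechet_derivative g (at y) v))) (at y)"
      using differentiable_has_derivative[OF smooth_on_differentiable[OF that(1,3)]] by (rule has_derivative_Im)
    then have "((\<lambda>y. 0) has_derivative (\<lambda>v. Im (frechet_derivative g (at y) v))) (at y)"
      using has_derivative_cong_open[OF S(1) that(3), of "\<lambda>y. Im (g y)" "\<lambda>y. 0"] that(2) by blast
    from has_derivative_unique[OF this has_derivative_const] show ?thesis by metis
  qed
  have dd: "?dd x y = of_real (Q x y)" for x y
    using real_deriv[OF smooth_on_derivative[OF f] real_deriv[OF f r] S(2)] by (simp add: Q_def complex_eq_iff)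
  have mixed: "wdir p q (\<lambda>z. wdir p' q' f z y) z x =
      p * p' * ?dd x y + p * q' * ?dd x (\<i> *s y) + q * p' * ?dd (\<i> *s x) y + q * q' * ?dd (\<i> *s x) (\<i> *s y)" for p q p' q' x y
  proof -
    have "frechet_derivative (\<lambda>z. wdir p' q' f z y) (at z) x = p' * ?dd x y + q' * ?dd x (\<i> *s y)" for x
      unfolding wdir_def
      by (subst frechet_derivative_eqI[OF has_derivative_add[OF has_derivative_mult_right[OF differentiable_has_derivative[OF sd]]
            has_derivative_mult_right[OF differentiable_has_derivative[OF sd]]]]) simp
    then show ?thesis by (simp add: wdir_def[of p q] algebra_simps)
  qed
  fix ws
  have one: "local_deriv (wdir p q) (\<lambda>z. zero_form (f z)) y [v] = wdir p q f y v" for p q y v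
    by (simp add: local_deriv_Cons local_deriv_Nil zero_form_def)
  have zero1: "local_deriv (wdir p q) (\<lambda>z. zero_form (f z)) y vs = 0" if "length vs \<noteq> 1" for p q y vs
    unfolding local_deriv_def
  proof (intro sum.neutral ballI)
    fix i assume "i \<in> {..<length vs}"
    then have "length (take i vs @ drop (Suc i) vs) \<noteq> 0" using that by (simp; linarith)
    then have "take i vs @ drop (Suc i) vs \<noteq> []" by (metis list.size(3))
    then have "zero_form t (take i vs @ drop (Suc i) vs) = 0" for t unfolding zero_form_def by (rule if_not_P)
    then show "(-1) ^ i * wdir p q (\<lambda>z. zero_form (f z) (take i vs @ drop (Suc i) vs)) y (vs ! i) = 0" by simp
  qed
  show "(H + ext_cnj H) ws = ext_scale 2 (hess_form Q) ws"
  proof (cases "length ws = 2")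
    case True
    then obtain x y where ws: "ws = [x, y]" by (auto simp: numeral_2_eq_2 length_Suc_conv)
    have "local_deriv dir_del (local_deriv dir_delbar (\<lambda>z. zero_form (f z))) z [x, y] =
       wdir (1/2) (- \<i> / 2) (\<lambda>z. wdir (1/2) (\<i> / 2) f z y) z x - wdir (1/2) (- \<i> / 2) (\<lambda>z. wdir (1/2) (\<i> / 2) f z x) z y"
      by (simp add: dir_wdir local_deriv_Cons local_deriv_Nil contract_def) (simp add: zero_form_def)
    then show ?thesis
      unfolding ws H_def by (simp add: mixed dd ext_scale_def ext_cnj_def hess_form_pair complex_eq_iff field_simps)
  next
    case False
    have "local_deriv dir_del (local_deriv dir_delbar (\<lambda>z. zero_form (f z))) z ws = 0"
      unfolding dir_wdir local_deriv_def[of "wdir (1/2) (- \<i> / 2)"]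
      using False by (intro sum.neutral ballI) (subst zero1, auto)
    then show ?thesis using False by (simp add: H_def ext_scale_def ext_cnj_def hess_form_def)
  qed
qed

section \<open>Continuous dependence of the star on the point\<close>

definition components_continuous :: "'z::topological_space set \<Rightarrow> ('z \<Rightarrow> 'n::finite ext) \<Rightarrow> bool" where
  "components_continuous S a \<longleftrightarrow> (\<forall>vs. continuous_on S (\<lambda>z. a z vs))"

lemma components_continuous_wedge:
  "components_continuous S a \<Longrightarrow> components_continuous S b \<Longrightarrow> components_continuous S (\<lambda>z. wedge (a z) (b z))"
  unfolding components_continuous_def wedge_def by (intro allI continuous_intros) auto

lemma components_continuous_const: "components_continuous S (\<lambda>z. a)"
  by (simp add: components_continuous_def)

lemma components_continuous_pow:
  "components_continuous S a \<Longrightarrow> components_continuous S (\<lambda>z. wedge_pow (a z) k)"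
  by (induction k) (simp_all add: components_continuous_wedge components_continuous_const)

lemma components_continuous_scale:
  "components_continuous S a \<Longrightarrow> components_continuous S (\<lambda>z. ext_scale c (a z))"
  unfolding components_continuous_def ext_scale_def by (intro allI continuous_intros) auto

lemma components_continuous_telescope:
  assumes "components_continuous S a" "components_continuous S b"
  shows "components_continuous S (\<lambda>z. telescope n (a z) (b z))"
proof -
  have "components_continuous S (\<lambda>z. wedge (wedge_pow (a z) k) (wedge_pow (b z) (n - 1 - k)))" for k
    by (intro components_continuous_wedge components_continuous_pow assms)
  then show ?thesis
    unfolding components_continuous_def telescope_def sum_ext_apply by (intro allI continuous_on_sum) blast
qed

lemma components_smooth_continuous: "components_smooth S U \<Longrightarrow> components_continuous S U"
  by (simp add: components_smooth_def components_continuous_def smooth_on_continuous)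

text \<open>
  The components of \<open>a\<close> are continuous for constant arguments; multilinearity extends this to
  arguments that vary with the point.
\<close>

lemma continuous_on_multi_alt:
  assumes "\<And>z. z \<in> S \<Longrightarrow> multi_alt (a z)" "components_continuous S a"
    and "\<And>f. f \<in> set fs \<Longrightarrow> continuous_on S f"
  shows "continuous_on S (\<lambda>z. a z (map (\<lambda>f. f z) fs))"
  using assms
proof (induction fs arbitrary: a)
  case Nil
  then show ?case by (simp add: components_continuous_def)
next
  case (Cons f fs)
  have IH: "continuous_on S (\<lambda>z. contract b (a z) (map (\<lambda>f. f z) fs))" for b
  proof (rule Cons.IH)
    show "multi_alt (contract b (a z))" if "z \<in> S" for z by (rule multi_alt_contract[OF Cons.prems(1)[OF that]])
    show "components_continuous S (\<lambda>z. contract b (a z))"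
      using Cons.prems(2) by (simp add: components_continuous_def contract_def)
  qed (use Cons.prems(3) in simp)
  have "continuous_on S (\<lambda>z. \<Sum>b\<in>Basis. (f z \<bullet> b) *\<^sub>R contract b (a z) (map (\<lambda>f. f z) fs))"
    using Cons.prems by (intro continuous_intros IH) auto
  moreover have "a z (map (\<lambda>f. f z) (f # fs)) = (\<Sum>b\<in>Basis. (f z \<bullet> b) *\<^sub>R contract b (a z) (map (\<lambda>f. f z) fs))"
    if "z \<in> S" for z
  proof -
    have lin: "linear (\<lambda>v. a z (v # map (\<lambda>f. f z) fs))"
      using multi_alt_linear[OF Cons.prems(1)[OF that], of "[]"] by simp
    have "a z (f z # map (\<lambda>f. f z) fs) = a z ((\<Sum>b\<in>Basis. (f z \<bullet> b) *\<^sub>R b) # map (\<lambda>f. f z) fs)"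
      by (simp add: euclidean_representation)
    also have "\<dots> = (\<Sum>b\<in>Basis. (f z \<bullet> b) *\<^sub>R a z (b # map (\<lambda>f. f z) fs))"
      by (simp only: linear_sum[OF lin] linear_scale[OF lin])
    finally show ?thesis by (simp add: contract_def)
  qed
  ultimately show ?case by (simp cong: continuous_on_cong)
qed

text \<open>
  In a continuous orthonormal frame the star is given by a formula with continuous entries, and
  the star does not depend on the frame.
\<close>

lemma components_continuous_star:
  fixes W :: "'z::topological_space \<Rightarrow> 'n::finite ext"
  assumes w: "\<And>z. z \<in> S \<Longrightarrow> hermitian (W z)" and Wc: "components_continuous S W"
    and b: "\<And>z. z \<in> S \<Longrightarrow> alt_form k (b z)" "components_continuous S b" and k: "k \<le> 2 * CARD('n)"
  shows "components_continuous S (\<lambda>z. hodge_star_at (W z) k (b z))"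
proof -
  obtain es :: "(complex ^ 'n) list" where es: "set es = Basis" "distinct es"
    using finite_distinct_list[OF finite_Basis] by blast
  have len: "length es = 2 * CARD('n)"
  proof -
    have "length es = DIM(complex ^ 'n)" using distinct_card[OF es(2)] es(1) by simp
    then show ?thesis by simp
  qed
  have mc: "continuous_on S (\<lambda>z. metric (W z) x y)" for x y
    unfolding metric_def using Wc by (auto simp: components_continuous_def intro!: continuous_intros)
  obtain fs where fs: "length fs = length es" "\<And>f. f \<in> set fs \<Longrightarrow> continuous_on S f"
    "\<And>z. z \<in> S \<Longrightarrow> orthonormal (metric (W z)) (map (\<lambda>f. f z) fs)"
    using continuous_orthonormal_frame[of S "\<lambda>z. metric (W z)" es, OF hermitian_inner_form[OF w] mc es(2)]
    by (auto simp: es(1) independent_Basis)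
  have vc: "components_continuous S (\<lambda>z. vol_at (W z))"
    unfolding vol_at_def divided_pow_def by (intro components_continuous_scale components_continuous_pow Wc)
  have vm: "multi_alt (vol_at (W z))" if "z \<in> S" for z
    using real_pp_vol[OF w[OF that]] by (simp add: real_pp_def alt_form_iff)
  have "continuous_on S (\<lambda>z. frame_star (vol_at (W z)) (map (\<lambda>f. f z) fs) (b z) ws)" for ws
  proof -
    have "continuous_on S (\<lambda>z. b z (map (\<lambda>f. f z) (nths fs T)))" for T
      using b fs(2) set_nths_subset[of fs T] by (intro continuous_on_multi_alt) (auto simp: alt_form_iff)
    moreover have "continuous_on S (\<lambda>z. vol_at (W z) (map (\<lambda>f. f z) (nths fs T @ map (\<lambda>v z. v) ws)))" for T
      using vm vc fs(2) set_nths_subset[of fs T] by (intro continuous_on_multi_alt) auto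
    then have "continuous_on S (\<lambda>z. vol_at (W z) (map (\<lambda>f. f z) (nths fs T) @ ws))" for T
      by (simp add: o_def)
    ultimately show ?thesis
      unfolding frame_star_def pairing_def by (auto simp: nths_map intro!: continuous_intros)
  qed
  moreover have "hodge_star_at (W z) k (b z) = frame_star (vol_at (W z)) (map (\<lambda>f. f z) fs) (b z)" if "z \<in> S" for z
    using fs(1) len by (intro hodge_star_at_eq_frame_star w fs(3) b(1) k that) simp
  ultimately show ?thesis unfolding components_continuous_def by (simp cong: continuous_on_cong)
qed

lemma hodge_star_at_linear:
  fixes w :: "'n::finite ext"
  assumes w: "hermitian w" and k: "k \<le> 2 * CARD('n)"
  shows "alt_form k a \<Longrightarrow> alt_form k b \<Longrightarrow> hodge_star_at w k (a - b) = hodge_star_at w k a - hodge_star_at w k b"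
    and "(\<And>i. i \<in> I \<Longrightarrow> alt_form k (g i)) \<Longrightarrow>
      hodge_star_at w k (\<Sum>i\<in>I. ext_scale (c i) (g i)) = (\<Sum>i\<in>I. ext_scale (c i) (hodge_star_at w k (g i)))"
    and "alt_form k a \<Longrightarrow> hodge_star_at w k (ext_scale d a) = ext_scale d (hodge_star_at w k a)"
proof -
  obtain us where us: "length us = CARD('n)" "orthonormal (metric w) (pairs us)"
    using unitary_frame_exists[OF w] .
  have st: "hodge_star_at w k a = frame_star (vol_at w) (pairs us) a" if "alt_form k a" for a
    using us by (intro hodge_star_at_eq_frame_star[OF w _ _ that k]) auto
  let ?s = "frame_star (vol_at w) (pairs us)"
  have lin: "?s (a + b) = ?s a + ?s b" "?s (ext_scale c a) = ext_scale c (?s a)" "?s 0 = 0" for a b c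
    by (simp_all add: frame_star_def pairing_left fun_eq_iff) (simp add: ext_scale_def frame_star_def)
  show scale: "alt_form k a \<Longrightarrow> hodge_star_at w k (ext_scale d a) = ext_scale d (hodge_star_at w k a)" for a d
    by (simp add: st alt_form_closed lin)
  show "hodge_star_at w k (a - b) = hodge_star_at w k a - hodge_star_at w k b" if "alt_form k a" "alt_form k b"
  proof -
    have "?s (a - b) + ?s b = ?s a" unfolding lin(1)[symmetric] by (simp only: diff_add_cancel)
    then show ?thesis unfolding st[OF that(1)] st[OF that(2)] st[OF alt_form_closed(3)[OF that]]
      by (simp only: eq_diff_eq)
  qed
  show "hodge_star_at w k (\<Sum>i\<in>I. ext_scale (c i) (g i)) = (\<Sum>i\<in>I. ext_scale (c i) (hodge_star_at w k (g i)))"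
    if "\<And>i. i \<in> I \<Longrightarrow> alt_form k (g i)"
  proof -
    have "?s (\<Sum>i\<in>I. ext_scale (c i) (g i)) = (\<Sum>i\<in>I. ext_scale (c i) (?s (g i)))"
      by (induction I rule: infinite_finite_induct) (simp_all only: sum.infinite sum.empty sum.insert lin not_False_eq_True)
    then show ?thesis using that
      by (simp add: st alt_form_sum alt_form_closed cong: sum.cong)
  qed
qed

section \<open>The linearised equation in a chart\<close>

text \<open>
  With this expansion the coefficients of the linearised operator are its values on the products
  of coordinate functions.
\<close>

lemma hess_form_expand:
  assumes "bilinear Q"
  shows "hess_form Q = (\<Sum>(a, b)\<in>Basis \<times> Basis. ext_scale (of_real (Q a b)) (hess_form (\<lambda>x y. (x \<bullet> a) * (y \<bullet> b))))"
proof
  fix ws :: "(complex ^ 'a) list"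
  have Q: "Q x y = (\<Sum>(a, b)\<in>Basis \<times> Basis. Q a b * ((x \<bullet> a) * (y \<bullet> b)))" for x y
  proof -
    have "Q x y = Q (\<Sum>a\<in>Basis. (x \<bullet> a) *\<^sub>R a) (\<Sum>b\<in>Basis. (y \<bullet> b) *\<^sub>R b)"
      by (simp add: euclidean_representation)
    also have "\<dots> = (\<Sum>(a, b)\<in>Basis \<times> Basis. Q ((x \<bullet> a) *\<^sub>R a) ((y \<bullet> b) *\<^sub>R b))"
      by (rule bilinear_sum[OF assms])
    finally show ?thesis by (simp add: bilinear_lmul[OF assms] bilinear_rmul[OF assms] mult_ac)
  qed
  show "hess_form Q ws = (\<Sum>(a, b)\<in>Basis \<times> Basis. ext_scale (of_real (Q a b)) (hess_form (\<lambda>x y. (x \<bullet> a) * (y \<bullet> b)))) ws"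
  proof (cases "length ws = 2")
    case True
    then obtain x y where ws: "ws = [x, y]" by (auto simp: numeral_2_eq_2 length_Suc_conv)
    let ?t = "\<lambda>a b. ((\<i> *s x) \<bullet> a) * (y \<bullet> b) + (y \<bullet> a) * ((\<i> *s x) \<bullet> b)
        - (x \<bullet> a) * ((\<i> *s y) \<bullet> b) - ((\<i> *s y) \<bullet> a) * (x \<bullet> b)"
    have "(\<Sum>(a, b)\<in>Basis \<times> Basis. Q a b * ?t a b / 4) = (\<Sum>(a, b)\<in>Basis \<times> Basis. Q a b * ?t a b) / 4"
      by (simp add: case_prod_beta sum_divide_distrib)
    also have "(\<Sum>(a, b)\<in>Basis \<times> Basis. Q a b * ?t a b) =
        Q (\<i> *s x) y + Q y (\<i> *s x) - Q x (\<i> *s y) - Q (\<i> *s y) x"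
      unfolding Q[of "\<i> *s x" y] Q[of y "\<i> *s x"] Q[of x "\<i> *s y"] Q[of "\<i> *s y" x]
      by (simp only: case_prod_unfold distrib_left right_diff_distrib sum.distrib sum_subtractf)
    finally have "hess_form Q ws = of_real (\<Sum>(a, b)\<in>Basis \<times> Basis. Q a b * ?t a b / 4)"
      unfolding ws hess_form_pair by (simp only:)
    also have "\<dots> = (\<Sum>(a, b)\<in>Basis \<times> Basis. ext_scale (of_real (Q a b)) (hess_form (\<lambda>x y. (x \<bullet> a) * (y \<bullet> b)))) ws"
      unfolding sum_ext_apply case_prod_beta ext_scale_def ws hess_form_pair of_real_sum
      by (intro sum.cong refl) simp
    finally show ?thesis .
  next
    case False
    then show ?thesis unfolding sum_ext_apply case_prod_beta ext_scale_def by (simp add: hess_form_def)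
  qed
qed

lemma bilinear_inner_product: "bilinear (\<lambda>x y. (x \<bullet> a) * (y \<bullet> (b :: 'v::real_inner)))"
  by (auto simp: bilinear_def intro!: linearI simp: inner_add_left algebra_simps)

text \<open>
  The two stars \<open>\<rho>1\<close> and \<open>\<rho>2\<close> have equal \<open>n\<close>-th powers, so \<open>(\<rho>1 - \<rho>2) \<and> R = 0\<close> for their telescoping sum
  \<open>R\<close>. Since \<open>\<rho>1 - \<rho>2\<close> is a multiple of the star of \<open>i \<partial>\<partial>\<close>-bar \<open>f \<and> W^(n-2)\<close>, this is a homogeneous linear
  equation for the Hessian of \<open>f\<close>. It is elliptic with continuous coefficients and has no terms of
  lower order, so the strong maximum principle applies.
\<close>

theorem local_strong_maximum:
  fixes W \<beta>1 \<beta>2 :: "complex ^ 'n \<Rightarrow> 'n::finite ext" and f :: "complex ^ 'n \<Rightarrow> complex"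
  assumes S: "open S" and w: "\<And>z. z \<in> S \<Longrightarrow> hermitian (W z)"
    and m: "1 \<le> m" "m + p = CARD('n) - 1"
    and Wc: "components_continuous S W" and bc: "components_continuous S \<beta>1" "components_continuous S \<beta>2"
    and sp: "\<And>z. z \<in> S \<Longrightarrow> strongly_pos_at m (\<beta>1 z)" "\<And>z. z \<in> S \<Longrightarrow> strongly_pos_at m (\<beta>2 z)"
    and eqn: "\<And>z. z \<in> S \<Longrightarrow>
      wedge_pow (hodge_star_at (W z) (2 * (CARD('n) - 1)) (wedge (\<beta>1 z) (divided_pow (W z) p))) CARD('n) =
      wedge_pow (hodge_star_at (W z) (2 * (CARD('n) - 1)) (wedge (\<beta>2 z) (divided_pow (W z) p))) CARD('n)"
    and diff: "\<And>z. z \<in> S \<Longrightarrow> \<beta>1 z - \<beta>2 z = ext_scale \<i>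
      (wedge (local_deriv dir_del (local_deriv dir_delbar (\<lambda>z. zero_form (f z))) z) (wedge_pow (W z) (m - 1)))"
    and f: "smooth_on S f" "\<And>z. z \<in> S \<Longrightarrow> Im (f z) = 0"
    and max: "\<And>z. z \<in> S \<Longrightarrow> Re (f z) \<le> M" "z0 \<in> S" "Re (f z0) = M"
  shows "\<exists>r>0. \<forall>z\<in>ball z0 r. Re (f z) = M"
proof -
  let ?n = "CARD('n)" let ?k = "2 * (?n - 1)"
  let ?star = "\<lambda>z. hodge_star_at (W z) ?k"
  have n: "?n \<ge> 2" "(m - 1) + p = ?n - 2" "1 + (?n - 2) = ?n - 1" using m by auto
  have k: "?k \<le> 2 * ?n" by simp
  define \<rho>1 \<rho>2 where "\<rho>1 z = ?star z (wedge (\<beta>1 z) (divided_pow (W z) p))"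
    and "\<rho>2 z = ?star z (wedge (\<beta>2 z) (divided_pow (W z) p))" for z
  have r1: "real_pp 1 (\<rho>1 z)" "\<And>v. v \<noteq> 0 \<Longrightarrow> herm (\<rho>1 z) v (\<i> *s v) > 0" if "z \<in> S" for z
    using star_strongly_positive[OF w[OF that] sp(1)[OF that] m(2)] by (simp_all add: \<rho>1_def)
  have r2: "real_pp 1 (\<rho>2 z)" "\<And>v. v \<noteq> 0 \<Longrightarrow> herm (\<rho>2 z) v (\<i> *s v) > 0" if "z \<in> S" for z
    using star_strongly_positive[OF w[OF that] sp(2)[OF that] m(2)] by (simp_all add: \<rho>2_def)
  define R where "R z = telescope ?n (\<rho>1 z) (\<rho>2 z)" for z
  obtain us0 where us0: "length us0 = ?n" "orthonormal (metric (W z0)) (pairs us0)"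
    using unitary_frame_exists[OF w[OF max(2)]] .
  have F: "distinct (pairs us0)" "span (set (pairs us0)) = UNIV"
    using orthonormal_distinct_independent[OF hermitian_inner_form[OF w[OF max(2)]] us0(2)]
      orthonormal_spanning[OF hermitian_inner_form[OF w[OF max(2)]] us0(2)] us0(1) by auto
  define Lop where "Lop z h = wedge (?star z (wedge h (wedge_pow (W z) (?n - 2)))) (R z) (pairs us0)" for z h
  define A where "A z a b = Re (Lop z (hess_form (\<lambda>x y. (x \<bullet> a) * (y \<bullet> b))))" for z a b
  have Wreal: "real_pp 1 (W z)" if "z \<in> S" for z using hermitian_real_pp[OF w[OF that]] .
  have hW_alt: "alt_form ?k (wedge h (wedge_pow (W z) (?n - 2)))" if "z \<in> S" "real_pp 1 h" for z h
    using real_pp_wedge[OF that(2) real_pp_pow[OF Wreal[OF that(1)], of "?n - 2"]] unfolding n(3) real_pp_def by blast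
  have b_real: "real_pp (?n - 1) (wedge (\<beta>1 z) (divided_pow (W z) p))"
      "real_pp (?n - 1) (wedge (\<beta>2 z) (divided_pow (W z) p))" if "z \<in> S" for z
    using real_pp_wedge[OF real_forms_at_real_pp[OF strongly_pos_at_real[OF sp(1)[OF that]]] real_pp_divided_pow[OF w[OF that], of p]]
      real_pp_wedge[OF real_forms_at_real_pp[OF strongly_pos_at_real[OF sp(2)[OF that]]] real_pp_divided_pow[OF w[OF that], of p]] m(2)
    by simp_all
  have b_alt: "alt_form ?k (wedge (\<beta>1 z) (divided_pow (W z) p))" "alt_form ?k (wedge (\<beta>2 z) (divided_pow (W z) p))"
    if "z \<in> S" for z using b_real[OF that] unfolding real_pp_def by blast+
  have contr: "contraction (A z) Q = Re (Lop z (hess_form Q))" if z: "z \<in> S" and Q: "bilinear Q" for z Q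
  proof -
    have "Lop z (hess_form Q) = (\<Sum>ab\<in>Basis \<times> Basis. of_real (Q (fst ab) (snd ab)) * Lop z (hess_form (\<lambda>x y. (x \<bullet> fst ab) * (y \<bullet> snd ab))))"
    proof -
      have alt: "alt_form ?k (wedge (hess_form (\<lambda>x y. (x \<bullet> fst ab) * (y \<bullet> snd ab))) (wedge_pow (W z) (?n - 2)))"
        for ab :: "(complex ^ 'n) \<times> (complex ^ 'n)"
        by (intro hW_alt[OF z] hess_form_real_pp bilinear_inner_product)
      show ?thesis
        unfolding Lop_def hess_form_expand[OF Q] case_prod_beta wedge_sum_left wedge_scale_left
          hodge_star_at_linear(2)[OF w[OF z] k alt] sum_ext_apply
        by (simp only: ext_scale_def)
    qed
    then have "Re (Lop z (hess_form Q)) = (\<Sum>ab\<in>Basis \<times> Basis. Q (fst ab) (snd ab) * A z (fst ab) (snd ab))"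
      by (simp add: A_def)
    also have "\<dots> = contraction (A z) Q"
      unfolding contraction_def sum.cartesian_product by (simp add: case_prod_beta mult.commute)
    finally show ?thesis ..
  qed
  define f1 where "f1 z y = Re (frechet_derivative f (at z) y)" for z y
  define f2 where "f2 z x y = Re (frechet_derivative (\<lambda>z. frechet_derivative f (at z) y) (at z) x)" for z x y
  have f1: "((\<lambda>z. Re (f z)) has_derivative f1 z) (at z)" if "z \<in> S" for z
    unfolding f1_def using differentiable_has_derivative[OF smooth_on_differentiable[OF f(1) that]]
    by (rule has_derivative_Re)
  have f2: "((\<lambda>z. f1 z y) has_derivative (\<lambda>x. f2 z x y)) (at z)" if "z \<in> S" for z y
    unfolding f1_def f2_def
    using differentiable_has_derivative[OF smooth_on_differentiable[OF smooth_on_derivative[OF f(1)] that]]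
    by (rule has_derivative_Re)
  have f2_bil: "bilinear (f2 z)" if "z \<in> S" for z
    by (rule bilinear_second_derivative[OF S that has_derivative_linear[OF f1] f2[OF that]])
  have pde: "Lop z (hess_form (f2 z)) = 0" if z: "z \<in> S" for z
  proof -
    define H where "H = ext_scale \<i> (local_deriv dir_del (local_deriv dir_delbar (\<lambda>z. zero_form (f z))) z)"
    define b where "b = wedge (\<beta>1 z) (divided_pow (W z) p) - wedge (\<beta>2 z) (divided_pow (W z) p)"
    let ?V = "wedge (wedge_pow (W z) (m - 1)) (divided_pow (W z) p)"
    have HH: "H + ext_cnj H = ext_scale 2 (hess_form (f2 z))"
      unfolding H_def f2_def using complex_hessian[OF S z f] .
    have V: "?V = ext_scale (1 / fact p) (wedge_pow (W z) (?n - 2))"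
      unfolding divided_pow_def wedge_scale_right wedge_pow_add[symmetric] n(2) ..
    have bH: "b = wedge H ?V"
      unfolding b_def H_def wedge_diff_left[symmetric] diff[OF z] by (simp add: wedge_scale_left wedge_assoc)
    have "ext_cnj ?V = ?V"
      using real_pp_wedge[OF real_pp_pow[OF Wreal[OF z], of "m - 1"] real_pp_divided_pow[OF w[OF z], of p]]
      by (simp add: real_pp_def)
    then have "ext_cnj b = wedge (ext_cnj H) ?V" unfolding bH cnj_wedge by simp
    moreover have "real_pp (?n - 1) b"
      unfolding b_def by (intro real_pp_closed b_real z)
    \<comment> \<open>The left-hand side of the equation is real, so only the real part of \<open>H\<close> enters.\<close>
    ultimately have "b + b = wedge (H + ext_cnj H) ?V"
      unfolding wedge_add_left bH[symmetric] by (simp add: real_pp_def)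
    then have "ext_scale 2 b = ext_scale 2 (wedge (hess_form (f2 z)) ?V)"
      unfolding HH wedge_scale_left by (simp add: ext_scale_def fun_eq_iff)
    then have "ext_scale (1/2) (ext_scale 2 b) = ext_scale (1/2) (ext_scale 2 (wedge (hess_form (f2 z)) ?V))"
      by (simp only:)
    then have "b = wedge (hess_form (f2 z)) ?V" by (simp add: ext_scale_simps)
    then have b: "b = ext_scale (1 / fact p) (wedge (hess_form (f2 z)) (wedge_pow (W z) (?n - 2)))"
      unfolding V wedge_scale_right .
    have "\<rho>1 z - \<rho>2 z = ?star z b"
      unfolding \<rho>1_def \<rho>2_def b_def using b_real[OF z]
      by (intro hodge_star_at_linear(1)[OF w[OF z] k, symmetric]) (auto simp: real_pp_def)
    also have "\<dots> = ext_scale (1 / fact p) (?star z (wedge (hess_form (f2 z)) (wedge_pow (W z) (?n - 2))))"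
      unfolding b by (intro hodge_star_at_linear(3)[OF w[OF z] k] hW_alt z hess_form_real_pp f2_bil)
    finally have d: "\<rho>1 z - \<rho>2 z = ext_scale (1 / fact p) (?star z (wedge (hess_form (f2 z)) (wedge_pow (W z) (?n - 2))))" .
    have "wedge (\<rho>1 z - \<rho>2 z) (R z) = wedge_pow (\<rho>1 z) ?n - wedge_pow (\<rho>2 z) ?n"
      unfolding R_def telescope_def
      by (rule wedge_pow_diff[symmetric]) (use real_pp_twist r1 r2 z in blast)+
    also have "\<dots> = 0" using eqn[OF z] by (simp only: \<rho>1_def \<rho>2_def diff_self)
    finally have "(1 / fact p) * Lop z (hess_form (f2 z)) = 0"
      unfolding d wedge_scale_left Lop_def by (simp add: ext_scale_def fun_eq_iff)
    then show ?thesis by simp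
  qed
  have Ac: "continuous_on S (\<lambda>z. A z a b)" for a b
  proof -
    have "components_continuous S (\<lambda>z. wedge (hess_form (\<lambda>x y. (x \<bullet> a) * (y \<bullet> b))) (wedge_pow (W z) (?n - 2)))"
      by (intro components_continuous_wedge components_continuous_const components_continuous_pow Wc)
    then have 1: "components_continuous S (\<lambda>z. ?star z (wedge (hess_form (\<lambda>x y. (x \<bullet> a) * (y \<bullet> b))) (wedge_pow (W z) (?n - 2))))"
      by (intro components_continuous_star[OF w Wc _ _ k] hW_alt hess_form_real_pp bilinear_inner_product)
    have dc: "components_continuous S (\<lambda>z. divided_pow (W z) p)"
      unfolding divided_pow_def by (intro components_continuous_scale components_continuous_pow Wc)
    have "components_continuous S \<rho>1" "components_continuous S \<rho>2"
      unfolding \<rho>1_def \<rho>2_def using b_alt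
      by (intro components_continuous_star[OF w Wc _ _ k] components_continuous_wedge bc dc; blast)+
    then have "components_continuous S R"
      unfolding R_def by (intro components_continuous_telescope)
    with 1 have "components_continuous S (\<lambda>z. wedge (?star z (wedge (hess_form (\<lambda>x y. (x \<bullet> a) * (y \<bullet> b))) (wedge_pow (W z) (?n - 2)))) (R z))"
      by (intro components_continuous_wedge)
    then show ?thesis
      unfolding A_def Lop_def by (auto simp: components_continuous_def intro!: continuous_intros)
  qed
  show ?thesis
  proof (rule strong_maximum_principle[OF S f1 f2 Ac _ _ _ max])
    fix z assume z: "z \<in> S"
    have her: "herm (hess_form Q) v (\<i> *s v) \<ge> 0" if "bilinear Q" "\<And>x. Q x x \<ge> 0" for Q v
      using that by (simp add: herm_hess_form)
    show "contraction (A z) Q \<ge> 0" if Q: "bilinear Q" "\<And>x. Q x x \<ge> 0" for Q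
      unfolding contr[OF z Q(1)] Lop_def R_def
      using linearised_operator_pos(1)[OF w[OF z] n(1) r1[OF z] r2[OF z] hess_form_real_pp[OF Q(1)] her[OF Q] F us0(1)] by simp
    show "contraction (A z) (\<lambda>x y. (\<xi> \<bullet> x) * (\<xi> \<bullet> y)) > 0" if "\<xi> \<noteq> 0" for \<xi>
    proof -
      let ?Q = "\<lambda>x y. (\<xi> \<bullet> x) * (\<xi> \<bullet> y)"
      have Q: "bilinear ?Q" "\<And>x. ?Q x x \<ge> 0"
        using bilinear_inner_product[of \<xi> \<xi>] by (simp_all add: inner_commute)
      have "\<xi> \<bullet> \<xi> > 0" using that by simp
      then have "herm (hess_form ?Q) \<xi> (\<i> *s \<xi>) > 0"
        by (simp add: herm_hess_form[OF Q(1)] add_pos_nonneg)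
      then show ?thesis
        unfolding contr[OF z Q(1)] Lop_def R_def
        using linearised_operator_pos(2)[OF w[OF z] n(1) r1[OF z] r2[OF z] hess_form_real_pp[OF Q(1)] her[OF Q] F us0(1)] by simp
    qed
    show "contraction (A z) (f2 z) \<ge> 0"
      unfolding contr[OF z f2_bil[OF z]] pde[OF z] by simp
  qed
qed

section \<open>Uniqueness on the compact manifold\<close>

lemma chart_inverse:
  assumes "is_chart X c"
  shows "x \<in> fst c \<Longrightarrow> chart_inv c (snd c x) = x"
    and "z \<in> snd c ` fst c \<Longrightarrow> chart_inv c z \<in> fst c"
    and "z \<in> snd c ` fst c \<Longrightarrow> snd c (chart_inv c z) = z"
    and "open (snd c ` fst c)"
    and "openin X (fst c)"
    and "continuous_map (subtopology X (fst c)) euclidean (snd c)"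
proof -
  have hm: "homeomorphic_map (subtopology X (fst c)) (top_of_set (snd c ` fst c)) (snd c)"
    and o: "openin X (fst c)" and op: "open (snd c ` fst c)"
    using assms by (auto simp: is_chart_def)
  have ts: "topspace (subtopology X (fst c)) = fst c"
    using openin_subset[OF o] by auto
  have "inj_on (snd c) (fst c)"
    using homeomorphic_imp_injective_map[OF hm] ts by simp
  then show "x \<in> fst c \<Longrightarrow> chart_inv c (snd c x) = x" by (simp add: chart_inv_def)
  show "z \<in> snd c ` fst c \<Longrightarrow> chart_inv c z \<in> fst c" by (simp add: chart_inv_def inv_into_into)
  show "z \<in> snd c ` fst c \<Longrightarrow> snd c (chart_inv c z) = z" by (simp add: chart_inv_def f_inv_into_f)
  show "open (snd c ` fst c)" "openin X (fst c)" by (rule op, rule o)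
  show "continuous_map (subtopology X (fst c)) euclidean (snd c)"
    using homeomorphic_imp_continuous_map[OF hm] by (simp add: continuous_map_in_subtopology)
qed

text \<open>
  On a compact space the maximum is attained, and the set where it is attained is closed and, by
  hypothesis, open.
\<close>

lemma constant_by_local_maximum:
  assumes X: "compact_space X" "connected_space X"
    and F: "continuous_map X euclideanreal F"
    and loc: "\<And>x M. x \<in> topspace X \<Longrightarrow> F x = M \<Longrightarrow> (\<And>y. y \<in> topspace X \<Longrightarrow> F y \<le> M) \<Longrightarrow>
       \<exists>V. openin X V \<and> x \<in> V \<and> (\<forall>y\<in>V. F y = M)"
  shows "\<exists>C. \<forall>x\<in>topspace X. F x = C"
proof (cases "topspace X = {}")
  case False
  have "compact (F ` topspace X)"
    using image_compactin[OF _ F, of "topspace X"] X(1) by (simp add: compact_space_def)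
  then obtain x0 where x0: "x0 \<in> topspace X" "\<And>y. y \<in> topspace X \<Longrightarrow> F y \<le> F x0"
    using compact_attains_sup[of "F ` topspace X"] False by auto
  define E where "E = {x \<in> topspace X. F x = F x0}"
  have "closedin X E"
    unfolding E_def using closedin_continuous_map_preimage[OF F, of "{F x0}"] by simp
  moreover have "openin X E"
    unfolding openin_subopen[of X E]
  proof
    fix x assume x: "x \<in> E"
    then obtain V where "openin X V" "x \<in> V" "\<forall>y\<in>V. F y = F x0"
      using loc[of x "F x0"] x0 by (auto simp: E_def)
    then show "\<exists>T. openin X T \<and> x \<in> T \<and> T \<subseteq> E"
      using openin_subset[of X V] by (intro exI[of _ V]) (auto simp: E_def)
  qed
  ultimately have "E = topspace X"
    using X(2) x0(1) by (auto simp: connected_space_clopen_in E_def)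
  then show ?thesis by (auto simp: E_def)
qed auto

lemma zero_form_wedge: "wedge (zero_form t) a = ext_scale t a"
proof -
  have "(zero_form t :: 'a ext) = ext_scale t ext_one" by (auto simp: zero_form_def ext_scale_def ext_one_def)
  then show ?thesis by (simp add: wedge_scale_left)
qed

lemma form_deriv_local_deriv: "form_deriv \<delta> u c x = local_deriv \<delta> (in_coords u c) (snd c x)"
  by (simp add: form_deriv_def local_deriv_def fun_eq_iff)

lemma in_coords_second_deriv:
  assumes "is_chart X c" "z \<in> snd c ` fst c"
  shows "in_coords (del (delbar u)) c z = local_deriv dir_del (local_deriv dir_delbar (in_coords u c)) z"
proof -
  note ch = chart_inverse[OF assms(1)]
  have "in_coords (delbar u) c y = local_deriv dir_delbar (in_coords u c) y" if "y \<in> snd c ` fst c" for y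
    unfolding in_coords_def[of "delbar u"] unfolding delbar_def form_deriv_local_deriv ch(3)[OF that] ..
  then have "local_deriv dir_del (in_coords (delbar u) c) z = local_deriv dir_del (local_deriv dir_delbar (in_coords u c)) z"
    unfolding dir_wdir by (intro local_deriv_cong_open[OF ch(4) assms(2)]) (simp add: dir_wdir)
  moreover have "in_coords (del (delbar u)) c z = local_deriv dir_del (in_coords (delbar u) c) (snd c (chart_inv c z))"
    unfolding in_coords_def[of "del (delbar u)"] unfolding del_def form_deriv_local_deriv ..
  ultimately show ?thesis by (simp only: ch(3)[OF assms(2)])
qed

lemma smooth_forms_components:
  assumes "u \<in> smooth_forms A p q" "c \<in> A"
  shows "components_smooth (snd c ` fst c) (in_coords u c)"
  using assms by (auto simp: smooth_forms_def components_smooth_def)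

lemma real_smooth_form_at:
  assumes "u \<in> real_smooth_forms A p" "c \<in> A" "x \<in> fst c"
  shows "u c x \<in> real_forms_at p"
  using assms by (auto simp: real_smooth_forms_def smooth_forms_def real_forms_at_def)

lemma kaehler_hermitian:
  assumes "compact_kaehler X A \<omega>" "c \<in> A" "x \<in> fst c" shows "hermitian (\<omega> c x)"
  using assms by (auto simp: compact_kaehler_def hermitian_def real_smooth_forms_def smooth_forms_def)

lemma kaehler_closed:
  assumes K: "compact_kaehler X A \<omega>" and c: "c \<in> A" and z: "z \<in> snd c ` fst c"
  shows "local_deriv (wdir p q) (in_coords \<omega> c) z = 0"
proof (rule closed_pp_local_deriv)
  have chart: "is_chart X c" using K c by (auto simp: compact_kaehler_def compact_complex_manifold_def)
  note ch = chart_inverse[OF chart]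
  show "open (snd c ` fst c)" by (rule ch)
  show "z \<in> snd c ` fst c" by (rule z)
  show "in_coords \<omega> c y (map (\<lambda>v. \<i> *s v) us) = in_coords \<omega> c y us" if "y \<in> snd c ` fst c" for y us
    using hermitian_real_pp[OF kaehler_hermitian[OF K c ch(2)[OF that]]]
    by (simp add: in_coords_def real_pp_def)
  have "ext_d \<omega> c (chart_inv c z) = 0"
    using K c ch(2)[OF z] by (simp add: compact_kaehler_def form_eq_def)
  then show "local_deriv (wdir 1 0) (in_coords \<omega> c) z = 0"
    unfolding ext_d_def form_deriv_local_deriv ch(3)[OF z] dir_wdir .
qed

text \<open>
  The components of index below \<open>r\<close> cancel, and the component of index \<open>r\<close> is a form of degree zero,
  that is, a number at every point.
\<close>

lemma lefschetz_top_difference: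
  fixes A :: "('a, 'n::finite) chart set"
  assumes L: "lefschetz_decomposition A \<omega> r u1 P1" "lefschetz_decomposition A \<omega> r u2 P2"
    and eq: "\<And>l. l < r \<Longrightarrow> form_eq A (P1 l) (P2 l)" and c: "c \<in> A" "x \<in> fst c"
  shows "u1 c x - u2 c x = ext_scale (P1 r c x [] - P2 r c x []) (wedge_pow (\<omega> c x) r)"
proof -
  have z: "P r c x = zero_form (P r c x [])" if "lefschetz_decomposition A \<omega> r u P" for u P
  proof -
    have "P r c x = 0 \<or> primitive_at (\<omega> c x) (r - r) (r - r) (P r c x)"
    proof -
      have "\<forall>l\<le>r. \<forall>c\<in>A. \<forall>x\<in>fst c. if l + CARD('n) < 2 * r then P l c x = 0
          else primitive_at (\<omega> c x) (r - l) (r - l) (P l c x)"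
        using that unfolding lefschetz_decomposition_def by (rule conjunct1)
      from this[rule_format, OF order_refl c] show ?thesis
        by (cases "r + CARD('n) < 2 * r") (simp_all only: if_True if_False simp_thms)
    qed
    then have "alt_form 0 (P r c x)"
    proof
      assume "P r c x = 0"
      then show ?thesis by (simp only: alt_form_closed(1))
    qed (simp add: primitive_at_def bidegree_def)
    then show ?thesis by (auto simp: alt_form_def zero_form_def fun_eq_iff)
  qed
  have u: "u c x = (\<Sum>l<r. wedge (P l c x) (wedge_pow (\<omega> c x) l)) + ext_scale (P r c x []) (wedge_pow (\<omega> c x) r)"
    if "lefschetz_decomposition A \<omega> r u P" for u P
  proof -
    have "u c x = (\<Sum>l\<le>r. form_wedge (P l) (form_pow \<omega> l)) c x"
      using that c by (simp add: lefschetz_decomposition_def form_eq_def)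
    also have "\<dots> = (\<Sum>l\<le>r. wedge (P l c x) (wedge_pow (\<omega> c x) l))"
      by (simp only: sum_ext_apply form_wedge_def form_pow_def)
    also have "\<dots> = (\<Sum>l<r. wedge (P l c x) (wedge_pow (\<omega> c x) l)) + wedge (P r c x) (wedge_pow (\<omega> c x) r)"
      unfolding lessThan_Suc_atMost[symmetric] sum.lessThan_Suc ..
    also have "wedge (P r c x) (wedge_pow (\<omega> c x) r) = ext_scale (P r c x []) (wedge_pow (\<omega> c x) r)"
      by (subst z[OF that]) (rule zero_form_wedge)
    finally show ?thesis .
  qed
  have s: "(\<Sum>l<r. wedge (P1 l c x) (wedge_pow (\<omega> c x) l)) = (\<Sum>l<r. wedge (P2 l c x) (wedge_pow (\<omega> c x) l))"
    using eq c by (intro sum.cong refl) (simp add: form_eq_def)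
  show ?thesis
    unfolding u[OF L(1)] u[OF L(2)] s
    by (simp only: add_diff_cancel_left) (simp add: ext_scale_def fun_eq_iff algebra_simps)
qed

text \<open>
  The power is at least one on a unitary frame of an \<open>r\<close>-dimensional subspace.
\<close>

lemma pow_nonzero_list:
  fixes w :: "'n::finite ext"
  assumes "hermitian w" "r \<le> CARD('n)"
  obtains vs where "Re (wedge_pow w r vs) > 0"
proof -
  obtain us where us: "length us = CARD('n)" "orthonormal (metric w) (pairs us)"
    using unitary_frame_exists[OF assms(1)] .
  have "pairs us = pairs (take r us) @ pairs (drop r us)" by (simp flip: pairs_simps(3))
  then have "orthonormal (metric w) (pairs (take r us))" using us(2) by (simp add: orthonormal_append)
  from pow_unitary_ge_1[OF assms(1) this] us(1) assms(2) that[of "pairs (take r us)"]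
  show thesis by (simp add: min_absorb2)
qed

theorem theorem3p6:
  fixes X :: "'a topology" and A :: "('a, 'n::finite) chart set"
    and \<omega> dV \<alpha> u1 u2 :: "('a, 'n) form"
    and P1 P2 :: "nat \<Rightarrow> ('a, 'n) form" and m :: nat
  assumes "compact_kaehler X A \<omega>"
    and "1 \<le> m" and "m \<le> CARD('n) - 1"
    and "dV \<in> real_smooth_forms A CARD('n)" and "strongly_positive A CARD('n) dV"
    and "\<alpha> \<in> real_smooth_forms A m" and "form_eq A (ext_d \<alpha>) 0" and "strongly_positive A m \<alpha>"
    and "u1 \<in> real_smooth_forms A (m - 1)" and "u2 \<in> real_smooth_forms A (m - 1)"
    and "form_eq A
      (form_pow (hodge_star \<omega> (2 * (CARD('n) - 1))
         (form_wedge (\<alpha> + form_scale \<i> (del (delbar u1))) (form_divided_pow \<omega> (CARD('n) - m - 1))))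
        CARD('n))
      (form_pow (hodge_star \<omega> (2 * (CARD('n) - 1))
         (form_wedge (\<alpha> + form_scale \<i> (del (delbar u2))) (form_divided_pow \<omega> (CARD('n) - m - 1))))
        CARD('n))"
    and "strongly_positive A m (\<alpha> + form_scale \<i> (del (delbar u1)))"
    and "strongly_positive A m (\<alpha> + form_scale \<i> (del (delbar u2)))"
    and "u1 \<in> ker_del_star A \<omega> (m - 1) (m - 1) \<inter> ker_delbar_star A \<omega> (m - 1) (m - 1)"
    and "u2 \<in> ker_del_star A \<omega> (m - 1) (m - 1) \<inter> ker_delbar_star A \<omega> (m - 1) (m - 1)"
    and "lefschetz_decomposition A \<omega> (m - 1) u1 P1"
    and "lefschetz_decomposition A \<omega> (m - 1) u2 P2"
    and "\<forall>l. l + 2 \<le> m \<longrightarrow> form_eq A (P1 l) (P2 l)"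
  shows "\<exists>C::real. form_eq A u1 (u2 + form_scale (complex_of_real C) (form_pow \<omega> (m - 1)))"
proof -
  note K = assms(1) and m = assms(2,3) and u_real = assms(9,10) and eqn = assms(11)
  let ?r = "m - 1" and ?p = "CARD('n) - m - 1"
  define B1 B2 where "B1 = \<alpha> + form_scale \<i> (del (delbar u1))" and "B2 = \<alpha> + form_scale \<i> (del (delbar u2))"
  define t where "t c x = P1 ?r c x [] - P2 ?r c x []" for c x
  have man: "compact_space X" "connected_space X" "\<And>c. c \<in> A \<Longrightarrow> is_chart X c" "(\<Union>c\<in>A. fst c) = topspace X"
    using K by (auto simp: compact_kaehler_def compact_complex_manifold_def)
  have u_diff: "u1 c x - u2 c x = ext_scale (t c x) (wedge_pow (\<omega> c x) ?r)" if "c \<in> A" "x \<in> fst c" for c x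
    unfolding t_def
    by (rule lefschetz_top_difference[OF assms(16,17) _ that]) (use assms(18) in simp)
  have rn: "?r \<le> CARD('n)" using m by simp
  have t_real: "Im (t c x) = 0" if c: "c \<in> A" "x \<in> fst c" for c x
  proof -
    obtain vs where vs: "Re (wedge_pow (\<omega> c x) ?r vs) > 0"
      using pow_nonzero_list[OF kaehler_hermitian[OF K c] rn] .
    have "Im (u1 c x vs) = 0" "Im (u2 c x vs) = 0" "Im (wedge_pow (\<omega> c x) ?r vs) = 0"
      using real_pp_Im[OF real_forms_at_real_pp[OF real_smooth_form_at[OF u_real(1) c]], of vs]
        real_pp_Im[OF real_forms_at_real_pp[OF real_smooth_form_at[OF u_real(2) c]], of vs]
        real_pp_Im[OF real_pp_pow[OF hermitian_real_pp[OF kaehler_hermitian[OF K c]]], of ?r vs]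
      by (metis Im_complex_of_real)+
    moreover have "u1 c x vs - u2 c x vs = t c x * wedge_pow (\<omega> c x) ?r vs"
      using fun_cong[OF u_diff[OF c], of vs] by (simp add: ext_scale_def)
    ultimately have "0 = Im (t c x) * Re (wedge_pow (\<omega> c x) ?r vs)"
      by (metis diff_zero minus_complex.sel(2) mult_zero_right add_0_left times_complex.sel(2))
    then show ?thesis using vs by simp
  qed
  have t_indep: "t c x = t d x" if c: "c \<in> A" "x \<in> fst c" and d: "d \<in> A" "x \<in> fst d" for c d x
  proof -
    let ?D = "map (frechet_derivative (transition c d) (at (snd c x)))"
    have comp: "u c x vs = u d x (?D vs)" if "u \<in> smooth_forms A p q" for u :: "('a, 'n) form" and p q vs
    proof -
      have "chart_compatible A u" using that by (simp add: smooth_forms_def)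
      then show ?thesis using c d unfolding chart_compatible_def by blast
    qed
    have us: "u1 \<in> smooth_forms A ?r ?r" "u2 \<in> smooth_forms A ?r ?r" "\<omega> \<in> smooth_forms A 1 1"
      using u_real K by (auto simp: real_smooth_forms_def compact_kaehler_def)
    obtain vs where vs: "Re (wedge_pow (\<omega> c x) ?r vs) > 0"
      using pow_nonzero_list[OF kaehler_hermitian[OF K c] rn] .
    have "wedge_pow (\<omega> d x) ?r (?D vs) = wedge_pow (\<omega> c x) ?r vs"
      unfolding wedge_pow_map comp[OF us(3), symmetric] ..
    then have "t c x * wedge_pow (\<omega> c x) ?r vs = t d x * wedge_pow (\<omega> c x) ?r vs"
      using fun_cong[OF u_diff[OF c], of vs] fun_cong[OF u_diff[OF d], of "?D vs"]
        comp[OF us(1), of vs] comp[OF us(2), of vs] by (simp add: ext_scale_def)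
    then show ?thesis using vs by auto
  qed
  \<comment> \<open>The coefficient does not depend on the chart, so an arbitrary one may be chosen at every point.\<close>
  define F where "F x = Re (t (SOME c. c \<in> A \<and> x \<in> fst c) x)" for x
  have F: "F x = Re (t c x)" if "c \<in> A" "x \<in> fst c" for c x
  proof -
    have "(SOME c. c \<in> A \<and> x \<in> fst c) \<in> A \<and> x \<in> fst (SOME c. c \<in> A \<and> x \<in> fst c)"
      using that by (intro someI[of "\<lambda>c. c \<in> A \<and> x \<in> fst c"]) auto
    then have "t (SOME c. c \<in> A \<and> x \<in> fst c) x = t c x" by (intro t_indep that) simp_all
    then show ?thesis by (simp only: F_def)
  qed
  \<comment> \<open>Where a component of \<open>\<omega>^(m-1)\<close> does not vanish, the coefficient is a quotient of smooth
    functions; so it inherits smoothness from \<open>u1\<close>, \<open>u2\<close> and \<open>\<omega>\<close>.\<close>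
  have local: "\<exists>c S f. c \<in> A \<and> x \<in> fst c \<and> open S \<and> snd c x \<in> S \<and> S \<subseteq> snd c ` fst c \<and> smooth_on S f \<and>
      (\<forall>z\<in>S. f z = t c (chart_inv c z))" if x: "x \<in> topspace X" for x
  proof -
    obtain c where c: "c \<in> A" "x \<in> fst c" using x man(4) by blast
    note ch = chart_inverse[OF man(3)[OF c(1)]]
    let ?O = "snd c ` fst c" and ?W = "in_coords \<omega> c"
    obtain vs where vs: "Re (wedge_pow (\<omega> c x) ?r vs) > 0"
      using pow_nonzero_list[OF kaehler_hermitian[OF K c] rn] .
    have Ws: "components_smooth ?O ?W"
      using K by (intro smooth_forms_components[OF _ c(1)]) (auto simp: compact_kaehler_def real_smooth_forms_def)
    have hs: "smooth_on ?O (\<lambda>z. wedge_pow (?W z) ?r vs)"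
      using components_smooth_pow[OF ch(4) Ws] by (simp add: components_smooth_def)
    define S where "S = {z \<in> ?O. wedge_pow (?W z) ?r vs \<noteq> 0}"
    have "open S"
    proof -
      have "S = ?O \<inter> (\<lambda>z. wedge_pow (?W z) ?r vs) -` (- {0})" by (auto simp: S_def)
      then show ?thesis
        using continuous_open_preimage[OF smooth_on_continuous[OF hs] ch(4), of "- {0}"] by auto
    qed
    have S: "S \<subseteq> ?O" by (auto simp: S_def)
    have "snd c x \<in> S" using vs c ch(1)[OF c(2)] by (auto simp: S_def in_coords_def)
    define f where "f z = (in_coords u1 c z vs - in_coords u2 c z vs) / wedge_pow (?W z) ?r vs" for z
    have us: "smooth_on S (\<lambda>z. in_coords u1 c z vs)" "smooth_on S (\<lambda>z. in_coords u2 c z vs)"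
      using smooth_forms_components[OF _ c(1), of u1 ?r ?r] smooth_forms_components[OF _ c(1), of u2 ?r ?r] u_real
      by (auto simp: real_smooth_forms_def components_smooth_def intro: smooth_on_subset[OF _ S])
    have "smooth_on S f"
      unfolding f_def
      by (intro smooth_on_divide smooth_on_diff us \<open>open S\<close> smooth_on_subset[OF hs S]) (simp add: S_def)
    moreover have "f z = t c (chart_inv c z)" if "z \<in> S" for z
    proof -
      have "in_coords u1 c z vs - in_coords u2 c z vs = t c (chart_inv c z) * wedge_pow (?W z) ?r vs"
        using fun_cong[OF u_diff[OF c(1) ch(2)], of z vs] that S by (auto simp: in_coords_def ext_scale_def)
      then show ?thesis using that by (simp add: f_def S_def)
    qed
    ultimately show ?thesis
      using c \<open>open S\<close> \<open>snd c x \<in> S\<close> S by blast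
  qed
  have nbhd: "openin X {y \<in> fst c. snd c y \<in> T}" if "c \<in> A" "open T" for c T
  proof -
    note ch = chart_inverse[OF man(3)[OF that(1)]]
    have "openin (subtopology X (fst c)) {y \<in> topspace (subtopology X (fst c)). snd c y \<in> T}"
      using openin_continuous_map_preimage[OF ch(6), of T] that(2) by simp
    moreover have "topspace (subtopology X (fst c)) = fst c" using openin_subset[OF ch(5)] by auto
    ultimately have "openin (subtopology X (fst c)) {y \<in> fst c. snd c y \<in> T}" by (simp only:)
    then show ?thesis using openin_trans_full ch(5) by blast
  qed
  have Fcont: "continuous_map X euclideanreal F"
    unfolding continuous_map_atin[of X] 
  proof 
    fix x assume x: "x \<in> topspace X"
    obtain c S f where c: "c \<in> A" "x \<in> fst c" and S: "open S" "snd c x \<in> S" "S \<subseteq> snd c ` fst c"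
      and f: "smooth_on S f" "\<forall>z\<in>S. f z = t c (chart_inv c z)" using local[OF x] by blast
    note ch = chart_inverse[OF man(3)[OF c(1)]]
    have Ff: "F y = Re (f (snd c y))" if "y \<in> fst c" "snd c y \<in> S" for y
      using F[OF c(1) that(1)] f(2) that ch(1)[OF that(1)] by auto
    show "limitin euclideanreal F (F x) (atin X x)"
      unfolding limitin_def
    proof (intro conjI allI impI)
      fix U assume U: "openin euclideanreal U \<and> F x \<in> U"
      have "continuous_on S (\<lambda>z. Re (f z))"
        using smooth_on_continuous[OF f(1)] by (intro continuous_intros)
      then have "open (S \<inter> (\<lambda>z. Re (f z)) -` U)"
        using U S(1) by (intro continuous_open_preimage) auto
      from nbhd[OF c(1) this] show "\<forall>\<^sub>F y in atin X x. F y \<in> U"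
        unfolding eventually_atin using U S(2) Ff c(2)
        by (intro disjI2 exI[of _ "{y \<in> fst c. snd c y \<in> S \<inter> (\<lambda>z. Re (f z)) -` U}"]) auto
    qed simp
  qed
  have "\<exists>C. \<forall>x\<in>topspace X. F x = C"
  proof (rule constant_by_local_maximum[OF man(1,2) Fcont])
    fix x M assume x: "x \<in> topspace X" and M: "F x = M" "\<And>y. y \<in> topspace X \<Longrightarrow> F y \<le> M"
    obtain c S f where c: "c \<in> A" "x \<in> fst c" and S: "open S" "snd c x \<in> S" "S \<subseteq> snd c ` fst c"
      and f: "smooth_on S f" "\<forall>z\<in>S. f z = t c (chart_inv c z)" using local[OF x] by blast
    note ch = chart_inverse[OF man(3)[OF c(1)]]
    let ?O = "snd c ` fst c" and ?W = "in_coords \<omega> c"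
    have inO: "z \<in> ?O" "chart_inv c z \<in> fst c" "snd c (chart_inv c z) = z" if "z \<in> S" for z
      using that S(3) ch(2,3) by blast+
    have ffst: "fst c \<subseteq> topspace X" using openin_subset[OF ch(5)] .
    have Ff: "F y = Re (f (snd c y))" if "y \<in> fst c" "snd c y \<in> S" for y
      using F[OF c(1) that(1)] f(2) that ch(1)[OF that(1)] by auto
    have smooth: "components_smooth ?O ?W" "components_smooth ?O (in_coords \<alpha> c)"
      "components_smooth ?O (in_coords u1 c)" "components_smooth ?O (in_coords u2 c)"
      using K assms(6) u_real smooth_forms_components[OF _ c(1)]
      by (auto simp: compact_kaehler_def real_smooth_forms_def)
    let ?dd = "\<lambda>u. local_deriv dir_del (local_deriv dir_delbar u)"
    have dd_smooth: "components_smooth ?O (?dd (in_coords u c))" if "components_smooth ?O (in_coords u c)" for u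
      unfolding dir_wdir by (intro components_smooth_deriv ch(4) that)
    have B: "in_coords (\<alpha> + form_scale \<i> (del (delbar u))) c z = in_coords \<alpha> c z + ext_scale \<i> (?dd (in_coords u c) z)"
      if "z \<in> ?O" for z u
      using in_coords_second_deriv[OF man(3)[OF c(1)] that, of u]
      by (simp add: in_coords_def form_scale_def plus_fun_def)
    have Bc: "components_continuous S (in_coords (\<alpha> + form_scale \<i> (del (delbar u))) c)"
      if "components_smooth ?O (in_coords u c)" for u
    proof -
      have "components_continuous ?O (\<lambda>z. in_coords \<alpha> c z + ext_scale \<i> (?dd (in_coords u c) z))"
        by (intro components_smooth_continuous components_smooth_add components_smooth_scale ch(4) dd_smooth that smooth)
      then have "continuous_on S (\<lambda>z. (in_coords \<alpha> c z + ext_scale \<i> (?dd (in_coords u c) z)) vs)" for vs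
        using S(3) unfolding components_continuous_def by (blast intro: continuous_on_subset)
      then have "continuous_on S (\<lambda>z. in_coords (\<alpha> + form_scale \<i> (del (delbar u))) c z vs)" for vs
        by (rule continuous_on_eq) (use S(3) in \<open>simp only: B subset_iff\<close>)
      then show ?thesis unfolding components_continuous_def by (rule allI)
    qed
    have diff: "in_coords B1 c z - in_coords B2 c z =
        ext_scale \<i> (wedge (?dd (\<lambda>z. zero_form (f z)) z) (wedge_pow (?W z) ?r))" if z: "z \<in> S" for z
    proof -
      note cd = components_smooth_differentiable
      have 1: "in_coords u1 c y - in_coords u2 c y = wedge (zero_form (f y)) (wedge_pow (?W y) ?r)" if "y \<in> S" for y
        using u_diff[OF c(1) inO(2)[OF that]] f(2) that by (simp add: in_coords_def zero_form_wedge)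
      have "?dd (in_coords u1 c) z - ?dd (in_coords u2 c) z = ?dd (\<lambda>z. in_coords u1 c z - in_coords u2 c z) z"
      proof -
        have d1: "local_deriv dir_delbar (\<lambda>z. in_coords u1 c z - in_coords u2 c z) y =
           local_deriv dir_delbar (in_coords u1 c) y - local_deriv dir_delbar (in_coords u2 c) y" if "y \<in> ?O" for y
          unfolding dir_wdir by (intro local_deriv_diff cd[OF smooth(3) that] cd[OF smooth(4) that])
        have "?dd (\<lambda>z. in_coords u1 c z - in_coords u2 c z) z =
           local_deriv dir_del (\<lambda>y. local_deriv dir_delbar (in_coords u1 c) y - local_deriv dir_delbar (in_coords u2 c) y) z"
          unfolding dir_wdir(2) by (rule local_deriv_cong_open[OF ch(4) inO(1)[OF z] d1])
        also have "\<dots> = ?dd (in_coords u1 c) z - ?dd (in_coords u2 c) z"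
          unfolding dir_wdir
          by (intro local_deriv_diff cd[OF components_smooth_deriv[OF ch(4) smooth(3)] inO(1)[OF z]]
              cd[OF components_smooth_deriv[OF ch(4) smooth(4)] inO(1)[OF z]])
        finally show ?thesis ..
      qed
      also have "\<dots> = ?dd (\<lambda>z. wedge (zero_form (f z)) (wedge_pow (?W z) ?r)) z"
      proof -
        have "local_deriv dir_delbar (\<lambda>z. in_coords u1 c z - in_coords u2 c z) y =
          local_deriv dir_delbar (\<lambda>z. wedge (zero_form (f z)) (wedge_pow (?W z) ?r)) y" if "y \<in> S" for y
          unfolding dir_wdir by (rule local_deriv_cong_open[OF S(1) that 1])
        then show ?thesis unfolding dir_wdir(2) by (rule local_deriv_cong_open[OF S(1) z])
      qed
      also have "\<dots> = wedge (?dd (\<lambda>z. zero_form (f z)) z) (wedge_pow (?W z) ?r)"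
        unfolding dir_wdir
      proof (rule second_deriv_wedge_pow[OF S(1) f(1) _ _ _ z])
        show "components_smooth S ?W"
          using smooth(1) smooth_on_subset[OF _ S(3)] by (auto simp: components_smooth_def)
      qed (use kaehler_closed[OF K c(1)] inO(1) in auto)
      finally show ?thesis
        unfolding B1_def B2_def B[OF inO(1)[OF z]]
        by (simp only: add_diff_cancel_left ext_scale_simps(6)[symmetric])
    qed
    have p: "m + ?p = CARD('n) - 1" using m by simp
    have "\<exists>r>0. \<forall>z\<in>ball (snd c x) r. Re (f z) = M"
    proof (rule local_strong_maximum[where W = ?W and ?\<beta>1.0 = "in_coords B1 c" and ?\<beta>2.0 = "in_coords B2 c" and m = m and p = ?p, OF S(1) _ m(1) p])
      show "hermitian (?W z)" if "z \<in> S" for z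
        unfolding in_coords_def by (rule kaehler_hermitian[OF K c(1) inO(2)[OF that]])
      show "components_continuous S ?W"
        using components_smooth_continuous[OF smooth(1)] S(3)
        by (auto simp: components_continuous_def intro: continuous_on_subset)
      show "components_continuous S (in_coords B1 c)" "components_continuous S (in_coords B2 c)"
        unfolding B1_def B2_def by (intro Bc smooth)+
      show "strongly_pos_at m (in_coords B1 c z)" "strongly_pos_at m (in_coords B2 c z)" if "z \<in> S" for z
        using assms(12,13)[folded B1_def B2_def] c(1) inO(2)[OF that]
        unfolding strongly_positive_def in_coords_def by blast+
      show "wedge_pow (hodge_star_at (?W z) (2 * (CARD('n) - 1)) (wedge (in_coords B1 c z) (divided_pow (?W z) ?p))) CARD('n) =
         wedge_pow (hodge_star_at (?W z) (2 * (CARD('n) - 1)) (wedge (in_coords B2 c z) (divided_pow (?W z) ?p))) CARD('n)"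
        if "z \<in> S" for z
        using eqn[folded B1_def B2_def] c(1) inO(2)[OF that]
        by (simp add: form_eq_def form_pow_def hodge_star_def form_wedge_def form_divided_pow_def in_coords_def)
      show "Im (f z) = 0" if "z \<in> S" for z using f(2) that t_real[OF c(1) inO(2)[OF that]] by simp
      show "Re (f z) \<le> M" if "z \<in> S" for z
        using M(2)[of "chart_inv c z"] Ff[OF inO(2)[OF that]] inO[OF that] that ffst by auto
      show "snd c x \<in> S" by (rule S)
      show "Re (f (snd c x)) = M" using M(1) Ff[OF c(2) S(2)] by simp
    qed (use diff f(1) in auto)
    then obtain r where r: "r > 0" "\<forall>z\<in>ball (snd c x) r. Re (f z) = M" by blast
    have "open (S \<inter> ball (snd c x) r)" using S(1) by auto
    from nbhd[OF c(1) this] show "\<exists>V. openin X V \<and> x \<in> V \<and> (\<forall>y\<in>V. F y = M)"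
      using r S(2) c(2) Ff by (intro exI[of _ "{y \<in> fst c. snd c y \<in> S \<inter> ball (snd c x) r}"]) auto
  qed
  then obtain C where C: "\<And>x. x \<in> topspace X \<Longrightarrow> F x = C" by blast
  have "u1 c x = u2 c x + ext_scale (of_real C) (wedge_pow (\<omega> c x) ?r)" if c: "c \<in> A" "x \<in> fst c" for c x
  proof -
    have "x \<in> topspace X" using c man(4) by blast
    then have "t c x = of_real C" using C F[OF c] t_real[OF c] by (simp add: complex_eq_iff)
    then show ?thesis using u_diff[OF c] by (metis diff_eq_eq add.commute)
  qed
  then show ?thesis
    by (intro exI[of _ C]) (simp add: form_eq_def form_scale_def form_pow_def)
qed

end
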